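(* Let $\Omega=(0,1)$, $T>0$, $1<\alpha<2$, $\mu<\frac14$, $u_0\in\mathcal H^1(\Omega)$, $u_1\in L^2(\Omega)$, $q\in L^\infty(0,T)$, $\omega_{\mathrm{obs}}^\delta\in L^2(\Omega)$ and $\lambda>0$. For $p\in L^2(\Omega)$ let $u[p]$ be the unique weak solution of the forward problem $$\begin{cases}{}_0^C D_t^\alpha u-u_{xx}-\dfrac{\mu}{x^2}u=p(x)q(t), & (x,t)\in\Omega\times(0,T),\\ u(x,0)=u_0(x),\quad \partial_t u(x,0)=u_1(x), & x\in\Omega,\\ u(0,t)=u(1,t)=0,& t\in(0,T),\end{cases}$$ put $\mathcal A p:=u[p](\cdot,T)-u[0](\cdot,T)$ and $\omega^\delta:=\omega_{\mathrm{obs}}^\delta-u[0](\cdot,T)$, and define the Tikhonov functional $$\mathcal J_\lambda(p):=\frac12\|\mathcal A p-\omega^\delta\|_{L^2(\Omega)}^2+\frac\lambda2\|p\|_{L^2(\Omega)}^2,\qquad p\in L^2(\Omega).$$ Let $p\in L^2(\Omega)$, let $u[p]$ be the corresponding forward solution, and let $\psi[p]$ solve the adjoint problem $$\begin{cases}{}_tD_T^\alpha\psi-\psi_{xx}-\dfrac{\mu}{x^2}\psi=0, & (x,t)\in\Omega\times(0,T),\\ \psi(0,t)=\psi(1,t)=0, & t\in(0,T),\\ \displaystyle\lim_{t\uparrow T}I_{T-}^{2-\alpha}\psi(\cdot,t)=0, & x\in\Omega,\\ \displaystyle\lim_{t\uparrow T}{}_tD_T^{\alpha-1}\psi(\cdot,t)=r[p],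 & x\in\Omega,\end{cases}$$ where $r[p]=\mathcal A p-\omega^\delta=u[p](\cdot,T)-\omega_{\mathrm{obs}}^\delta$. Then $\mathcal J_\lambda$ is Fréchet differentiable on $L^2(\Omega)$, and its ($L^2(\Omega)$-)gradient is $$\nabla\mathcal J_\lambda(p)=\int_0^T q(t)\,\psi[p](\cdot,t)\,dt+\lambda p.$$
   Context: Here $\mu$ is a real number with $\mu<1/4$ and $\Omega=(0,1)$. For $v,w\in H_0^1(\Omega)$ put $a_\mu(v,w)=\int_0^1 v_xw_x\,dx-\mu\int_0^1\frac{vw}{x^2}\,dx$. By Hardy's inequality $\int_0^1|v|^2/x^2\,dx\le 4\int_0^1|v_x|^2\,dx$ this is a continuous, symmetric, coercive form on $H_0^1(\Omega)$. Let $L_\mu$ be the associated positive self-adjoint operator in $L^2(\Omega)$ (the Friedrichs realization of $-\frac{d^2}{dx^2}-\frac{\mu}{x^2}$ with homogeneous Dirichlet conditions): $v\in D(L_\mu)$ and $L_\mu v=g$ iff $v\in H_0^1(\Omega)$, $g\in L^2(\Omega)$ and $a_\mu(v,\varphi)=(g,\varphi)_{L^2(\Omega)}$ for all $\varphi\in H_0^1(\Omega)$. $L_\mu$ has compact resolvent; let $\{\phi_n\}_{n\ge1}$ be an orthonormal basis of $L^2(\Omega)$ of eigenfunctions, $L_\mu\phi_n=\lambda_n\phi_n$, $0<\lambda_1\le\lambda_2\le\cdots\to\infty$. For $\sigma\ge0$, $\mathcal H^\sigma(\Omega)=D(L_\mu^{\sigma/2})$ with $\|v\|_{\mathcal H^\sigma}^2=\sum_n\lambda_n^\sigma|(v,\phi_n)_{L^2(\Omega)}|^2$;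 for $\sigma<0$, $\mathcal H^\sigma(\Omega)$ is the completion of $L^2(\Omega)$ in the norm given by the same formula, equivalently $\mathcal H^{\sigma}=(\mathcal H^{-\sigma})'$ with pivot space $L^2(\Omega)$. In particular $\mathcal H^1(\Omega)=H_0^1(\Omega)$ with the equivalent norm $a_\mu(v,v)^{1/2}$. Caputo derivative of order $1<\alpha<2$: ${}_0^C D_t^\alpha u(t)=\frac{1}{\Gamma(2-\alpha)}\int_0^t(t-s)^{1-\alpha}u''(s)\,ds=I_{0+}^{2-\alpha}u''(t)$, where $I_{0+}^{2-\alpha}$ is the left-sided Riemann–Liouville fractional integral of order $2-\alpha$. Weak solution of the forward problem: with $f(t):=p\,q(t)$, a function $u$ is a weak solution if $u\in C([0,T];\mathcal H^1(\Omega))\cap C^1([0,T];\mathcal H^{-1}(\Omega))$, ${}_0^C D_t^\alpha u\in L^2(0,T;\mathcal H^{-1}(\Omega))$, $u(\cdot,0)=u_0$ in $\mathcal H^1(\Omega)$, $\partial_tu(\cdot,0)=u_1$ in $\mathcal H^{-1}(\Omega)$, and for a.e. $t\in(0,T)$ $$\langle {}_0^C D_t^\alpha u(t),v\rangle_{\mathcal H^{-1},\mathcal H^1}+a_\mu(u(t),v)=(f(t),v)_{L^2(\Omega)}\qquad\forall v\in\mathcal H^1(\Omega).$$ For every $p\in L^2(\Omega)$ (and $q,u_0,u_1$ as in the claim) there is a unique weak solution, so $u[p](\cdot,T)$ is well defined; $u[0]$ is the solution with $p=0$ and the same initial data. The operator $\mathcal A:L^2(\Omega)\to L^2(\Omega)$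 is linear and bounded. The function $\omega_{\mathrm{obs}}^\delta$ plays the role of noisy terminal data, with $\|\omega_{\mathrm{obs}}^\delta-\omega_{\mathrm{obs}}\|_{L^2(\Omega)}\le\delta$ for the exact terminal data $\omega_{\mathrm{obs}}$. Right-sided Riemann–Liouville fractional operators: for $\beta>0$, $(I_{T-}^{\beta}\psi)(t)=\frac1{\Gamma(\beta)}\int_t^T(s-t)^{\beta-1}\psi(s)\,ds$; for $1<\alpha<2$, ${}_tD_T^\alpha\psi(t)=\frac{d^2}{dt^2}(I_{T-}^{2-\alpha}\psi)(t)$ and ${}_tD_T^{\alpha-1}\psi(t)=-\frac{d}{dt}(I_{T-}^{2-\alpha}\psi)(t)$. The terminal conditions in the adjoint problem are fractional terminal conditions, the terminal quantities being understood as fractional traces at $T$ from the left. *)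

theory Defs
  imports "HOL-Analysis.Analysis"
begin

lemma closed_subspace_projection:
  fixes V :: "'a::{real_inner,complete_space} set"
  assumes V: "subspace V" "closed V"
  shows "\<exists>m\<in>V. \<forall>v\<in>V. inner (x - m) v = 0"
proof -
  define d where "d = infdist x V"
  have ne: "V \<noteq> {}" using V(1) subspace_0 by blast
  have d0: "0 \<le> d" by (simp add: d_def infdist_nonneg)
  have dle: "d\<^sup>2 \<le> (norm (x - v))\<^sup>2" if "v \<in> V" for v
    using infdist_le[OF that, of x] d0 by (simp add: d_def dist_norm power_mono)
  have "\<exists>v\<in>V. norm (x - v) < d + 1 / real (Suc n)" for n
  proof -
    have "infdist x V < d + 1 / real (Suc n)" by (simp add: d_def)
    then have "(INF a\<in>V. dist x a) < d + 1 / real (Suc n)"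
      using ne by (simp add: infdist_def)
    then obtain v where "v \<in> V" "dist x v < d + 1 / real (Suc n)"
      using ne by (subst (asm) cINF_less_iff) auto
    then show ?thesis by (auto simp: dist_norm)
  qed
  then obtain m where m: "\<And>n. m n \<in> V" "\<And>n. norm (x - m n) < d + 1 / real (Suc n)"
    by metis
  have lim: "(\<lambda>n. (norm (x - m n))\<^sup>2) \<longlonglongrightarrow> d\<^sup>2"
  proof (rule tendsto_power, rule tendsto_sandwich[where f = "\<lambda>_. d" and h = "\<lambda>n. d + 1 / real (Suc n)"])
    show "\<forall>\<^sub>F n in sequentially. d \<le> norm (x - m n)"
      using m(1) infdist_le[of _ V x] by (auto simp: d_def dist_norm)
    show "\<forall>\<^sub>F n in sequentially. norm (x - m n) \<le> d + 1 / real (Suc n)"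
      by (rule always_eventually) (use m(2) less_imp_le in blast)
    show "(\<lambda>n. d + 1 / real (Suc n)) \<longlonglongrightarrow> d"
      using tendsto_add[OF tendsto_const[of d] LIMSEQ_inverse_real_of_nat]
      by (simp add: inverse_eq_divide)
  qed auto
  have para: "(norm (m i - m j))\<^sup>2 \<le> 2 * ((norm (x - m i))\<^sup>2 - d\<^sup>2) + 2 * ((norm (x - m j))\<^sup>2 - d\<^sup>2)" for i j
  proof -
    have "(1/2) *\<^sub>R (m i + m j) \<in> V"
      using V(1) m(1) by (intro subspace_scale subspace_add) auto
    from dle[OF this] have "4 * d\<^sup>2 \<le> (norm (2 *\<^sub>R (x - (1/2) *\<^sub>R (m i + m j))))\<^sup>2"
      by (simp add: power_mult_distrib)
    moreover have "2 *\<^sub>R (x - (1/2) *\<^sub>R (m i + m j)) = (x - m i) + (x - m j)"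
      by (simp add: algebra_simps scaleR_2)
    moreover have "(norm (m i - m j))\<^sup>2 + (norm ((x - m i) + (x - m j)))\<^sup>2
        = 2 * (norm (x - m i))\<^sup>2 + 2 * (norm (x - m j))\<^sup>2"
      by (simp add: power2_norm_eq_inner algebra_simps inner_commute)
    ultimately show ?thesis by simp
  qed
  have "Cauchy m"
  proof (rule metric_CauchyI)
    fix e :: real assume e: "0 < e"
    then have "0 < e\<^sup>2 / 4" by simp
    from LIMSEQ_D[OF lim this] obtain N where N: "\<And>n. n \<ge> N \<Longrightarrow> \<bar>(norm (x - m n))\<^sup>2 - d\<^sup>2\<bar> < e\<^sup>2 / 4"
      by auto
    have "dist (m i) (m j) < e" if "i \<ge> N" "j \<ge> N" for i j
    proof -
      have "(norm (m i - m j))\<^sup>2 < e\<^sup>2"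
        using para[of i j] N[OF that(1)] N[OF that(2)]
          abs_ge_self[of "(norm (x - m i))\<^sup>2 - d\<^sup>2"] abs_ge_self[of "(norm (x - m j))\<^sup>2 - d\<^sup>2"]
        by simp
      then show ?thesis using e by (simp add: dist_norm power_less_imp_less_base)
    qed
    then show "\<exists>M. \<forall>i\<ge>M. \<forall>j\<ge>M. dist (m i) (m j) < e" by blast
  qed
  then obtain l where l: "m \<longlonglongrightarrow> l"
    using Cauchy_convergent convergent_def by blast
  have lV: "l \<in> V" using closed_sequentially[OF V(2) _ l] m(1) by blast
  have "(\<lambda>n. (norm (x - m n))\<^sup>2) \<longlonglongrightarrow> (norm (x - l))\<^sup>2"
    by (intro tendsto_intros l)
  then have nl: "(norm (x - l))\<^sup>2 = d\<^sup>2" using lim LIMSEQ_unique by blast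
  have "inner (x - l) v = 0" if v: "v \<in> V" for v
  proof (cases "v = 0")
    case False
    define t where "t = inner (x - l) v / inner v v"
    have vv: "inner v v > 0" using False by simp
    have "l + t *\<^sub>R v \<in> V" using V(1) lV v by (intro subspace_add subspace_scale)
    from dle[OF this] have "(norm (x - l))\<^sup>2 \<le> (norm ((x - l) - t *\<^sub>R v))\<^sup>2"
      using nl by (simp add: diff_diff_eq)
    also have "\<dots> = (norm (x - l))\<^sup>2 - 2 * t * inner (x - l) v + t\<^sup>2 * inner v v"
      unfolding power2_norm_eq_inner
      by (simp add: inner_diff_left inner_diff_right inner_commute power2_eq_square algebra_simps)
    also have "\<dots> = (norm (x - l))\<^sup>2 - (inner (x - l) v)\<^sup>2 / inner v v"
      using vv by (simp add: t_def power2_eq_square field_simps)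
    finally have "(inner (x - l) v)\<^sup>2 / inner v v \<le> 0" by simp
    then show ?thesis using vv
      by (smt (verit) divide_pos_pos zero_less_power2)
  qed simp
  then show ?thesis using lV by blast
qed

lemma second_countable_if_countable_dense:
  fixes D :: "'a::metric_space set"
  assumes D: "countable D" "closure D = UNIV"
  shows "\<exists>B :: 'a set set. countable B \<and> open = generate_topology B"
proof (intro exI conjI)
  let ?B = "(\<lambda>(d, n). ball d (1 / real (Suc n))) ` (D \<times> (UNIV :: nat set))"
  show "countable ?B" using D(1) by auto
  have "topological_basis ?B"
  proof (rule topological_basisI)
    fix U :: "'a set" and x assume U: "open U" "x \<in> U"
    then obtain e where e: "0 < e" "ball x e \<subseteq> U" by (meson openE)
    obtain n where n: "1 / real (Suc n) < e / 2" using nat_approx_posE[of "e/2"] e(1) by auto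
    have "x \<in> closure D" using D(2) by simp
    then obtain d where d: "d \<in> D" "dist d x < 1 / real (Suc n)"
      unfolding closure_approachable by (meson of_nat_0_less_iff zero_less_Suc zero_less_divide_1_iff)
    have "ball d (1 / real (Suc n)) \<subseteq> ball x e"
    proof
      fix y assume "y \<in> ball d (1 / real (Suc n))"
      then have "dist x y < e" using d(2) n dist_triangle[of x y d] by (simp add: dist_commute)
      then show "y \<in> ball x e" by simp
    qed
    then show "\<exists>B'\<in>?B. x \<in> B' \<and> B' \<subseteq> U"
      using d e(2) by (intro bexI[of _ "ball d (1 / real (Suc n))"]) auto
  qed auto
  then show "open = generate_topology ?B" by (rule topological_basis_imp_subbasis)
qed

lemma subspace_closure_if_rational_subspace:
  fixes D :: "'a::real_normed_vector set"
  assumes 0: "0 \<in> D"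
    and add: "\<And>x y. x \<in> D \<Longrightarrow> y \<in> D \<Longrightarrow> x + y \<in> D"
    and scale: "\<And>r x. x \<in> D \<Longrightarrow> of_rat r *\<^sub>R x \<in> D"
  shows "subspace (closure D)"
proof (rule subspaceI)
  show "0 \<in> closure D" using 0 closure_subset by blast
  show "x + y \<in> closure D" if xy: "x \<in> closure D" "y \<in> closure D" for x y
  proof -
    obtain f g where "\<And>n. f n \<in> D" "f \<longlonglongrightarrow> x" "\<And>n. g n \<in> D" "g \<longlonglongrightarrow> y"
      using xy unfolding closure_sequential by blast
    then show ?thesis unfolding closure_sequential
      by (intro exI[of _ "\<lambda>n. f n + g n"]) (auto intro: tendsto_add add)
  qed
  show "c *\<^sub>R x \<in> closure D" if x: "x \<in> closure D" for c x
  proof -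
    obtain f where f: "\<And>n. f n \<in> D" "f \<longlonglongrightarrow> x"
      using x unfolding closure_sequential by blast
    have "\<exists>r. \<bar>of_rat r - c\<bar> < 1 / real (Suc n)" for n
    proof -
      obtain r where "c - 1 / real (Suc n) < of_rat r" "of_rat r < c"
        using of_rat_dense[of "c - 1 / real (Suc n)" c] by auto
      then show ?thesis by (intro exI[of _ r]) linarith
    qed
    then obtain r where r: "\<And>n. \<bar>of_rat (r n) - c\<bar> < 1 / real (Suc n)" by metis
    have "(\<lambda>n. of_rat (r n)) \<longlonglongrightarrow> c"
    proof (rule LIM_zero_cancel, rule Lim_null_comparison)
      show "\<forall>\<^sub>F n in sequentially. norm (of_rat (r n) - c) \<le> inverse (real (Suc n))"
        by (rule always_eventually) (use r[THEN less_imp_le] in \<open>simp add: inverse_eq_divide\<close>)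
    qed (rule LIMSEQ_inverse_real_of_nat)
    then have "(\<lambda>n. of_rat (r n) *\<^sub>R f n) \<longlonglongrightarrow> c *\<^sub>R x" using f(2) by (rule tendsto_scaleR)
    then show ?thesis unfolding closure_sequential
      using scale f(1) by (intro exI[of _ "\<lambda>n. of_rat (r n) *\<^sub>R f n"]) simp
  qed
qed

lemma countable_dense_if_countable_total:
  fixes S :: "'a::real_normed_vector set"
  assumes S: "countable S" "closure (span S) = UNIV"
  shows "\<exists>D :: 'a set. countable D \<and> closure D = UNIV"
proof -
  define f :: "(rat \<times> 'a) list \<Rightarrow> 'a" where "f = (\<lambda>xs. \<Sum>(r, s)\<leftarrow>xs. of_rat r *\<^sub>R s)"
  define D where "D = f ` lists (UNIV \<times> S)"
  have "countable D" using S(1) by (auto simp: D_def)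
  have D: "f xs \<in> D" if "set xs \<subseteq> UNIV \<times> S" for xs
    using that unfolding D_def lists_eq_set by (intro imageI) simp
  have DE: "\<exists>xs. set xs \<subseteq> UNIV \<times> S \<and> x = f xs" if "x \<in> D" for x
    using that unfolding D_def lists_eq_set by blast
  have "subspace (closure D)"
  proof (rule subspace_closure_if_rational_subspace)
    show "0 \<in> D" using D[of "[]"] by (simp add: f_def)
    show "x + y \<in> D" if xy: "x \<in> D" "y \<in> D" for x y
    proof -
      obtain xs ys where "set xs \<subseteq> UNIV \<times> S" "x = f xs" "set ys \<subseteq> UNIV \<times> S" "y = f ys"
        using DE xy by metis
      then show ?thesis using D[of "xs @ ys"] by (simp add: f_def)
    qed
    show "of_rat r *\<^sub>R x \<in> D" if x: "x \<in> D" for r x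
    proof -
      obtain xs where xs: "set xs \<subseteq> UNIV \<times> S" "x = f xs" using DE x by metis
      have "f (map (\<lambda>(r', s). (r * r', s)) xs) = of_rat r *\<^sub>R f xs"
        by (induction xs) (auto simp: f_def of_rat_mult scaleR_add_right)
      moreover have "set (map (\<lambda>(r', s). (r * r', s)) xs) \<subseteq> UNIV \<times> S"
        using xs(1) by auto
      ultimately show ?thesis using xs(2) D by metis
    qed
  qed
  moreover have "S \<subseteq> closure D"
  proof
    fix s assume "s \<in> S"
    then have "s \<in> D" using D[of "[(1, s)]"] by (simp add: f_def)
    then show "s \<in> closure D" using closure_subset by blast
  qed
  ultimately have "span S \<subseteq> closure D" by (simp add: span_minimal)
  then have "closure (span S) \<subseteq> closure D" by (metis closure_minimal closed_closure)
  then have "closure D = UNIV" using S(2) by auto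
  with \<open>countable D\<close> show ?thesis by blast
qed

lemma subspace_closure:
  fixes S :: "'a::real_normed_vector set"
  assumes S: "subspace S"
  shows "subspace (closure S)"
proof (rule subspaceI)
  show "0 \<in> closure S" using S subspace_0 closure_subset by blast
  show "x + y \<in> closure S" if xy: "x \<in> closure S" "y \<in> closure S" for x y
  proof -
    obtain f g where "\<And>n. f n \<in> S" "f \<longlonglongrightarrow> x" "\<And>n. g n \<in> S" "g \<longlonglongrightarrow> y"
      using xy unfolding closure_sequential by blast
    then show ?thesis unfolding closure_sequential
      using S by (intro exI[of _ "\<lambda>n. f n + g n"]) (auto intro: tendsto_add subspace_add)
  qed
  show "c *\<^sub>R x \<in> closure S" if x: "x \<in> closure S" for c x
  proof -
    obtain f where "\<And>n. f n \<in> S" "f \<longlonglongrightarrow> x"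
      using x unfolding closure_sequential by blast
    then show ?thesis unfolding closure_sequential
      using S by (intro exI[of _ "\<lambda>n. c *\<^sub>R f n"]) (auto intro: tendsto_intros subspace_scale)
  qed
qed

lemma riesz_representation:
  fixes F :: "'a::{real_inner,complete_space} \<Rightarrow> real"
  assumes F: "bounded_linear F"
  shows "\<exists>y. \<forall>x. F x = inner y x"
proof (cases "\<forall>x. F x = 0")
  case False
  interpret F: bounded_linear F by fact
  obtain x where x: "F x \<noteq> 0" using False by blast
  have cl: "closed {v. F v = 0}"
    by (intro closed_Collect_eq continuous_intros F.continuous_on)
  have "subspace {v. F v = 0}"
    by (auto simp: subspace_def F.add F.scaleR)
  from closed_subspace_projection[OF this cl, of x] obtain m
    where m: "F m = 0" "\<And>v. F v = 0 \<Longrightarrow> inner (x - m) v = 0" by auto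
  let ?z = "x - m"
  have z: "F ?z = F x" "?z \<noteq> 0" using m(1) x F.zero by (auto simp: F.diff)
  have "F v = inner ((F x / inner ?z ?z) *\<^sub>R ?z) v" for v
  proof -
    have "F (v - (F v / F x) *\<^sub>R ?z) = 0" using z x by (simp add: F.diff F.scaleR)
    from m(2)[OF this] have "inner ?z v = F v / F x * inner ?z ?z"
      by (simp add: inner_diff_right)
    then show ?thesis using x z by simp
  qed
  then show ?thesis by blast
qed (auto intro: exI[of _ 0])

instance blinfun :: ("{real_inner,polish_space}", euclidean_space) polish_space
proof
  obtain D0 :: "'a set" where D0: "countable D0" "\<And>U. open U \<Longrightarrow> U \<noteq> {} \<Longrightarrow> \<exists>d\<in>D0. d \<in> U"
    using countable_dense_exists by blast
  let ?f = "\<lambda>(d :: 'a, b :: 'b). blinfun_scaleR_left b o\<^sub>L blinfun_inner_right d"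
  let ?S = "?f ` (D0 \<times> Basis)"
  have "F \<in> closure (span ?S)" for F :: "'a \<Rightarrow>\<^sub>L 'b"
  proof -
    have "\<exists>y. \<forall>x. inner (F x) b = inner y x" for b :: 'b
      by (rule riesz_representation) (intro bounded_linear_intros)
    then obtain y where y: "\<And>b x. inner (F x) b = inner (y b) x" by metis
    have "?f (z, b) \<in> closure (span ?S)" if b: "b \<in> Basis" for z b
    proof -
      have "z \<in> closure D0"
        using D0(2) by (auto simp: closure_iff_nhds_not_empty)
      then obtain d where d: "\<And>n. d n \<in> D0" "d \<longlonglongrightarrow> z" unfolding closure_sequential by blast
      have "(\<lambda>n. ?f (d n, b)) \<longlonglongrightarrow> ?f (z, b)"
        unfolding split_conv
        by (rule bounded_bilinear.tendsto[OF bounded_bilinear_blinfun_compose tendsto_const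
              bounded_linear.tendsto[OF bounded_linear_blinfun_inner_right d(2)]])
      moreover have "?f (d n, b) \<in> span ?S" for n using d(1) b by (intro span_base) auto
      ultimately show ?thesis unfolding closure_sequential by (intro exI[of _ "\<lambda>n. ?f (d n, b)"] conjI allI)
    qed
    then have "(\<Sum>b\<in>Basis. ?f (y b, b)) \<in> closure (span ?S)"
      by (intro subspace_sum subspace_closure subspace_span)
    moreover have "(\<Sum>b\<in>Basis. ?f (y b, b)) = F"
      by (rule blinfun_eqI)
         (simp add: blinfun.sum_left y[symmetric] euclidean_representation)
    ultimately show ?thesis by simp
  qed
  then have "closure (span ?S) = UNIV" by blast
  moreover have "countable ?S" using D0(1) by (simp add: countable_finite)
  ultimately obtain D :: "('a \<Rightarrow>\<^sub>L 'b) set" where "countable D" "closure D = UNIV"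
    using countable_dense_if_countable_total by meson
  then show "\<exists>B :: ('a \<Rightarrow>\<^sub>L 'b) set set. countable B \<and> open = generate_topology B"
    by (rule second_countable_if_countable_dense)
qed

definition unit_interval :: "real measure"
  where "unit_interval = restrict_space lborel {0<..<1}"

lemma space_unit_interval [simp]: "space unit_interval = {0<..<1}"
  by (simp add: unit_interval_def space_restrict_space)

lemma finite_measure_unit_interval: "finite_measure unit_interval"
  by (rule finite_measureI) (simp add: unit_interval_def emeasure_restrict_space space_restrict_space)

definition sq_integrable :: "(real \<Rightarrow> real) \<Rightarrow> bool"
  where "sq_integrable f \<longleftrightarrow> f \<in> borel_measurable unit_interval \<and> integrable unit_interval (\<lambda>x. (f x)\<^sup>2)"

lemma sq_integrable_mult:
  assumes "sq_integrable f" "sq_integrable g"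
  shows "integrable unit_interval (\<lambda>x. f x * g x)"
proof (rule Bochner_Integration.integrable_bound)
  show "integrable unit_interval (\<lambda>x. (f x)\<^sup>2 + (g x)\<^sup>2)"
    using assms by (auto simp: sq_integrable_def)
  show "(\<lambda>x. f x * g x) \<in> borel_measurable unit_interval"
    using assms by (auto simp: sq_integrable_def)
  have "\<bar>a * b\<bar> \<le> a\<^sup>2 + b\<^sup>2" for a b :: real
  proof -
    have "2 * (\<bar>a\<bar> * \<bar>b\<bar>) \<le> a\<^sup>2 + b\<^sup>2"
      using sum_squares_bound[of "\<bar>a\<bar>" "\<bar>b\<bar>"] by (simp add: mult.assoc)
    moreover have "0 \<le> \<bar>a\<bar> * \<bar>b\<bar>" by simp
    ultimately show ?thesis unfolding abs_mult by linarith
  qed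
  then show "AE x in unit_interval. norm (f x * g x) \<le> norm ((f x)\<^sup>2 + (g x)\<^sup>2)"
    by simp
qed

lemma sq_integrable_add:
  assumes "sq_integrable f" "sq_integrable g"
  shows "sq_integrable (\<lambda>x. f x + g x)"
proof -
  have "integrable unit_interval (\<lambda>x. (f x)\<^sup>2 + (g x)\<^sup>2 + 2 * (f x * g x))"
    using assms sq_integrable_mult[OF assms] by (auto simp: sq_integrable_def)
  then show ?thesis
    using assms by (auto simp: sq_integrable_def power2_sum mult.assoc)
qed

lemma sq_integrable_scale:
  assumes "sq_integrable f"
  shows "sq_integrable (\<lambda>x. c * f x)"
  using assms by (auto simp: sq_integrable_def power_mult_distrib)

text \<open>\<open>L\<^sup>2(0,1)\<close> over the reals. On arguments that are not square integrable \<open>to_l2\<close> is unspecified.\<close>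

quotient_type l2 = "real \<Rightarrow> real" / partial:
  "\<lambda>f g. sq_integrable f \<and> sq_integrable g \<and> (AE x in unit_interval. f x = g x)"
  morphisms rep_l2 to_l2
proof (rule part_equivpI)
  show "\<exists>f. sq_integrable f \<and> sq_integrable f \<and> (AE x in unit_interval. f x = f x)"
    by (rule exI[of _ "\<lambda>_. 0"]) (simp add: sq_integrable_def)
  show "symp (\<lambda>f g. sq_integrable f \<and> sq_integrable g \<and> (AE x in unit_interval. f x = g x))"
    by (rule sympI) (auto simp: eq_commute)
  show "transp (\<lambda>f g. sq_integrable f \<and> sq_integrable g \<and> (AE x in unit_interval. f x = g x))"
  proof (rule transpI, elim conjE, intro conjI)
    fix f g h :: "real \<Rightarrow> real"
    assume "AE x in unit_interval. f x = g x" "AE x in unit_interval. g x = h x"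
    then show "AE x in unit_interval. f x = h x" by eventually_elim simp
  qed
qed

lemma sq_integrable_rep: "sq_integrable (rep_l2 f)"
  using Quotient_rep_reflp[OF Quotient_l2, of f] by simp

lemma to_l2_rep [simp]: "to_l2 (rep_l2 f) = f"
  by (rule Quotient_abs_rep[OF Quotient_l2])

lemma to_l2_eq_iff:
  assumes "sq_integrable f" "sq_integrable g"
  shows "to_l2 f = to_l2 g \<longleftrightarrow> (AE x in unit_interval. f x = g x)"
  using Quotient_rel[OF Quotient_l2] assms by blast

lemma rep_to_l2:
  assumes "sq_integrable f"
  shows "AE x in unit_interval. rep_l2 (to_l2 f) x = f x"
  using Quotient_rep_abs[OF Quotient_l2, of f] assms by simp

instantiation l2 :: real_inner
begin

lift_definition zero_l2 :: l2 is "\<lambda>_. 0"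
  by (simp add: sq_integrable_def)

lift_definition plus_l2 :: "l2 \<Rightarrow> l2 \<Rightarrow> l2" is "\<lambda>f g x. f x + g x"
  using sq_integrable_add by auto

lift_definition scaleR_l2 :: "real \<Rightarrow> l2 \<Rightarrow> l2" is "\<lambda>c f x. c * f x"
  using sq_integrable_scale by auto

lift_definition uminus_l2 :: "l2 \<Rightarrow> l2" is "\<lambda>f x. - f x"
  using sq_integrable_scale[of _ "-1"] by auto

lift_definition inner_l2 :: "l2 \<Rightarrow> l2 \<Rightarrow> real" is "\<lambda>f g. integral\<^sup>L unit_interval (\<lambda>x. f x * g x)"
proof -
  fix f f' g g' :: "real \<Rightarrow> real"
  assume 1: "sq_integrable f \<and> sq_integrable f' \<and> (AE x in unit_interval. f x = f' x)"
    and 2: "sq_integrable g \<and> sq_integrable g' \<and> (AE x in unit_interval. g x = g' x)"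
  show "integral\<^sup>L unit_interval (\<lambda>x. f x * g x) = integral\<^sup>L unit_interval (\<lambda>x. f' x * g' x)"
    using 1 2 by (intro integral_cong_AE) (auto simp: sq_integrable_def)
qed

definition minus_l2 :: "l2 \<Rightarrow> l2 \<Rightarrow> l2" where "minus_l2 f g = f + (- g)"
definition norm_l2 :: "l2 \<Rightarrow> real" where "norm_l2 f = sqrt (inner f f)"
definition sgn_l2 :: "l2 \<Rightarrow> l2" where "sgn_l2 f = scaleR (inverse (norm f)) f"
definition dist_l2 :: "l2 \<Rightarrow> l2 \<Rightarrow> real" where "dist_l2 f g = norm (f - g)"
definition uniformity_l2 :: "(l2 \<times> l2) filter"
  where "uniformity_l2 = (INF e\<in>{0 <..}. principal {(x, y). dist x y < e})"
definition open_l2 :: "l2 set \<Rightarrow> bool"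
  where "open_l2 U \<longleftrightarrow> (\<forall>x\<in>U. \<forall>\<^sub>F (x', y) in uniformity. x' = x \<longrightarrow> y \<in> U)"

instance
proof
  fix f g h :: l2 and a b c :: real
  show "f + g + h = f + (g + h)"
    by transfer (auto simp: add.assoc intro!: sq_integrable_add)
  show "f + g = g + f"
    by transfer (auto simp: add.commute intro!: sq_integrable_add)
  show "0 + f = f"
    by transfer auto
  show "- f + f = 0"
    by transfer (auto simp: sq_integrable_def)
  show "f - g = f + - g"
    by (simp add: minus_l2_def)
  show "a *\<^sub>R (f + g) = a *\<^sub>R f + a *\<^sub>R g"
    by transfer (auto simp: distrib_left intro!: sq_integrable_add sq_integrable_scale)
  show "(a + b) *\<^sub>R f = a *\<^sub>R f + b *\<^sub>R f"
    by transfer (auto simp: distrib_right intro!: sq_integrable_add sq_integrable_scale)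
  show "a *\<^sub>R b *\<^sub>R f = (a * b) *\<^sub>R f"
    by transfer (auto simp: mult.assoc intro!: sq_integrable_scale)
  show "1 *\<^sub>R f = f"
    by transfer auto
  show "sgn f = scaleR (inverse (norm f)) f" by (rule sgn_l2_def)
  show "dist f g = norm (f - g)" by (rule dist_l2_def)
  show "(uniformity :: (l2 \<times> l2) filter) = (INF e\<in>{0 <..}. principal {(x, y). dist x y < e})"
    by (rule uniformity_l2_def)
  show "norm f = sqrt (inner f f)" by (rule norm_l2_def)
  show "inner f g = inner g f"
    by transfer (simp add: mult.commute)
  show "inner (f + g) h = inner f h + inner g h"
    by transfer (simp add: distrib_right Bochner_Integration.integral_add[OF sq_integrable_mult sq_integrable_mult])
  show "inner (a *\<^sub>R f) g = a * inner f g"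
    by transfer (simp add: mult.assoc)
  show "0 \<le> inner f f"
    by transfer simp
  show "inner f f = 0 \<longleftrightarrow> f = 0"
    by transfer
       (auto simp: sq_integrable_def integral_nonneg_eq_0_iff_AE power2_eq_square)
  show "open U = (\<forall>x\<in>U. \<forall>\<^sub>F (x', y) in uniformity. x' = x \<longrightarrow> y \<in> U)" for U :: "l2 set"
    by (rule open_l2_def)
qed

end

lemma inner_to_l2:
  assumes "sq_integrable f" "sq_integrable g"
  shows "inner (to_l2 f) (to_l2 g) = integral\<^sup>L unit_interval (\<lambda>x. f x * g x)"
  using assms by (simp add: inner_l2.abs_eq)

lemma to_l2_add:
  "\<lbrakk>sq_integrable f; sq_integrable g\<rbrakk> \<Longrightarrow> to_l2 (\<lambda>x. f x + g x) = to_l2 f + to_l2 g"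
  by (simp add: plus_l2.abs_eq)

lemma to_l2_scale:
  "sq_integrable f \<Longrightarrow> to_l2 (\<lambda>x. c * f x) = c *\<^sub>R to_l2 f"
  by (simp add: scaleR_l2.abs_eq)

lemma sq_integrable_bounded:
  assumes "f \<in> borel_measurable unit_interval" "\<And>x. \<bar>f x\<bar> \<le> B"
  shows "sq_integrable f"
  unfolding sq_integrable_def
proof (intro conjI assms(1) finite_measure.integrable_const_bound[OF finite_measure_unit_interval])
  show "AE x in unit_interval. norm ((f x)\<^sup>2) \<le> B\<^sup>2"
    using power_mono[OF assms(2) abs_ge_zero, of _ 2] by simp
qed (use assms in auto)

lemma sq_integrable_indicator: "A \<in> sets borel \<Longrightarrow> sq_integrable (indicator A)"
  by (rule sq_integrable_bounded[where B = 1]) (auto simp: unit_interval_def indicator_def intro: measurable_restrict_space1)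

lemma sq_integrable_integrable:
  assumes "sq_integrable f" shows "integrable unit_interval f"
  using sq_integrable_mult[OF assms sq_integrable_indicator[of UNIV]] by simp

lemma l2_inner_eq: "inner f g = integral\<^sup>L unit_interval (\<lambda>x. rep_l2 f x * rep_l2 g x)"
  using inner_to_l2[OF sq_integrable_rep sq_integrable_rep, of f g] by simp

lemma inner_to_l2_left:
  assumes "sq_integrable g"
  shows "inner f (to_l2 g) = integral\<^sup>L unit_interval (\<lambda>x. rep_l2 f x * g x)"
  using inner_to_l2[OF sq_integrable_rep assms, of f] by simp

lemma borel_eq_rat_atMost: "(borel :: real measure) = sigma UNIV (range (\<lambda>r::rat. {..of_rat r}))"
proof (rule borel_eq_sigmaI1[OF borel_eq_atMost])
  fix U :: "real set" assume "U \<in> range (\<lambda>a. {..a})"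
  then obtain a where a: "U = {..a}" by blast
  let ?M = "sigma UNIV (range (\<lambda>r::rat. {..real_of_rat r}))"
  have "{..a} = (\<Inter>r\<in>{r::rat. a < of_rat r}. {..real_of_rat r})"
  proof (intro set_eqI iffI)
    fix x assume x: "x \<in> (\<Inter>r\<in>{r::rat. a < of_rat r}. {..real_of_rat r})"
    show "x \<in> {..a}"
    proof (rule ccontr)
      assume "x \<notin> {..a}"
      then obtain r where "a < of_rat r" "of_rat r < x" using of_rat_dense[of a x] by auto
      then show False using x by force
    qed
  qed auto
  moreover have "{r::rat. a < of_rat r} \<noteq> {}"
    using of_rat_dense[of a "a + 1"] by auto
  moreover have "(\<lambda>r. {..real_of_rat r}) ` {r. a < of_rat r} \<subseteq> sets ?M"
    by auto
  ultimately show "U \<in> sets ?M"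
    using sets.countable_INT'[of "{r. a < of_rat r}" "\<lambda>r. {..real_of_rat r}" ?M] a by simp
qed auto

lemma l2_orthogonal_imp_zero:
  assumes z: "\<And>r. inner z (to_l2 (indicator {..real_of_rat r})) = 0"
  shows "z = 0"
proof -
  let ?f = "rep_l2 z"
  interpret finite_measure unit_interval by (rule finite_measure_unit_interval)
  have f: "integrable unit_interval ?f" by (rule sq_integrable_integrable[OF sq_integrable_rep])
  have sets: "sets unit_interval = sets.restricted_space borel {0<..<1}"
    by (simp add: unit_interval_def sets_restrict_space)
  have gen: "(LINT x:{..real_of_rat r}|unit_interval. ?f x) = 0" for r
    using z[of r] by (simp add: inner_to_l2_left sq_integrable_indicator set_lebesgue_integral_def mult.commute)
  have meas: "A \<inter> {0<..<1} \<in> sets unit_interval" if "A \<in> sets borel" for A :: "real set"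
    using that by (auto simp: unit_interval_def sets_restrict_space)
  have si: "set_integrable unit_interval (A \<inter> {0<..<1}) ?f" if "A \<in> sets borel" for A
    using integrable_mult_indicator[OF meas[OF that] f] by (simp add: set_integrable_def)
  have cut: "(LINT x:(A \<inter> {0<..<1})|unit_interval. ?f x) = (LINT x:A|unit_interval. ?f x)" for A
    unfolding set_lebesgue_integral_def by (rule Bochner_Integration.integral_cong) (auto simp: indicator_def)
  have UNIV0: "(LINT x:UNIV|unit_interval. ?f x) = 0"
  proof -
    have "(LINT x:UNIV|unit_interval. ?f x) = (LINT x:{..real_of_rat 1}|unit_interval. ?f x)"
      unfolding set_lebesgue_integral_def by (rule Bochner_Integration.integral_cong) (auto simp: indicator_def)
    then show ?thesis using gen[of 1] by simp
  qed
  have all: "(LINT x:A|unit_interval. ?f x) = 0" if "A \<in> sigma_sets UNIV (range (\<lambda>r::rat. {..real_of_rat r}))" for A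
    using that
  proof (induction rule: sigma_sets_induct_disjoint[rotated 2, consumes 1, case_names basic empty compl union])
    show "Int_stable (range (\<lambda>r::rat. {..real_of_rat r}))"
    proof (rule Int_stableI)
      fix a b :: "real set"
      assume "a \<in> range (\<lambda>r::rat. {..real_of_rat r})" "b \<in> range (\<lambda>r::rat. {..real_of_rat r})"
      then obtain r s where "a = {..real_of_rat r}" "b = {..real_of_rat s}" by blast
      then have "a \<inter> b = {..real_of_rat (min r s)}" by (auto simp: min_def of_rat_less_eq)
      then show "a \<inter> b \<in> range (\<lambda>r::rat. {..real_of_rat r})" by blast
    qed
  next
    case (basic A)
    then show ?case using gen by auto
  next
    case empty
    show ?case by (simp add: set_lebesgue_integral_def)
  next
    case (compl A)
    then have A: "A \<in> sets borel" by (simp add: borel_eq_rat_atMost)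
    have "(LINT x:UNIV \<inter> {0<..<1}|unit_interval. ?f x)
        = (LINT x:(A \<inter> {0<..<1}) \<union> ((UNIV - A) \<inter> {0<..<1})|unit_interval. ?f x)"
      by (rule arg_cong[where f = "\<lambda>B. set_lebesgue_integral unit_interval B ?f"]) blast
    also have "\<dots> = (LINT x:A \<inter> {0<..<1}|unit_interval. ?f x) + (LINT x:(UNIV - A) \<inter> {0<..<1}|unit_interval. ?f x)"
      by (rule set_integral_Un[OF _ si si]) (use A in auto)
    finally show ?case unfolding cut compl.IH UNIV0 by simp
  next
    case (union A)
    then have A: "A i \<in> sets borel" for i by (auto simp: borel_eq_rat_atMost)
    have "(LINT x:(\<Union>i. A i \<inter> {0<..<1})|unit_interval. ?f x) = (\<Sum>i. (LINT x:(A i \<inter> {0<..<1})|unit_interval. ?f x))"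
    proof (rule lebesgue_integral_countable_add)
      show "set_integrable unit_interval (\<Union>i. A i \<inter> {0<..<1}) ?f"
        using si[of "\<Union>i. A i"] A by (simp add: Int_UN_distrib2 sets.countable_UN image_subset_iff)
      show "A i \<inter> {0<..<1} \<inter> (A j \<inter> {0<..<1}) = {}" if "i \<noteq> j" for i j
        using union(1) that by (auto simp: disjoint_family_on_def)
    qed (rule meas[OF A])
    then show ?case using union by (simp add: cut flip: Int_UN_distrib2)
  qed auto
  have "AE x in unit_interval. ?f x = 0"
  proof (rule density_zero[OF f])
    fix A assume "A \<in> sets unit_interval"
    then obtain B where "B \<in> sets borel" "A = B \<inter> {0<..<1}" by (auto simp: sets)
    then show "set_lebesgue_integral unit_interval A ?f = 0"
      using all[of B] cut[of B] by (simp add: borel_eq_rat_atMost)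
  qed
  then have "to_l2 ?f = to_l2 (\<lambda>_. 0)"
    by (intro iffD2[OF to_l2_eq_iff] sq_integrable_rep sq_integrable_bounded[where B = 0]) auto
  then show ?thesis by (simp add: zero_l2_def)
qed

instance l2 :: complete_space
proof
  fix X :: "nat \<Rightarrow> l2" assume X: "Cauchy X"
  interpret finite_measure unit_interval by (rule finite_measure_unit_interval)
  have "\<exists>N. \<forall>m\<ge>N. \<forall>n\<ge>N. norm (X m - X n) < (1/2) ^ k" for k
    using CauchyD[OF X, of "(1/2)^k"] by auto
  then obtain N where N: "\<And>k m n. m \<ge> N k \<Longrightarrow> n \<ge> N k \<Longrightarrow> norm (X m - X n) < (1/2) ^ k" by metis
  define r where "r k = Max (N ` {..k}) + k" for k
  have r: "N k \<le> r k" "N k \<le> r (Suc k)" for k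
    unfolding r_def by (intro trans_le_add1 Max_ge; simp)+
  define f where "f k = rep_l2 (X (r k))" for k
  have f: "sq_integrable (f k)" for k by (simp add: f_def sq_integrable_rep)
  have fm[measurable]: "f k \<in> borel_measurable unit_interval" for k using f[of k] by (simp add: sq_integrable_def)
  have Xf: "X (r k) = to_l2 (f k)" for k by (simp add: f_def)
  have diff: "sq_integrable (\<lambda>x. g x - h x)" "to_l2 g - to_l2 h = to_l2 (\<lambda>x. g x - h x)"
    if "sq_integrable g" "sq_integrable h" for g h
  proof -
    have h': "sq_integrable (\<lambda>x. -1 * h x)" by (rule sq_integrable_scale[OF that(2)])
    show "sq_integrable (\<lambda>x. g x - h x)" using sq_integrable_add[OF that(1) h'] by simp
    show "to_l2 g - to_l2 h = to_l2 (\<lambda>x. g x - h x)"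
      using to_l2_add[OF that(1) h'] to_l2_scale[OF that(2), of "-1"] by simp
  qed
  have nn: "(\<integral>\<^sup>+x. ennreal ((g x)\<^sup>2) \<partial>unit_interval) = ennreal ((norm (to_l2 g))\<^sup>2)" if "sq_integrable g" for g
    using that by (simp add: nn_integral_eq_integral sq_integrable_def power2_norm_eq_inner inner_to_l2 flip: power2_eq_square)
  have g: "(\<integral>\<^sup>+x. ennreal \<bar>f (Suc k) x - f k x\<bar> \<partial>unit_interval) \<le> ennreal ((1/2)^k)" for k
  proof -
    let ?g = "\<lambda>x. \<bar>f (Suc k) x - f k x\<bar>"
    have sq1: "sq_integrable (\<lambda>_. 1)" by (rule sq_integrable_bounded[where B = 1]) auto
    have sg: "sq_integrable ?g" using diff(1)[OF f f, of "Suc k" k] by (simp add: sq_integrable_def)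
    have "inner (to_l2 ?g) (to_l2 (\<lambda>_. 1)) \<le> norm (to_l2 ?g) * norm (to_l2 (\<lambda>_. 1))"
      by (rule norm_cauchy_schwarz)
    also have "inner (to_l2 ?g) (to_l2 (\<lambda>_. 1)) = integral\<^sup>L unit_interval ?g"
      by (simp add: inner_to_l2 sg sq1)
    also have "norm (to_l2 (\<lambda>_. 1)) = 1"
      by (simp add: norm_eq_sqrt_inner inner_to_l2 sq1)
         (simp add: unit_interval_def measure_restrict_space space_restrict_space)
    also have "norm (to_l2 ?g) = norm (X (r (Suc k)) - X (r k))"
      unfolding Xf diff(2)[OF f f] norm_eq_sqrt_inner
      by (simp add: inner_to_l2 sg diff(1)[OF f f] flip: power2_eq_square)
    also have "\<dots> \<le> (1/2)^k" using N[OF r(2) r(1), of k] by simp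
    finally have "integral\<^sup>L unit_interval ?g \<le> (1/2)^k" by simp
    then show ?thesis
      using sq_integrable_integrable[OF sg] by (simp add: nn_integral_eq_integral ennreal_leI)
  qed
  have "(\<integral>\<^sup>+x. (\<Sum>k. ennreal \<bar>f (Suc k) x - f k x\<bar>) \<partial>unit_interval)
      = (\<Sum>k. \<integral>\<^sup>+x. ennreal \<bar>f (Suc k) x - f k x\<bar> \<partial>unit_interval)"
    by (rule nn_integral_suminf) simp
  also have "\<dots> \<le> (\<Sum>k. ennreal ((1/2)^k))" by (intro suminf_le g) auto
  also have "\<dots> = ennreal (\<Sum>k. (1/2)^k)" by (rule suminf_ennreal2) auto
  finally have "(\<integral>\<^sup>+x. (\<Sum>k. ennreal \<bar>f (Suc k) x - f k x\<bar>) \<partial>unit_interval) \<noteq> \<infinity>"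
    by (auto simp: top_unique)
  then have "AE x in unit_interval. (\<Sum>k. ennreal \<bar>f (Suc k) x - f k x\<bar>) \<noteq> \<infinity>"
    by (intro nn_integral_PInf_AE) auto
  then have conv: "AE x in unit_interval. convergent (\<lambda>k. f k x)"
  proof eventually_elim
    fix x assume "(\<Sum>k. ennreal \<bar>f (Suc k) x - f k x\<bar>) \<noteq> \<infinity>"
    then have "summable (\<lambda>k. \<bar>f (Suc k) x - f k x\<bar>)" by (intro summable_suminf_not_top) (auto simp: top_unique)
    then have "summable (\<lambda>k. f (Suc k) x - f k x)" by (rule summable_rabs_cancel)
    then have "convergent (\<lambda>n. \<Sum>k<n. f (Suc k) x - f k x)" by (simp add: summable_iff_convergent)
    then obtain L where "(\<lambda>n. f n x - f 0 x) \<longlonglongrightarrow> L"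
      unfolding sum_lessThan_telescope[of "\<lambda>k. f k x"] convergent_def by blast
    from tendsto_add[OF this tendsto_const[of "f 0 x"]] show "convergent (\<lambda>k. f k x)"
      by (auto simp: convergent_def)
  qed
  define F where "F x = lim (\<lambda>k. f k x)" for x
  have Fm[measurable]: "F \<in> borel_measurable unit_interval" unfolding F_def by measurable
  have tail: "norm (X (r m) - X (r k)) \<le> (1/2)^k" if "k \<le> m" for k m
  proof -
    have "r k \<le> r m" using that by (auto simp: r_def intro!: add_mono Max_mono)
    then show ?thesis using N[of k "r m" "r k"] r(1)[of k] by simp
  qed
  have Fatou: "(\<integral>\<^sup>+x. ennreal ((F x - f k x)\<^sup>2) \<partial>unit_interval) \<le> ennreal (((1/2)^k)\<^sup>2)" for k
  proof -
    have "(\<integral>\<^sup>+x. ennreal ((F x - f k x)\<^sup>2) \<partial>unit_interval)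
        = (\<integral>\<^sup>+x. liminf (\<lambda>m. ennreal ((f m x - f k x)\<^sup>2)) \<partial>unit_interval)"
    proof (rule nn_integral_cong_AE)
      show "AE x in unit_interval. ennreal ((F x - f k x)\<^sup>2) = liminf (\<lambda>m. ennreal ((f m x - f k x)\<^sup>2))"
        using conv
      proof eventually_elim
        fix x assume "convergent (\<lambda>k. f k x)"
        then have "(\<lambda>m. f m x) \<longlonglongrightarrow> F x" by (simp add: F_def convergent_LIMSEQ_iff)
        then have "(\<lambda>m. ennreal ((f m x - f k x)\<^sup>2)) \<longlonglongrightarrow> ennreal ((F x - f k x)\<^sup>2)"
          by (intro tendsto_ennrealI tendsto_intros)
        then show "ennreal ((F x - f k x)\<^sup>2) = liminf (\<lambda>m. ennreal ((f m x - f k x)\<^sup>2))"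
          by (intro lim_imp_Liminf[symmetric]) auto
      qed
    qed
    also have "\<dots> \<le> liminf (\<lambda>m. \<integral>\<^sup>+x. ennreal ((f m x - f k x)\<^sup>2) \<partial>unit_interval)"
      by (rule nn_integral_liminf) simp
    also have "\<dots> \<le> ennreal (((1/2)^k)\<^sup>2)"
    proof (rule Liminf_le)
      show "\<forall>\<^sub>F m in sequentially. (\<integral>\<^sup>+x. ennreal ((f m x - f k x)\<^sup>2) \<partial>unit_interval) \<le> ennreal (((1/2)^k)\<^sup>2)"
        using eventually_ge_at_top[of k]
      proof eventually_elim
        case (elim m)
        have "(norm (to_l2 (\<lambda>x. f m x - f k x)))\<^sup>2 \<le> ((1/2)^k)\<^sup>2"
          using tail[OF elim] by (intro power_mono) (simp_all add: Xf diff(2)[OF f f])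
        then show ?case by (simp add: nn diff(1)[OF f f] ennreal_leI)
      qed
    qed simp
    finally show ?thesis .
  qed
  have sqFf: "sq_integrable (\<lambda>x. F x - f k x)" for k
    unfolding sq_integrable_def
    by (intro conjI integrableI_bounded) (use Fatou[of k] in \<open>auto simp: le_less_trans top_unique\<close>)
  have F: "sq_integrable F" using sq_integrable_add[OF sqFf[of 0] f[of 0]] by simp
  have "norm (X (r k) - to_l2 F) \<le> (1/2)^k" for k
  proof -
    have "(norm (to_l2 F - X (r k)))\<^sup>2 \<le> ((1/2)^k)\<^sup>2"
      using Fatou[of k] nn[OF sqFf[of k]] by (simp add: Xf diff(2)[OF F f])
    then show ?thesis by (simp add: power2_le_iff_abs_le norm_minus_commute)
  qed
  note bound = this
  have half0: "(\<lambda>k. (1/2) ^ k :: real) \<longlonglongrightarrow> 0"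
    by (rule LIMSEQ_power_zero) simp
  have lim: "(\<lambda>k. X (r k)) \<longlonglongrightarrow> to_l2 F"
    by (rule LIM_zero_cancel[OF Lim_null_comparison[OF always_eventually[OF allI[OF bound]] half0]])
  have "X \<longlonglongrightarrow> to_l2 F"
  proof (rule LIMSEQ_I)
    fix e :: real assume e: "0 < e"
    obtain k where k: "(1/2)^k < e / 2" using real_arch_pow_inv[of "e/2" "1/2"] e by auto
    obtain K where K: "\<And>m. m \<ge> K \<Longrightarrow> norm (X (r m) - to_l2 F) < e / 2"
      using LIMSEQ_D[OF lim, of "e/2"] e by auto
    have "norm (X n - to_l2 F) < e" if "n \<ge> N k" for n
    proof -
      have "r k \<le> r (max k K)" by (auto simp: r_def intro!: add_mono Max_mono)
      then have "norm (X n - X (r (max k K))) < e / 2"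
        using N[OF that, of "r (max k K)"] r(1)[of k] k by linarith
      then show ?thesis
        using K[of "max k K"] norm_triangle_ineq[of "X n - X (r (max k K))" "X (r (max k K)) - to_l2 F"] by simp
    qed
    then show "\<exists>no. \<forall>n\<ge>no. norm (X n - to_l2 F) < e" by blast
  qed
  then show "convergent X" by (auto simp: convergent_def)
qed

instance l2 :: polish_space
proof
  let ?S = "range (\<lambda>r. to_l2 (indicator {..real_of_rat r}))"
  have "x \<in> closure (span ?S)" for x
  proof -
    obtain m where m: "m \<in> closure (span ?S)" "\<And>v. v \<in> closure (span ?S) \<Longrightarrow> inner (x - m) v = 0"
      using closed_subspace_projection[OF subspace_closure[OF subspace_span] closed_closure, of ?S x] by blast
    have "x - m = 0"
    proof (rule l2_orthogonal_imp_zero)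
      fix r :: rat
      show "inner (x - m) (to_l2 (indicator {..real_of_rat r})) = 0"
        by (rule m(2)) (meson closure_subset rangeI span_base subsetD)
    qed
    then show ?thesis using m(1) by simp
  qed
  then have "closure (span ?S) = UNIV" by blast
  then obtain D :: "l2 set" where "countable D" "closure D = UNIV"
    using countable_dense_if_countable_total[of ?S] by auto
  then show "\<exists>B :: l2 set set. countable B \<and> open = generate_topology B"
    by (rule second_countable_if_countable_dense)
qed

definition test_functions :: "(real \<Rightarrow> real) set"
  where "test_functions =
    {\<eta>. (\<forall>k x. (deriv ^^ k) \<eta> differentiable at x) \<and> closure {x. \<eta> x \<noteq> 0} \<subseteq> {0<..<1}}"

lemma test_functionsD:
  assumes "\<eta> \<in> test_functions"
  shows "\<eta> differentiable at x" "sq_integrable \<eta>" "sq_integrable (deriv \<eta>)"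
proof -
  have d: "(deriv ^^ k) \<eta> differentiable at x" for k x
    using assms by (auto simp: test_functions_def)
  have sup: "closure {x. \<eta> x \<noteq> 0} \<subseteq> {0<..<1}"
    using assms by (auto simp: test_functions_def)
  show "\<eta> differentiable at x" using d[of 0] by simp
  have cont: "continuous_on UNIV ((deriv ^^ k) \<eta>)" for k
    using d by (simp add: continuous_on_eq_continuous_at differentiable_imp_continuous_within)
  have zero: "\<eta> x = 0" if "x \<notin> {0<..<1}" for x
    using that subset_trans[OF closure_subset sup] by blast
  have zero': "deriv \<eta> x = 0" if "x \<notin> {0..1}" for x
  proof -
    have "open (- {0..1::real})" by auto
    then have "\<forall>\<^sub>F y in nhds x. y \<in> - {0..1}" by (rule eventually_nhds_in_open) (use that in simp)
    then have "\<forall>\<^sub>F y in nhds x. \<eta> y = 0" by eventually_elim (rule zero, auto)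
    then have "deriv \<eta> x = deriv (\<lambda>_. 0) x" by (rule deriv_cong_ev) simp
    then show ?thesis by simp
  qed
  have sq: "sq_integrable ((deriv ^^ k) \<eta>)" if z: "\<And>x. x \<notin> {0..1} \<Longrightarrow> (deriv ^^ k) \<eta> x = 0" for k
  proof -
    have "compact ((deriv ^^ k) \<eta> ` {0..1})"
      by (intro compact_continuous_image continuous_on_subset[OF cont]) auto
    then obtain B where B: "\<And>x. x \<in> {0..1} \<Longrightarrow> \<bar>(deriv ^^ k) \<eta> x\<bar> \<le> B"
      using compact_imp_bounded bounded_iff by (metis imageI real_norm_def)
    have "0 \<le> B" using B[of 0] by auto
    then have "\<bar>(deriv ^^ k) \<eta> x\<bar> \<le> B" for x using B z by (cases "x \<in> {0..1}") auto
    then show ?thesis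
      using borel_measurable_continuous_onI[OF cont]
      by (intro sq_integrable_bounded[where B = B]) (simp_all add: unit_interval_def measurable_restrict_space1)
  qed
  have "\<eta> x = 0" if "x \<notin> {0..1}" for x by (rule zero) (use that in auto)
  then show "sq_integrable \<eta>" using sq[of 0] by simp
  show "sq_integrable (deriv \<eta>)" using sq[of 1] zero' by simp
qed

lemma higher_deriv_linear:
  fixes f g :: "real \<Rightarrow> real"
  assumes "\<And>k x. (deriv ^^ k) f differentiable at x" "\<And>k x. (deriv ^^ k) g differentiable at x"
  shows "(deriv ^^ k) (\<lambda>x. f x + c * g x) = (\<lambda>x. (deriv ^^ k) f x + c * (deriv ^^ k) g x)"
proof (induction k)
  case (Suc k)
  have "deriv (\<lambda>x. (deriv ^^ k) f x + c * (deriv ^^ k) g x) x = deriv ((deriv ^^ k) f) x + c * deriv ((deriv ^^ k) g) x" for x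
    using assms[of k x]
    by (intro DERIV_imp_deriv DERIV_add DERIV_cmult) (simp_all add: DERIV_deriv_iff_real_differentiable)
  then show ?case by (simp add: Suc)
qed simp

lemma test_functions_linear:
  assumes "f \<in> test_functions" "g \<in> test_functions"
  shows "(\<lambda>x. f x + c * g x) \<in> test_functions"
proof -
  have "closure {x. f x + c * g x \<noteq> 0} \<subseteq> closure ({x. f x \<noteq> 0} \<union> {x. g x \<noteq> 0})"
    by (intro closure_mono) auto
  with assms show ?thesis
    unfolding test_functions_def mem_Collect_eq
    by (subst higher_deriv_linear) (auto simp: closure_Un)
qed

text \<open>\<open>H\<^sub>0\<^sup>1(0,1)\<close> is the closure of \<open>C\<^sub>c\<^sup>\<infinity>(0,1)\<close> in \<open>H\<^sup>1\<close>. An element \<open>v\<close> is carried as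
  the pair \<open>(v, v\<^sub>x)\<close>, so that the inner product of \<^typ>\<open>l2 \<times> l2\<close> is the one of \<open>H\<^sup>1\<close>; the second
  component is the weak derivative of the first, hence determined by it.\<close>

definition grad_graph :: "(l2 \<times> l2) set"
  where "grad_graph = (\<lambda>\<eta>. (to_l2 \<eta>, to_l2 (deriv \<eta>))) ` test_functions"

lemma subspace_grad_graph: "subspace grad_graph"
proof -
  have zero: "(\<lambda>_. 0) \<in> test_functions"
  proof -
    have "(deriv ^^ k) (\<lambda>_. 0 :: real) = (\<lambda>_. 0 :: real)" for k by (induction k) auto
    then show ?thesis by (simp add: test_functions_def)
  qed
  have lin: "x + c *\<^sub>R y \<in> grad_graph" if xy: "x \<in> grad_graph" "y \<in> grad_graph" for x y c
  proof -
    obtain f g where fg: "f \<in> test_functions" "g \<in> test_functions"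
      "x = (to_l2 f, to_l2 (deriv f))" "y = (to_l2 g, to_l2 (deriv g))"
      using xy unfolding grad_graph_def by blast
    have "deriv (\<lambda>x. f x + c * g x) = (\<lambda>x. deriv f x + c * deriv g x)"
      using higher_deriv_linear[of f g 1 c] fg(1,2) by (simp add: test_functions_def)
    then have "x + c *\<^sub>R y = (to_l2 (\<lambda>x. f x + c * g x), to_l2 (deriv (\<lambda>x. f x + c * g x)))"
      using fg by (simp add: to_l2_add to_l2_scale test_functionsD sq_integrable_scale)
    then show ?thesis using test_functions_linear[OF fg(1,2)] unfolding grad_graph_def by blast
  qed
  have 0: "0 \<in> grad_graph"
    unfolding grad_graph_def by (rule image_eqI[OF _ zero]) (simp add: zero_l2_def zero_prod_def)
  show ?thesis
    using lin[of _ _ 1] lin[OF 0] 0 by (auto simp: subspace_def)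
qed

typedef h01 = "closure grad_graph" morphisms rep_h01 abs_h01
  using subspace_0[OF subspace_closure[OF subspace_grad_graph]] by blast

setup_lifting type_definition_h01

instantiation h01 :: real_inner
begin

lift_definition zero_h01 :: h01 is 0
  by (rule subspace_0[OF subspace_closure[OF subspace_grad_graph]])

lift_definition plus_h01 :: "h01 \<Rightarrow> h01 \<Rightarrow> h01" is "(+)"
  by (rule subspace_add[OF subspace_closure[OF subspace_grad_graph]])

lift_definition minus_h01 :: "h01 \<Rightarrow> h01 \<Rightarrow> h01" is "(-)"
  by (rule subspace_diff[OF subspace_closure[OF subspace_grad_graph]])

lift_definition uminus_h01 :: "h01 \<Rightarrow> h01" is uminus
  by (rule subspace_neg[OF subspace_closure[OF subspace_grad_graph]])

lift_definition scaleR_h01 :: "real \<Rightarrow> h01 \<Rightarrow> h01" is scaleR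
  by (rule subspace_scale[OF subspace_closure[OF subspace_grad_graph]])

lift_definition inner_h01 :: "h01 \<Rightarrow> h01 \<Rightarrow> real" is inner .

lift_definition norm_h01 :: "h01 \<Rightarrow> real" is norm .

lift_definition dist_h01 :: "h01 \<Rightarrow> h01 \<Rightarrow> real" is dist .

definition sgn_h01 :: "h01 \<Rightarrow> h01" where "sgn_h01 v = scaleR (inverse (norm v)) v"
definition uniformity_h01 :: "(h01 \<times> h01) filter"
  where "uniformity_h01 = (INF e\<in>{0 <..}. principal {(x, y). dist x y < e})"
definition open_h01 :: "h01 set \<Rightarrow> bool"
  where "open_h01 U \<longleftrightarrow> (\<forall>x\<in>U. \<forall>\<^sub>F (x', y) in uniformity. x' = x \<longrightarrow> y \<in> U)"

instance
proof
  fix f g h :: h01 and a b c :: real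
  show "f + g + h = f + (g + h)" by transfer (rule add.assoc)
  show "f + g = g + f" by transfer (rule add.commute)
  show "0 + f = f" by transfer simp
  show "- f + f = 0" by transfer simp
  show "f - g = f + - g" by transfer simp
  show "a *\<^sub>R (f + g) = a *\<^sub>R f + a *\<^sub>R g" by transfer (rule scaleR_add_right)
  show "(a + b) *\<^sub>R f = a *\<^sub>R f + b *\<^sub>R f" by transfer (rule scaleR_add_left)
  show "a *\<^sub>R b *\<^sub>R f = (a * b) *\<^sub>R f" by transfer simp
  show "1 *\<^sub>R f = f" by transfer simp
  show "sgn f = scaleR (inverse (norm f)) f" by (rule sgn_h01_def)
  show "dist f g = norm (f - g)" by transfer (rule dist_norm)
  show "(uniformity :: (h01 \<times> h01) filter) = (INF e\<in>{0 <..}. principal {(x, y). dist x y < e})"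
    by (rule uniformity_h01_def)
  show "norm f = sqrt (inner f f)" by transfer (rule norm_eq_sqrt_inner)
  show "inner f g = inner g f" by transfer (rule inner_commute)
  show "inner (f + g) h = inner f h + inner g h" by transfer (rule inner_add_left)
  show "inner (a *\<^sub>R f) g = a * inner f g" by transfer simp
  show "0 \<le> inner f f" by transfer simp
  show "inner f f = 0 \<longleftrightarrow> f = 0" by transfer simp
  show "open U = (\<forall>x\<in>U. \<forall>\<^sub>F (x', y) in uniformity. x' = x \<longrightarrow> y \<in> U)" for U :: "h01 set"
    by (rule open_h01_def)
qed

end

instance h01 :: polish_space
proof
  show "convergent X" if X: "Cauchy X" for X :: "nat \<Rightarrow> h01"
  proof -
    have "Cauchy (\<lambda>n. rep_h01 (X n))" using X by (simp add: Cauchy_def dist_h01.rep_eq)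
    then obtain l where l: "(\<lambda>n. rep_h01 (X n)) \<longlonglongrightarrow> l"
      using Cauchy_convergent convergent_def by blast
    then have "l \<in> closure grad_graph"
      using closed_sequentially[OF closed_closure _ l] rep_h01 by blast
    then have "rep_h01 (abs_h01 l) = l" by (rule abs_h01_inverse)
    then have "X \<longlonglongrightarrow> abs_h01 l" using l by (simp add: tendsto_iff dist_h01.rep_eq)
    then show ?thesis by (auto simp: convergent_def)
  qed
  obtain B :: "(l2 \<times> l2) set set" where B: "countable B" "topological_basis B"
    using ex_countable_basis by blast
  have cont: "continuous_on UNIV rep_h01"
    unfolding continuous_on_iff by (auto simp: dist_h01.rep_eq)
  have "topological_basis ((\<lambda>U. rep_h01 -` U) ` B)"
  proof (rule topological_basisI)
    show "open U" if "U \<in> (\<lambda>U. rep_h01 -` U) ` B" for U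
      using that topological_basis_open[OF B(2)] open_vimage[OF _ cont] by blast
    fix U :: "h01 set" and v assume U: "open U" "v \<in> U"
    then obtain e where e: "0 < e" "ball v e \<subseteq> U" by (meson openE)
    obtain V where V: "V \<in> B" "rep_h01 v \<in> V" "V \<subseteq> ball (rep_h01 v) e"
      using topological_basisE[OF B(2) open_ball centre_in_ball[THEN iffD2, OF e(1)]] by blast
    have "rep_h01 -` V \<subseteq> U" using V(3) e(2) by (force simp: dist_h01.rep_eq)
    then show "\<exists>W\<in>(\<lambda>U. rep_h01 -` U) ` B. v \<in> W \<and> W \<subseteq> U" using V by blast
  qed
  then show "\<exists>B :: h01 set set. countable B \<and> open = generate_topology B"
    using topological_basis_imp_subbasis B(1) by blast
qed

definition h01_to_l2 :: "h01 \<Rightarrow> l2" where "h01_to_l2 v = fst (rep_h01 v)"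
definition weak_deriv :: "h01 \<Rightarrow> l2" where "weak_deriv v = snd (rep_h01 v)"

lemma inner_h01_eq: "inner v w = inner (h01_to_l2 v) (h01_to_l2 w) + inner (weak_deriv v) (weak_deriv w)"
  by (simp add: inner_h01.rep_eq inner_prod_def h01_to_l2_def weak_deriv_def)

lemma bounded_linear_h01_to_l2: "bounded_linear h01_to_l2"
proof (rule bounded_linear_intro[where K = 1])
  show "norm (h01_to_l2 v) \<le> norm v * 1" for v using norm_fst_le[of "fst (rep_h01 v)" "snd (rep_h01 v)"] by (simp add: h01_to_l2_def norm_h01.rep_eq)
qed (simp_all add: h01_to_l2_def plus_h01.rep_eq scaleR_h01.rep_eq)

definition a_form :: "real \<Rightarrow> h01 \<Rightarrow> h01 \<Rightarrow> real"
  where "a_form \<mu> v w = inner (weak_deriv v) (weak_deriv w)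
    - \<mu> * (LINT x|unit_interval. rep_l2 (h01_to_l2 v) x * rep_l2 (h01_to_l2 w) x / x\<^sup>2)"

text \<open>For \<open>\<mu> < 1/4\<close> the norm \<open>sqrt (a_form \<mu> v v)\<close> of \<open>\<H>\<^sup>1\<close> is equivalent to the norm of
  \<^typ>\<open>h01\<close>. Hence \<^typ>\<open>h01\<close> is \<open>\<H>\<^sup>1\<close> and its topological dual is \<open>\<H>\<^sup>-\<^sup>1\<close> up to equivalent norms, and only
  their topologies enter below.\<close>

type_synonym hm1 = "h01 \<Rightarrow>\<^sub>L real"

definition pivot :: "l2 \<Rightarrow> hm1"
  where "pivot f = Blinfun (\<lambda>v. inner f (h01_to_l2 v))"

lemma pivot_apply [simp]: "blinfun_apply (pivot f) v = inner f (h01_to_l2 v)"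
  unfolding pivot_def
  by (rule bounded_linear_Blinfun_apply[THEN fun_cong])
     (rule bounded_linear_compose[OF bounded_linear_inner_right bounded_linear_h01_to_l2])

abbreviation h01_to_hm1 :: "h01 \<Rightarrow> hm1"
  where "h01_to_hm1 v \<equiv> pivot (h01_to_l2 v)"

definition rl_integral_left :: "real \<Rightarrow> (real \<Rightarrow> 'a::{banach,second_countable_topology}) \<Rightarrow> real \<Rightarrow> 'a"
  where "rl_integral_left \<beta> y t = (1 / Gamma \<beta>) *\<^sub>R (LBINT s:{0..t}. (t - s) powr (\<beta> - 1) *\<^sub>R y s)"

definition rl_integral_right :: "real \<Rightarrow> real \<Rightarrow> (real \<Rightarrow> 'a::{banach,second_countable_topology}) \<Rightarrow> real \<Rightarrow> 'a"
  where "rl_integral_right \<beta> T y t = (1 / Gamma \<beta>) *\<^sub>R (LBINT s:{t..T}. (s - t) powr (\<beta> - 1) *\<^sub>R y s)"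

lemma has_bochner_integral_powr:
  fixes \<beta> \<tau> t :: real
  assumes "0 < \<beta>" "\<tau> \<le> t"
  shows "has_bochner_integral lborel (\<lambda>s. indicator {\<tau>..t} s * (s - \<tau>) powr (\<beta> - 1)) ((t - \<tau>) powr \<beta> / \<beta>)"
    and "has_bochner_integral lborel (\<lambda>s. indicator {\<tau>..t} s * (t - s) powr (\<beta> - 1)) ((t - \<tau>) powr \<beta> / \<beta>)"
proof -
  let ?c = "t - \<tau>"
  have c: "0 \<le> ?c" using assms by simp
  have "((\<lambda>x. x powr (\<beta> - 1)) has_integral (?c powr (\<beta> - 1 + 1) / (\<beta> - 1 + 1))) {0..?c}"
    by (rule has_integral_powr_from_0) (use assms in auto)
  then have hi: "((\<lambda>x. x powr (\<beta> - 1)) has_integral (?c powr \<beta> / \<beta>)) {0..?c}" by simp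
  have "(\<lambda>x. x powr (\<beta> - 1)) absolutely_integrable_on {0..?c}"
    using hi by (intro nonnegative_absolutely_integrable_1) (auto simp: integrable_on_def)
  then have si: "set_integrable lborel {0..?c} (\<lambda>x. x powr (\<beta> - 1))"
    unfolding set_integrable_def
    by (subst (asm) integrable_completion) auto
  have "(LBINT x:{0..?c}. x powr (\<beta> - 1)) = ?c powr \<beta> / \<beta>"
    using set_borel_integral_eq_integral(2)[OF si] hi by (simp add: integral_unique)
  with si have b: "has_bochner_integral lborel (\<lambda>x. indicator {0..?c} x * x powr (\<beta> - 1)) (?c powr \<beta> / \<beta>)"
    by (simp add: has_bochner_integral_iff set_integrable_def set_lebesgue_integral_def)
  show "has_bochner_integral lborel (\<lambda>s. indicator {\<tau>..t} s * (s - \<tau>) powr (\<beta> - 1)) (?c powr \<beta> / \<beta>)"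
    using lborel_has_bochner_integral_real_affine_iff[of 1 _ _ "-\<tau>", THEN iffD1, OF _ b]
    by (simp add: indicator_def algebra_simps)
  show "has_bochner_integral lborel (\<lambda>s. indicator {\<tau>..t} s * (t - s) powr (\<beta> - 1)) (?c powr \<beta> / \<beta>)"
    using lborel_has_bochner_integral_real_affine_iff[of "-1" _ _ t, THEN iffD1, OF _ b]
    by (simp add: indicator_def algebra_simps conj_commute)
qed

lemma weighted_Fubini:
  fixes Y :: "real \<Rightarrow> 'a::{banach,second_countable_topology}" and w :: "real \<Rightarrow> real \<Rightarrow> real"
  assumes Y: "integrable lborel Y" and Y0: "\<And>\<tau>. \<tau> \<notin> {0..t} \<Longrightarrow> Y \<tau> = 0"
    and wm: "(\<lambda>(\<tau>, s). w \<tau> s) \<in> borel_measurable (lborel \<Otimes>\<^sub>M lborel)"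
    and w0: "\<And>\<tau> s. 0 \<le> w \<tau> s" and "0 < \<beta>"
    and w: "\<And>\<tau>. \<tau> \<le> t \<Longrightarrow> has_bochner_integral lborel (w \<tau>) ((t - \<tau>) powr \<beta> / \<beta>)"
  shows "(LBINT s. LBINT \<tau>. w \<tau> s *\<^sub>R Y \<tau>) = (LBINT \<tau>. ((t - \<tau>) powr \<beta> / \<beta>) *\<^sub>R Y \<tau>)"
    and "integrable lborel (\<lambda>s. LBINT \<tau>. w \<tau> s *\<^sub>R Y \<tau>)"
proof -
  have Ym[measurable]: "Y \<in> borel_measurable borel" using Y by auto
  note wm[measurable]
  have int: "integrable lborel (\<lambda>s. w \<tau> s *\<^sub>R Y \<tau>)" for \<tau>
    using w[of \<tau>] Y0[of \<tau>] by (cases "\<tau> \<in> {0..t}") (auto simp: has_bochner_integral_iff)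
  have eq: "(LBINT s. w \<tau> s *\<^sub>R v) = ((t - \<tau>) powr \<beta> / \<beta>) *\<^sub>R v" if "\<tau> \<le> t" for \<tau> and v :: 'a
    using w[OF that] by (simp add: has_bochner_integral_iff)
  have F: "integrable (lborel \<Otimes>\<^sub>M lborel) (\<lambda>(\<tau>, s). w \<tau> s *\<^sub>R Y \<tau>)"
  proof (rule lborel_pair.Fubini_integrable)
    show "(\<lambda>(\<tau>, s). w \<tau> s *\<^sub>R Y \<tau>) \<in> borel_measurable (lborel \<Otimes>\<^sub>M lborel)"
      by measurable
    show "AE \<tau> in lborel. integrable lborel (\<lambda>s. case (\<tau>, s) of (\<tau>, s) \<Rightarrow> w \<tau> s *\<^sub>R Y \<tau>)"
      using int by simp
    have "(LBINT s. norm (case (\<tau>, s) of (\<tau>, s) \<Rightarrow> w \<tau> s *\<^sub>R Y \<tau>)) = ((t - \<tau>) powr \<beta> / \<beta>) * norm (Y \<tau>)" for \<tau>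
      using w[of \<tau>] Y0[of \<tau>] w0 by (cases "\<tau> \<in> {0..t}") (auto simp: has_bochner_integral_iff)
    moreover have "integrable lborel (\<lambda>\<tau>. ((t - \<tau>) powr \<beta> / \<beta>) * norm (Y \<tau>))"
    proof (rule Bochner_Integration.integrable_bound)
      show "integrable lborel (\<lambda>\<tau>. (t powr \<beta> / \<beta>) * norm (Y \<tau>))" using Y by auto
      have "(t - \<tau>) powr \<beta> / \<beta> * norm (Y \<tau>) \<le> t powr \<beta> / \<beta> * norm (Y \<tau>)" for \<tau>
        using Y0[of \<tau>] \<open>0 < \<beta>\<close>
        by (cases "\<tau> \<in> {0..t}") (auto intro!: mult_right_mono divide_right_mono powr_mono2)
      then show "AE \<tau> in lborel. norm ((t - \<tau>) powr \<beta> / \<beta> * norm (Y \<tau>)) \<le> norm ((t powr \<beta> / \<beta>) * norm (Y \<tau>))"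
        using \<open>0 < \<beta>\<close> by simp
    qed measurable
    ultimately show "integrable lborel (\<lambda>\<tau>. LBINT s. norm (case (\<tau>, s) of (\<tau>, s) \<Rightarrow> w \<tau> s *\<^sub>R Y \<tau>))"
      by simp
  qed
  have "(LBINT s. LBINT \<tau>. w \<tau> s *\<^sub>R Y \<tau>) = (LBINT \<tau>. LBINT s. w \<tau> s *\<^sub>R Y \<tau>)"
    by (rule lborel_pair.Fubini_integral[OF F])
  also have "\<dots> = (LBINT \<tau>. ((t - \<tau>) powr \<beta> / \<beta>) *\<^sub>R Y \<tau>)"
  proof (intro Bochner_Integration.integral_cong refl)
    show "(LBINT s. w \<tau> s *\<^sub>R Y \<tau>) = ((t - \<tau>) powr \<beta> / \<beta>) *\<^sub>R Y \<tau>" for \<tau>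
      using eq[of \<tau> "Y \<tau>"] Y0[of \<tau>] by (cases "\<tau> \<in> {0..t}") simp_all
  qed
  finally show "(LBINT s. LBINT \<tau>. w \<tau> s *\<^sub>R Y \<tau>) = (LBINT \<tau>. ((t - \<tau>) powr \<beta> / \<beta>) *\<^sub>R Y \<tau>)" .
  show "integrable lborel (\<lambda>s. LBINT \<tau>. w \<tau> s *\<^sub>R Y \<tau>)"
    by (rule lborel_pair.integrable_snd[OF F])
qed

lemma rl_integral_left_primitive:
  fixes y :: "real \<Rightarrow> 'a::{banach,second_countable_topology}"
  assumes "0 < \<beta>" "set_integrable lborel {0..t} y"
  shows "rl_integral_left \<beta> (\<lambda>s. LBINT \<tau>:{0..s}. y \<tau>) t = (LBINT s:{0..t}. rl_integral_left \<beta> y s)"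
    and "set_integrable lborel {0..t} (rl_integral_left \<beta> y)"
proof -
  define Y where "Y \<tau> = indicator {0..t} \<tau> *\<^sub>R y \<tau>" for \<tau>
  have Y: "integrable lborel Y" "\<And>\<tau>. \<tau> \<notin> {0..t} \<Longrightarrow> Y \<tau> = 0"
    using assms(2) by (auto simp: Y_def[abs_def] set_integrable_def)
  have 1: "(LBINT s:{0..t}. (t - s) powr (\<beta> - 1) *\<^sub>R (LBINT \<tau>:{0..s}. y \<tau>))
      = (LBINT s. LBINT \<tau>. (indicator {\<tau>..t} s * (t - s) powr (\<beta> - 1)) *\<^sub>R Y \<tau>)"
    unfolding set_lebesgue_integral_def Y_def integral_scaleR_right[symmetric]
    by (intro Bochner_Integration.integral_cong refl) (auto simp: indicator_def)
  have 20: "indicator {0..t} s *\<^sub>R (LBINT \<tau>:{0..s}. (s - \<tau>) powr (\<beta> - 1) *\<^sub>R y \<tau>)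
      = (LBINT \<tau>. (indicator {\<tau>..t} s * (s - \<tau>) powr (\<beta> - 1)) *\<^sub>R Y \<tau>)" for s
    unfolding set_lebesgue_integral_def Y_def integral_scaleR_right[symmetric]
    by (intro Bochner_Integration.integral_cong refl) (auto simp: indicator_def)
  then have 2: "(LBINT s:{0..t}. (LBINT \<tau>:{0..s}. (s - \<tau>) powr (\<beta> - 1) *\<^sub>R y \<tau>))
      = (LBINT s. LBINT \<tau>. (indicator {\<tau>..t} s * (s - \<tau>) powr (\<beta> - 1)) *\<^sub>R Y \<tau>)"
    unfolding set_lebesgue_integral_def[of _ "{0..t}"] by simp
  have m: "{p \<in> space (lborel \<Otimes>\<^sub>M lborel). fst p \<le> snd p \<and> snd p \<le> t} \<in> sets (lborel \<Otimes>\<^sub>M lborel)"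
    by measurable
  have ind: "(\<lambda>(\<tau>, s). indicat_real {\<tau>..t} s) = indicator {p. fst p \<le> snd p \<and> snd p \<le> t}"
    by (auto simp: indicator_def fun_eq_iff)
  have im[measurable]: "(\<lambda>(\<tau>, s). indicat_real {\<tau>..t} s) \<in> borel_measurable (lborel \<Otimes>\<^sub>M lborel)"
    unfolding ind using m by (intro borel_measurable_indicator) (simp add: space_pair_measure)
  have "(LBINT s:{0..t}. (t - s) powr (\<beta> - 1) *\<^sub>R (LBINT \<tau>:{0..s}. y \<tau>))
      = (LBINT s:{0..t}. (LBINT \<tau>:{0..s}. (s - \<tau>) powr (\<beta> - 1) *\<^sub>R y \<tau>))"
    unfolding 1 2
    by (subst (1 2) weighted_Fubini(1)[OF Y(1) Y(2) _ _ assms(1)])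
       (use has_bochner_integral_powr[OF assms(1)] in \<open>auto intro!: im borel_measurable_times simp: split_beta'\<close>)
  then show "rl_integral_left \<beta> (\<lambda>s. LBINT \<tau>:{0..s}. y \<tau>) t = (LBINT s:{0..t}. rl_integral_left \<beta> y s)"
    by (simp add: rl_integral_left_def set_lebesgue_integral_def)
  have "integrable lborel (\<lambda>s. LBINT \<tau>. (indicator {\<tau>..t} s * (s - \<tau>) powr (\<beta> - 1)) *\<^sub>R Y \<tau>)"
    by (rule weighted_Fubini(2)[OF Y(1) Y(2) _ _ assms(1)])
       (use has_bochner_integral_powr[OF assms(1)] in \<open>auto intro!: im borel_measurable_times simp: split_beta'\<close>)
  then have "integrable lborel (\<lambda>s. (1 / Gamma \<beta>) *\<^sub>R
      (indicator {0..t} s *\<^sub>R (LBINT \<tau>:{0..s}. (s - \<tau>) powr (\<beta> - 1) *\<^sub>R y \<tau>)))"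
    unfolding 20 by (rule integrable_scaleR_right)
  then show "set_integrable lborel {0..t} (rl_integral_left \<beta> y)"
    by (simp add: set_integrable_def rl_integral_left_def scaleR_left_commute)
qed

text \<open>\<open>g\<close> is the Caputo derivative of order \<open>\<alpha> \<in> (1,2)\<close> on \<open>(0,T)\<close> of a \<open>C\<^sup>1\<close> function with derivative
  \<open>y'\<close>. As \<open>y'\<close> is only continuous, the second derivative in \<open>I\<^sup>2\<^sup>-\<^sup>\<alpha> y''\<close> is taken in the weak sense, that is
  \<open>g = d/dt I\<^sup>2\<^sup>-\<^sup>\<alpha> (y' - y' 0)\<close>, here in integrated form; \<open>caputo_derivative_classical\<close> below shows that
  \<open>g = I\<^sup>2\<^sup>-\<^sup>\<alpha> y''\<close> if \<open>y'\<close> is absolutely continuous.\<close>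

definition has_caputo_derivative ::
  "real \<Rightarrow> real \<Rightarrow> (real \<Rightarrow> 'a::{banach,second_countable_topology}) \<Rightarrow> (real \<Rightarrow> 'a) \<Rightarrow> bool"
  where "has_caputo_derivative \<alpha> T y' g \<longleftrightarrow>
    set_integrable lborel {0..T} g \<and>
    (\<forall>t\<in>{0..T}. rl_integral_left (2 - \<alpha>) (\<lambda>s. y' s - y' 0) t = (LBINT s:{0..t}. g s))"

lemma caputo_derivative_classical:
  assumes "\<alpha> < 2" "set_integrable lborel {0..T} y''"
    and y': "\<And>t. t \<in> {0..T} \<Longrightarrow> y' t = y' 0 + (LBINT s:{0..t}. y'' s)"
  shows "has_caputo_derivative \<alpha> T y' (rl_integral_left (2 - \<alpha>) y'')"
  unfolding has_caputo_derivative_def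
proof (intro conjI ballI)
  show "set_integrable lborel {0..T} (rl_integral_left (2 - \<alpha>) y'')"
    using assms(1,2) by (intro rl_integral_left_primitive(2)) auto
  fix t assume t: "t \<in> {0..T}"
  have "rl_integral_left (2 - \<alpha>) (\<lambda>s. y' s - y' 0) t = rl_integral_left (2 - \<alpha>) (\<lambda>s. LBINT \<tau>:{0..s}. y'' \<tau>) t"
  proof -
    have "(t - s) powr (2 - \<alpha> - 1) *\<^sub>R (y' s - y' 0) = (t - s) powr (2 - \<alpha> - 1) *\<^sub>R (LBINT \<tau>:{0..s}. y'' \<tau>)"
      if "s \<in> {0..t}" for s
      using y'[of s] that t by simp
    then show ?thesis
      unfolding rl_integral_left_def by (intro arg_cong[where f = "scaleR _"] set_lebesgue_integral_cong) auto
  qed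
  also have "\<dots> = (LBINT s:{0..t}. rl_integral_left (2 - \<alpha>) y'' s)"
    using assms(1) t by (intro rl_integral_left_primitive(1) set_integrable_subset[OF assms(2)]) auto
  finally show "rl_integral_left (2 - \<alpha>) (\<lambda>s. y' s - y' 0) t = (LBINT s:{0..t}. rl_integral_left (2 - \<alpha>) y'' s)" .
qed

definition linf :: "real \<Rightarrow> (real \<Rightarrow> real) \<Rightarrow> bool"
  where "linf T q \<longleftrightarrow> set_borel_measurable lborel {0<..<T} q \<and>
    (\<exists>C. AE t\<in>{0<..<T} in lborel. \<bar>q t\<bar> \<le> C)"

definition bochner_l2 :: "real \<Rightarrow> (real \<Rightarrow> 'a::real_normed_vector) \<Rightarrow> bool"
  where "bochner_l2 T g \<longleftrightarrow> set_borel_measurable lborel {0<..<T} g \<and>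
    set_integrable lborel {0<..<T} (\<lambda>t. (norm (g t))\<^sup>2)"

definition weak_solution ::
  "real \<Rightarrow> real \<Rightarrow> real \<Rightarrow> (real \<Rightarrow> real) \<Rightarrow> h01 \<Rightarrow> l2 \<Rightarrow> l2 \<Rightarrow> (real \<Rightarrow> h01) \<Rightarrow> bool"
  where "weak_solution \<mu> \<alpha> T q u0 u1 p u \<longleftrightarrow>
    continuous_on {0..T} u \<and> u 0 = u0 \<and>
    (\<exists>u' g. continuous_on {0..T} u' \<and>
      (\<forall>t\<in>{0..T}. ((\<lambda>s. h01_to_hm1 (u s)) has_vector_derivative u' t) (at t within {0..T})) \<and>
      u' 0 = pivot u1 \<and>
      has_caputo_derivative \<alpha> T u' g \<and> bochner_l2 T g \<and>
      (AE t\<in>{0<..<T} in lborel. \<forall>v. blinfun_apply (g t) v + a_form \<mu> (u t) v = inner (q t *\<^sub>R p) (h01_to_l2 v)))"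

text \<open>\<open>d1\<close> and \<open>d2\<close> are the right-sided Riemann--Liouville derivatives of \<open>y\<close> of order \<open>\<alpha> - 1\<close> and \<open>\<alpha>\<close>, for
  \<open>\<alpha> \<in> (1,2)\<close>: \<open>d1 = - d/dt I\<^sup>2\<^sup>-\<^sup>\<alpha> y\<close> and \<open>d2 = d\<^sup>2/dt\<^sup>2 I\<^sup>2\<^sup>-\<^sup>\<alpha> y\<close>, the outer derivative in \<open>d2\<close> being that of an
  absolutely continuous function.\<close>

definition has_right_rl_derivatives ::
  "real \<Rightarrow> real \<Rightarrow> (real \<Rightarrow> 'a::{banach,second_countable_topology}) \<Rightarrow> (real \<Rightarrow> 'a) \<Rightarrow> (real \<Rightarrow> 'a) \<Rightarrow> bool"
  where "has_right_rl_derivatives \<alpha> T y d1 d2 \<longleftrightarrow>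
    (\<forall>t\<in>{0<..<T}. (rl_integral_right (2 - \<alpha>) T y has_vector_derivative - d1 t) (at t)) \<and>
    set_integrable lborel {0<..<T} d2 \<and>
    (\<forall>s\<in>{0<..<T}. \<forall>t\<in>{s..<T}. (- d1 t) - (- d1 s) = (LBINT \<tau>:{s..t}. d2 \<tau>))"

text \<open>Weak solutions of the adjoint problem, with traces at \<open>T\<close> taken in \<open>\<H>\<^sup>-\<^sup>1\<close>. Only \<open>\<psi> \<in> L\<^sup>1(0,T;\<H>\<^sup>1)\<close> is
  demanded, the least for which the equation and the fractional integral of \<open>\<psi>\<close> make sense.\<close>

definition adjoint_solution :: "real \<Rightarrow> real \<Rightarrow> real \<Rightarrow> l2 \<Rightarrow> (real \<Rightarrow> h01) \<Rightarrow> bool"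
  where "adjoint_solution \<mu> \<alpha> T r \<psi> \<longleftrightarrow>
    set_integrable lborel {0<..<T} \<psi> \<and>
    (\<exists>d1 d2. has_right_rl_derivatives \<alpha> T (\<lambda>t. h01_to_hm1 (\<psi> t)) d1 d2 \<and>
      (AE t\<in>{0<..<T} in lborel. \<forall>v. blinfun_apply (d2 t) v + a_form \<mu> (\<psi> t) v = 0) \<and>
      (rl_integral_right (2 - \<alpha>) T (\<lambda>t. h01_to_hm1 (\<psi> t)) \<longlongrightarrow> 0) (at_left T) \<and>
      (d1 \<longlongrightarrow> pivot r) (at_left T))"

definition forward_operator :: "(l2 \<Rightarrow> real \<Rightarrow> h01) \<Rightarrow> real \<Rightarrow> l2 \<Rightarrow> l2"
  where "forward_operator u T p = h01_to_l2 (u p T) - h01_to_l2 (u 0 T)"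

definition residual :: "(l2 \<Rightarrow> real \<Rightarrow> h01) \<Rightarrow> real \<Rightarrow> l2 \<Rightarrow> l2 \<Rightarrow> l2"
  where "residual u T \<omega>obs p = forward_operator u T p - (\<omega>obs - h01_to_l2 (u 0 T))"

definition tikhonov :: "(l2 \<Rightarrow> real \<Rightarrow> h01) \<Rightarrow> real \<Rightarrow> l2 \<Rightarrow> real \<Rightarrow> l2 \<Rightarrow> real"
  where "tikhonov u T \<omega>obs lam p = (norm (residual u T \<omega>obs p))\<^sup>2 / 2 + lam / 2 * (norm p)\<^sup>2"

end

theory Submission
  imports Defs
begin

text \<open>The map \<open>p \<mapsto> u p T\<close> is affine, so the Tikhonov functional is quadratic. Once the linear part \<open>A\<close> of
this map is known to be bounded, the functional is differentiable, with derivative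
\<open>h \<mapsto> (r, A h) + lam (p, h)\<close> at \<open>p\<close>, where \<open>r\<close> is the residual at \<open>p\<close>. Two things remain: the boundedness of \<open>A\<close>,
and the identity \<open>(r, A h) = (\<integral> q \<psi>, h)\<close>, which says that the adjoint problem computes the
adjoint of \<open>A\<close>.

Both come from reducing the two problems to integral equations in \<open>L\<^sup>2(0,1)\<close>. By Hardy's inequality the form
\<open>a\<^sub>\<mu>\<close> is coercive, and the Lax--Milgram theorem gives the bounded symmetric operator
\<open>L_inv = L\<^sub>\<mu>\<^sup>-\<^sup>1\<close> on \<open>L\<^sup>2(0,1)\<close>. Testing the equations with functions from the range of \<open>L\<^sub>\<mu>\<^sup>-\<^sup>1\<close>, and undoing the
fractional derivatives with the semigroup law \<open>I\<^sup>a I\<^sup>b = I\<^sup>a\<^sup>+\<^sup>b\<close>, turns both problems into Volterra equations of the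
first kind in \<open>L\<^sup>2(0,1)\<close> with the bounded kernel \<open>k(x) = x\<^sup>\<alpha>\<^sup>-\<^sup>1 / \<Gamma>(\<alpha>)\<close>. For \<open>w h = u h - u 0\<close> and for \<open>\<psi>\<close> they
read

\<^item> \<open>L\<^sub>\<mu>\<^sup>-\<^sup>1 (w h t) = \<integral>\<^sub>0\<^sup>t k(t - s) (q(s) L\<^sub>\<mu>\<^sup>-\<^sup>1 h - w h s) ds\<close>,
\<^item> \<open>L\<^sub>\<mu>\<^sup>-\<^sup>1 (\<psi> t) = k(T - t) L\<^sub>\<mu>\<^sup>-\<^sup>1 r - \<integral>\<^sub>t\<^sup>T k(s - t) \<psi>(s) ds\<close>

(\<open>weak_solution_volterra\<close> and \<open>adjoint_solution_volterra\<close>).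

The rest is abstract and takes place in the locale \<open>volterra_source_problem\<close>. Uniqueness
(\<open>volterra_first_kind_unique\<close>): if \<open>B\<close> is symmetric and \<open>B w = - k * w\<close>, then \<open>B\<^sup>n w\<close> decays like \<open>K\<^sup>n t\<^sup>n / n!\<close>, whereas
symmetry forces \<open>B\<^sup>n x\<close> to be at least geometric in \<open>n\<close> unless \<open>B x = 0\<close>. Uniqueness makes \<open>h \<mapsto> w h\<close>
linear and lets it commute with \<open>B\<close>, and the graph of this map is closed. As a solution is given for every
source, the closed graph theorem yields the boundedness of \<open>A\<close>. Finally, pairing the two Volterra equations with
each other gives, after one exchange of the order of integration, \<open>(B r, B (A h)) = (B \<integral> q \<psi>, B h)\<close>
(\<open>final_value_pairing\<close>), and \<open>B\<close> is removed from this identity because it commutes with \<open>A\<close>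
(\<open>final_value_adjoint\<close>).

What links this abstract part to the problem is that the kernel of \<open>L_inv\<close> is orthogonal to \<open>H\<^sub>0\<^sup>1(0,1)\<close>, where
the states \<open>u\<close> and \<open>\<psi>\<close> live: a state that \<open>L_inv\<close> annihilates is zero.\<close>

section \<open>Bochner integrals on the real line\<close>

lemma integrable_imp_set_integrable:
  fixes f :: "real \<Rightarrow> 'a::{banach,second_countable_topology}"
  assumes "integrable lborel f" "A \<in> sets borel"
  shows "set_integrable lborel A f"
  using integrable_mult_indicator[of A lborel f] assms by (simp add: set_integrable_def)

lemma set_integral_bounded_linear:
  fixes f :: "'m \<Rightarrow> 'a::{banach,second_countable_topology}" and L :: "'a \<Rightarrow> 'b::{banach,second_countable_topology}"
  assumes L: "bounded_linear L" and f: "set_integrable M A f"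
  shows "set_integrable M A (\<lambda>x. L (f x))" "(LINT x:A|M. L (f x)) = L (LINT x:A|M. f x)"
proof -
  have eq: "(\<lambda>x. indicator A x *\<^sub>R L (f x)) = (\<lambda>x. L (indicator A x *\<^sub>R f x))"
    by (simp add: linear_scale[OF bounded_linear.linear[OF L]])
  show "set_integrable M A (\<lambda>x. L (f x))" "(LINT x:A|M. L (f x)) = L (LINT x:A|M. f x)"
    using f unfolding set_integrable_def set_lebesgue_integral_def eq
    by (auto intro: integrable_bounded_linear[OF L] integral_bounded_linear[OF L])
qed

text \<open>A bounded measurable factor does not destroy integrability; used for the scalar product of vectors
and for the multiplication by a scalar.\<close>

lemma set_integrable_bilinear_bounded:
  fixes f :: "'m \<Rightarrow> 'a::{real_normed_vector,second_countable_topology}"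
    and g :: "'m \<Rightarrow> 'b::{banach,second_countable_topology}"
    and prod :: "'a \<Rightarrow> 'b \<Rightarrow> 'c::{banach,second_countable_topology}"
  assumes "bounded_bilinear prod" and f: "set_borel_measurable M A f" "\<And>x. x \<in> A \<Longrightarrow> norm (f x) \<le> K"
    and g: "set_integrable M A g"
  shows "set_integrable M A (\<lambda>x. prod (f x) (g x))"
proof -
  interpret bounded_bilinear prod by fact
  obtain C where C: "0 < C" "\<And>x y. norm (prod x y) \<le> norm x * norm y * C" using pos_bounded by blast
  have "integrable M (\<lambda>x. prod (indicator A x *\<^sub>R f x) (indicator A x *\<^sub>R g x))"
  proof (rule Bochner_Integration.integrable_bound)
    show "integrable M (\<lambda>x. (K * C) *\<^sub>R (indicator A x *\<^sub>R g x))"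
      using g by (intro integrable_scaleR_right) (simp add: set_integrable_def)
    have "continuous_on UNIV (\<lambda>p. prod (fst p) (snd p))"
      by (intro continuous_on continuous_intros)
    then show "(\<lambda>x. prod (indicator A x *\<^sub>R f x) (indicator A x *\<^sub>R g x)) \<in> borel_measurable M"
      using f(1) g by (intro borel_measurable_continuous_Pair[of _ M _ prod])
        (auto simp: set_borel_measurable_def set_integrable_def)
    show "AE x in M. norm (prod (indicator A x *\<^sub>R f x) (indicator A x *\<^sub>R g x)) \<le> norm ((K * C) *\<^sub>R (indicator A x *\<^sub>R g x))"
    proof (intro AE_I2)
      fix x
      show "norm (prod (indicator A x *\<^sub>R f x) (indicator A x *\<^sub>R g x)) \<le> norm ((K * C) *\<^sub>R (indicator A x *\<^sub>R g x))"
      proof (cases "x \<in> A")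
        case True
        have "norm (prod (f x) (g x)) \<le> norm (f x) * norm (g x) * C" by (rule C(2))
        also have "\<dots> \<le> K * norm (g x) * C" using C(1) f(2)[OF True] by (intro mult_right_mono) auto
        also have "\<dots> \<le> \<bar>K * C\<bar> * norm (g x)"
          using mult_right_mono[OF abs_ge_self[of "K * C"] norm_ge_zero[of "g x"]] by (simp add: ac_simps)
        finally show ?thesis using True by simp
      qed (simp add: zero_left)
    qed
  qed
  moreover have "(\<lambda>x. prod (indicator A x *\<^sub>R f x) (indicator A x *\<^sub>R g x)) = (\<lambda>x. indicator A x *\<^sub>R prod (f x) (g x))"
    by (auto simp: indicator_def zero_left)
  ultimately show ?thesis by (simp add: set_integrable_def)
qed

lemma set_borel_measurable_continuous_Icc:
  fixes f :: "real \<Rightarrow> 'a::real_normed_vector"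
  shows "continuous_on {a..b} f \<Longrightarrow> set_borel_measurable lborel {a..b} f"
  by (simp add: set_borel_measurable_def borel_measurable_continuous_on_indicator)

lemma continuous_Icc_bounded:
  fixes f :: "real \<Rightarrow> 'a::real_normed_vector"
  assumes "continuous_on {a..b} f"
  obtains K where "\<And>x. x \<in> {a..b} \<Longrightarrow> norm (f x) \<le> K"
proof -
  have "bounded (f ` {a..b})" by (intro compact_imp_bounded compact_continuous_image assms compact_Icc)
  then show thesis unfolding bounded_iff using that by (metis imageI)
qed

lemma integral_power_upto:
  fixes t :: real assumes "0 \<le> t"
  shows "set_integrable lborel {0..t} (\<lambda>s. s ^ n)" "(LBINT s:{0..t}. s ^ n) = t ^ Suc n / Suc n"
proof -
  show i: "set_integrable lborel {0..t} (\<lambda>s. s ^ n)"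
    by (rule borel_integrable_atLeastAtMost') (intro continuous_intros)
  show "(LBINT s:{0..t}. s ^ n) = t ^ Suc n / Suc n"
    using integral_power[OF assms, of n] by (simp add: set_lebesgue_integral_def mult.commute)
qed

text \<open>The half-lines form a \<open>\<pi>\<close>-system that generates the Borel sets, so all set integrals of \<open>f\<close> vanish.\<close>

lemma AE_zero_if_interval_integrals_zero:
  fixes f :: "real \<Rightarrow> 'a::{banach,second_countable_topology}"
  assumes f: "integrable lborel f" and 0: "\<And>a. (LBINT t:{a..}. f t) = 0"
  shows "AE t in lborel. f t = 0"
proof (rule sigma_finite_measure.density_zero[OF sigma_finite_lborel f])
  note si = integrable_imp_set_integrable[OF f]
  have open0: "(LBINT t:{a<..}. f t) = 0" for a
  proof -
    have "({a..} - {a<..}) \<union> ({a<..} - {a..}) = {a}" by auto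
    then have "(LBINT t:{a..}. f t) = (LBINT t:{a<..}. f t)"
      by (intro set_integral_null_delta[OF f]) auto
    then show ?thesis using 0 by simp
  qed
  have UNIV0: "(LBINT t:UNIV. f t) = 0"
  proof -
    have "(\<lambda>n. LBINT t:{- real n<..}. f t) \<longlonglongrightarrow> (LBINT t:(\<Union>n. {- real n<..}). f t)"
      by (rule set_integral_cont_up) (auto simp: incseq_def intro!: si)
    moreover have "(\<Union>n. {- real n<..}) = (UNIV :: real set)"
      by (auto simp: minus_less_iff reals_Archimedean2)
    ultimately show ?thesis using open0 by (simp add: LIMSEQ_const_iff)
  qed
  have all: "(LBINT t:A. f t) = 0" if "A \<in> sigma_sets UNIV (range (greaterThan :: real \<Rightarrow> real set))" for A
    using that
  proof (induction rule: sigma_sets_induct_disjoint[rotated 2, consumes 1, case_names basic empty compl union])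
    show "Int_stable (range (greaterThan :: real \<Rightarrow> real set))"
    proof (rule Int_stableI)
      fix A B assume "A \<in> range (greaterThan :: real \<Rightarrow> real set)" "B \<in> range (\<lambda>a::real. {a<..})"
      then obtain a b where "A = {a<..}" "B = {b<..}" by blast
      then have "A \<inter> B = {max a b<..}" by auto
      then show "A \<inter> B \<in> range (greaterThan :: real \<Rightarrow> real set)" by blast
    qed
  next
    case (basic A)
    then show ?case using open0 by auto
  next
    case empty
    show ?case by (simp add: set_lebesgue_integral_def)
  next
    case (compl A)
    then have A: "A \<in> sets borel" by (simp add: borel_Ioi)
    have "(LBINT t:A \<union> (UNIV - A). f t) = (LBINT t:A. f t) + (LBINT t:UNIV - A. f t)"
      using A by (intro set_integral_Un si) auto
    then show ?case using compl UNIV0 by (simp add: Un_Diff_cancel)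
  next
    case (union A)
    then have A: "A i \<in> sets borel" for i by (auto simp: borel_Ioi)
    have "(LBINT t:(\<Union>i. A i). f t) = (\<Sum>i. (LBINT t:A i. f t))"
      using union(1) A by (intro lebesgue_integral_countable_add si) (auto simp: disjoint_family_on_def)
    then show ?case using union by simp
  qed auto
  show "(LBINT t:A. f t) = 0" if "A \<in> sets lborel" for A
    using all[of A] that by (simp add: borel_Ioi)
qed

text \<open>For Bochner integrals with values in a general Banach space the tail integral takes the place of the
indefinite integral: it needs no case distinction on the order of the limits of integration.\<close>

lemma continuous_tail_integral:
  fixes f :: "real \<Rightarrow> 'a::{banach,second_countable_topology}"
  assumes f: "integrable lborel f"
  shows "continuous_on UNIV (\<lambda>t. LBINT s:{t..}. f s)"
  unfolding continuous_on_sequentially comp_def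
proof (intro allI ballI impI, elim conjE)
  fix X :: "nat \<Rightarrow> real" and t assume X: "X \<longlonglongrightarrow> t"
  show "(\<lambda>n. LBINT s:{X n..}. f s) \<longlonglongrightarrow> (LBINT s:{t..}. f s)"
    unfolding set_lebesgue_integral_def
  proof (rule integral_dominated_convergence[where w = "\<lambda>s. norm (f s)"])
    show "AE s in lborel. (\<lambda>n. indicator {X n..} s *\<^sub>R f s) \<longlonglongrightarrow> indicator {t..} s *\<^sub>R f s"
      using AE_lborel_singleton[of t]
    proof eventually_elim
      fix s assume "s \<noteq> t"
      then consider "s < t" | "t < s" by linarith
      then have "\<forall>\<^sub>F n in sequentially. indicator {X n..} s *\<^sub>R f s = indicator {t..} s *\<^sub>R f s"
      proof cases
        case 1
        then have "\<forall>\<^sub>F n in sequentially. s < X n" by (rule order_tendstoD(1)[OF X])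
        then show ?thesis by eventually_elim (use 1 in auto)
      next
        case 2
        then have "\<forall>\<^sub>F n in sequentially. X n < s" by (rule order_tendstoD(2)[OF X])
        then show ?thesis by eventually_elim (use 2 in auto)
      qed
      then show "(\<lambda>n. indicator {X n..} s *\<^sub>R f s) \<longlonglongrightarrow> indicator {t..} s *\<^sub>R f s"
        by (rule tendsto_eventually)
    qed
  qed (use f in \<open>auto simp: indicator_def\<close>)
qed

lemma tail_integral_diff:
  fixes f :: "real \<Rightarrow> 'a::{banach,second_countable_topology}"
  assumes f: "integrable lborel f" and "s \<le> t"
  shows "(LBINT \<tau>:{s..}. f \<tau>) - (LBINT \<tau>:{t..}. f \<tau>) = (LBINT \<tau>:{s..t}. f \<tau>)"
proof -
  note si = integrable_imp_set_integrable[OF f]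
  have split: "{s..} = {s..<t} \<union> {t..}" using assms(2) by auto
  have "(LBINT \<tau>:{s..}. f \<tau>) = (LBINT \<tau>:{s..<t}. f \<tau>) + (LBINT \<tau>:{t..}. f \<tau>)"
    unfolding split by (rule set_integral_Un) (auto intro!: si)
  moreover have "({s..t} - {s..<t}) \<union> ({s..<t} - {s..t}) = {t}" using assms(2) by auto
  then have "(LBINT \<tau>:{s..t}. f \<tau>) = (LBINT \<tau>:{s..<t}. f \<tau>)"
    by (intro set_integral_null_delta[OF f]) auto
  ultimately show ?thesis by simp
qed

lemma has_vector_derivative_tail_integral:
  fixes f :: "real \<Rightarrow> 'a::{banach,second_countable_topology}"
  assumes f: "integrable lborel f" and c: "isCont f t"
  shows "((\<lambda>t. LBINT s:{t..}. f s) has_vector_derivative - f t) (at t)"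
  unfolding has_vector_derivative_def has_derivative_iff_norm
proof (intro conjI bounded_linear_scaleR_left)
  define E where "E t = (LBINT s:{t..}. f s)" for t
  note si = integrable_imp_set_integrable[OF f]
  have key: "norm ((LBINT \<tau>:{a..b}. f \<tau>) - (b - a) *\<^sub>R f t) \<le> e * (b - a)"
    if "a \<le> b" "\<And>\<tau>. \<tau> \<in> {a..b} \<Longrightarrow> norm (f \<tau> - f t) \<le> e" for a b e
  proof -
    have ci: "set_integrable lborel {a..b} (\<lambda>_. v)" "(LBINT \<tau>:{a..b}. v) = (b - a) *\<^sub>R v" for v :: "'b::{banach,second_countable_topology}"
      using that(1) by (auto simp: set_integrable_def set_lebesgue_integral_def)
    have "(LBINT \<tau>:{a..b}. f \<tau>) - (b - a) *\<^sub>R f t = (LBINT \<tau>:{a..b}. f \<tau> - f t)"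
      using si[of "{a..b}"] ci(1)[of "f t"] ci(2)[of "f t"] by (subst set_integral_diff) auto
    also have "norm \<dots> \<le> (LBINT \<tau>:{a..b}. norm (f \<tau> - f t))"
      by (intro set_integral_norm_bound set_integral_diff(1) si ci) auto
    also have "\<dots> \<le> (LBINT \<tau>:{a..b}. e)"
      by (intro set_integral_mono set_integrable_norm set_integral_diff(1) si ci) (use that in auto)
    finally show ?thesis using ci(2)[of e] by (simp add: mult.commute)
  qed
  show "((\<lambda>y. norm ((LBINT s:{y..}. f s) - (LBINT s:{t..}. f s) - (y - t) *\<^sub>R - f t) / norm (y - t)) \<longlongrightarrow> 0) (at t)"
    unfolding E_def[symmetric]
  proof (rule tendstoI)
    fix e :: real assume e: "0 < e"
    then obtain d where d: "0 < d" "\<And>\<tau>. dist \<tau> t < d \<Longrightarrow> dist (f \<tau>) (f t) < e / 2"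
      using c unfolding continuous_at_eps_delta by (meson half_gt_zero)
    have "\<forall>\<^sub>F y in at t. dist y t < d" "\<forall>\<^sub>F y in at t. y \<noteq> t"
      using d(1) by (auto simp: eventually_at intro: exI[of _ d])
    then show "\<forall>\<^sub>F y in at t. dist (norm (E y - E t - (y - t) *\<^sub>R - f t) / norm (y - t)) 0 < e"
    proof eventually_elim
      fix y assume y: "dist y t < d" "y \<noteq> t"
      have le: "norm (f \<tau> - f t) \<le> e / 2" if "\<tau> \<in> {min y t..max y t}" for \<tau>
      proof -
        have "dist \<tau> t < d" using that y by (auto simp: dist_real_def)
        then show ?thesis using d(2)[of \<tau>] by (simp add: dist_norm)
      qed
      have "E (min y t) - E (max y t) = (LBINT \<tau>:{min y t..max y t}. f \<tau>)"
        unfolding E_def by (rule tail_integral_diff[OF f]) auto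
      then have "norm (E (min y t) - E (max y t) - (max y t - min y t) *\<^sub>R f t) \<le> e / 2 * (max y t - min y t)"
        using key[of "min y t" "max y t" "e / 2"] le by simp
      moreover have "norm (E y - E t - (y - t) *\<^sub>R - f t) = norm (E (min y t) - E (max y t) - (max y t - min y t) *\<^sub>R f t)"
        by (cases "y \<le> t") (auto simp: min_def max_def algebra_simps norm_minus_commute)
      moreover have "max y t - min y t = norm (y - t)" by auto
      ultimately have "norm (E y - E t - (y - t) *\<^sub>R - f t) / norm (y - t) \<le> e / 2"
        using y(2) by (simp add: divide_le_eq)
      then have "norm (E y - E t - (y - t) *\<^sub>R - f t) / norm (y - t) < e" using e by linarith
      then show "dist (norm (E y - E t - (y - t) *\<^sub>R - f t) / norm (y - t)) 0 < e" by simp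
    qed
  qed
qed

text \<open>Adding the tail integral of \<open>f\<close> to \<open>F\<close> gives a function with derivative zero. It serves mainly for functions with values in
\<open>\<H>\<^sup>-\<^sup>1\<close>.\<close>

lemma bochner_FTC:
  fixes F f :: "real \<Rightarrow> 'a::{banach,second_countable_topology}"
  assumes "a \<le> b" and F: "\<And>t. t \<in> {a..b} \<Longrightarrow> (F has_vector_derivative f t) (at t within {a..b})"
    and f: "continuous_on {a..b} f"
  shows "(LBINT t:{a..b}. f t) = F b - F a"
proof -
  have int: "integrable lborel (\<lambda>t. indicator {a..b} t *\<^sub>R f t)"
    using borel_integrable_atLeastAtMost'[OF f] by (simp add: set_integrable_def)
  define E where "E t = (LBINT s:{t..}. indicator {a..b} s *\<^sub>R f s)" for t
  have E: "E s - E t = (LBINT \<tau>:{s..t}. indicator {a..b} \<tau> *\<^sub>R f \<tau>)" if "s \<le> t" for s t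
    unfolding E_def by (rule tail_integral_diff[OF int that])
  have cF: "continuous_on {a..b} F"
    using F by (meson continuous_on_eq_continuous_within has_vector_derivative_continuous)
  have cE: "continuous_on {a..b} E"
    unfolding E_def by (rule continuous_on_subset[OF continuous_tail_integral[OF int]]) simp
  have "F b + E b = F a + E a"
  proof (rule has_derivative_zero_unique_strong_interval[where a = a and b = b and k = "{a, b}" and f = "\<lambda>t. F t + E t"])
    fix t assume "t \<in> {a..b} - {a, b}"
    then have t: "t \<in> {a<..<b}" by auto
    have "isCont (\<lambda>t. indicator {a..b} t *\<^sub>R f t) t"
    proof -
      have "isCont f t" using continuous_on_subset[OF f, of "{a<..<b}"] t
        by (simp add: continuous_on_eq_continuous_at subset_eq)
      moreover have "\<forall>\<^sub>F s in nhds t. f s = indicator {a..b} s *\<^sub>R f s"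
        using eventually_nhds_in_open[OF open_greaterThanLessThan t] by eventually_elim simp
      ultimately show ?thesis by (subst isCont_cong[symmetric]) auto
    qed
    from has_vector_derivative_tail_integral[OF int this] t
    have "(E has_vector_derivative - f t) (at t within {a..b})"
      unfolding E_def by (auto intro: has_vector_derivative_at_within)
    then have "((\<lambda>t. F t + E t) has_vector_derivative f t + - f t) (at t within {a..b})"
      using t by (intro has_vector_derivative_add F) auto
    then show "((\<lambda>t. F t + E t) has_derivative (\<lambda>h. 0)) (at t within {a..b})"
      by (simp add: has_vector_derivative_def)
  qed (use assms(1) in \<open>auto intro!: continuous_on_add cF cE\<close>)
  moreover have "(LBINT \<tau>:{a..b}. indicator {a..b} \<tau> *\<^sub>R f \<tau>) = (LBINT t:{a..b}. f t)"
    by (rule set_lebesgue_integral_cong) auto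
  ultimately show ?thesis using E[OF assms(1)] by (simp add: algebra_simps)
qed

text \<open>Both sides have the same increments on \<open>(0,T)\<close> and the same limit at \<open>T\<close>.\<close>

lemma eq_tail_integral:
  fixes f h :: "real \<Rightarrow> 'a::{banach,second_countable_topology}"
  assumes f: "set_integrable lborel {0<..<T} f"
    and h: "\<And>s t. 0 < s \<Longrightarrow> s \<le> t \<Longrightarrow> t < T \<Longrightarrow> h s - h t = (LBINT \<tau>:{s..t}. f \<tau>)"
    and lim: "(h \<longlongrightarrow> l) (at_left T)" and s: "0 < s" "s < T"
  shows "h s = l + (LBINT \<tau>:{s..T}. indicator {0<..<T} \<tau> *\<^sub>R f \<tau>)"
proof -
  define g where "g \<tau> = indicator {0<..<T} \<tau> *\<^sub>R f \<tau>" for \<tau>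
  have g: "integrable lborel g" using f by (simp add: set_integrable_def g_def[abs_def])
  define E where "E t = (LBINT \<tau>:{t..}. g \<tau>)" for t
  have "(E \<longlongrightarrow> E T) (at T)"
    using continuous_tail_integral[OF g] unfolding E_def
    by (simp add: continuous_on_eq_continuous_at isCont_def)
  then have E: "(E \<longlongrightarrow> E T) (at_left T)" by (rule tendsto_within_subset) simp
  have diff: "h s - E s = h t - E t" if "t \<in> {s<..<T}" for t
  proof -
    have "(LBINT \<tau>:{s..t}. f \<tau>) = (LBINT \<tau>:{s..t}. g \<tau>)"
      by (rule set_lebesgue_integral_cong) (use that s in \<open>auto simp: g_def\<close>)
    then show ?thesis
      using h[of s t] tail_integral_diff[OF g, of s t] that s by (simp add: E_def algebra_simps)
  qed
  have ev: "\<forall>\<^sub>F t in at_left T. h t - E t = h s - E s"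
    using eventually_at_left_real[OF s(2)] by eventually_elim (use diff in auto)
  have "((\<lambda>t. h t - E t) \<longlongrightarrow> l - E T) (at_left T)" by (intro tendsto_diff lim E)
  moreover have "((\<lambda>t. h t - E t) \<longlongrightarrow> h s - E s) (at_left T)" by (rule tendsto_eventually[OF ev])
  ultimately have "l - E T = h s - E s"
    by (rule tendsto_unique[rotated]) (simp add: trivial_limit_at_left_real)
  moreover have "E s - E T = (LBINT \<tau>:{s..T}. g \<tau>)"
    unfolding E_def using s by (intro tail_integral_diff[OF g]) auto
  ultimately show ?thesis unfolding g_def by (simp add: algebra_simps)
qed

lemma set_integral_indicator_open:
  fixes f :: "real \<Rightarrow> 'a::{banach,second_countable_topology}"
  assumes "0 < s" and f: "set_integrable lborel {s..T} f"
  shows "(LBINT \<tau>:{s..T}. indicator {0<..<T} \<tau> *\<^sub>R f \<tau>) = (LBINT \<tau>:{s..T}. f \<tau>)"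
proof -
  have g: "integrable lborel (\<lambda>\<tau>. indicator {s..T} \<tau> *\<^sub>R f \<tau>)" using f by (simp add: set_integrable_def)
  have "({s..T} - {s..<T}) \<union> ({s..<T} - {s..T}) = (if s \<le> T then {T} else {})" by auto
  then have "(LBINT \<tau>:{s..T}. indicator {s..T} \<tau> *\<^sub>R f \<tau>) = (LBINT \<tau>:{s..<T}. indicator {s..T} \<tau> *\<^sub>R f \<tau>)"
    by (intro set_integral_null_delta[OF g]) auto
  moreover have "(LBINT \<tau>:{s..T}. indicator {s..T} \<tau> *\<^sub>R f \<tau>) = (LBINT \<tau>:{s..T}. f \<tau>)"
    by (rule set_lebesgue_integral_cong) auto
  moreover have "(LBINT \<tau>:{s..<T}. indicator {s..T} \<tau> *\<^sub>R f \<tau>) = (LBINT \<tau>:{s..T}. indicator {0<..<T} \<tau> *\<^sub>R f \<tau>)"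
    unfolding set_lebesgue_integral_def
    by (intro Bochner_Integration.integral_cong) (use assms(1) in \<open>auto simp: indicator_def\<close>)
  ultimately show ?thesis by simp
qed

lemma set_integrable_closed_end:
  fixes f :: "real \<Rightarrow> 'a::{banach,second_countable_topology}"
  assumes f: "set_integrable lborel {0<..<T} f" and "0 < s"
  shows "set_integrable lborel {s..T} f"
proof (rule set_integrable_subset)
  have "(\<lambda>\<tau>. indicator {T} \<tau> *\<^sub>R f \<tau>) = (\<lambda>\<tau>. indicator {T} \<tau> *\<^sub>R f T)"
    by (auto simp: indicator_def)
  then have "set_integrable lborel {T} f" by (simp add: set_integrable_def)
  then show "set_integrable lborel ({0<..<T} \<union> {T}) f"
    by (intro set_integrable_Un f) auto
qed (use assms(2) in auto)

lemma set_integrable_reflect: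
  fixes f :: "real \<Rightarrow> 'a::{banach,second_countable_topology}"
  shows "set_integrable lborel {t..T} f \<longleftrightarrow> set_integrable lborel {0..T - t} (\<lambda>s. f (T - s))"
proof -
  have eq: "(\<lambda>s. indicator {0..T - t} s *\<^sub>R f (T - s)) = (\<lambda>s. indicator {t..T} (T + (-1) * s) *\<^sub>R f (T + (-1) * s))"
  proof
    show "indicator {0..T - t} s *\<^sub>R f (T - s) = indicator {t..T} (T + (-1) * s) *\<^sub>R f (T + (-1) * s)" for s
      by (cases "0 \<le> s \<and> s \<le> T - t") (auto simp: indicator_def)
  qed
  show ?thesis
    unfolding set_integrable_def eq
    by (rule lborel_integrable_real_affine_iff[of "-1" "\<lambda>s. indicator {t..T} s *\<^sub>R f s" T, symmetric]) simp
qed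

lemma set_integral_reflect:
  fixes f :: "real \<Rightarrow> 'a::{banach,second_countable_topology}"
  shows "(LBINT s:{t..T}. f s) = (LBINT s:{0..T - t}. f (T - s))"
proof -
  have eq: "(\<lambda>s. indicator {0..T - t} s *\<^sub>R f (T - s)) = (\<lambda>s. indicator {t..T} (T + (-1) * s) *\<^sub>R f (T + (-1) * s))"
  proof
    show "indicator {0..T - t} s *\<^sub>R f (T - s) = indicator {t..T} (T + (-1) * s) *\<^sub>R f (T + (-1) * s)" for s
      by (cases "0 \<le> s \<and> s \<le> T - t") (auto simp: indicator_def)
  qed
  show ?thesis
    unfolding set_lebesgue_integral_def eq
    using lborel_integral_real_affine[of "-1" "\<lambda>s. indicator {t..T} s *\<^sub>R f s" T] by simp
qed

section \<open>Fractional integrals and derivatives\<close>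

text \<open>The Beta integral, transported from \<open>[0,1]\<close> to \<open>[\<tau>,t]\<close>. It also holds for \<open>\<tau> = t\<close>, where both sides are \<open>0\<close> because
\<open>0 powr x = 0\<close>.\<close>

lemma has_bochner_integral_beta_kernel:
  fixes a b \<tau> t :: real
  assumes "0 < a" "0 < b" "\<tau> \<le> t"
  shows "has_bochner_integral lborel
    (\<lambda>s. indicator {\<tau>..t} s * ((t - s) powr (a - 1) * (s - \<tau>) powr (b - 1)))
    (Beta a b * (t - \<tau>) powr (a + b - 1))"
proof (cases "\<tau> = t")
  case True
  have "AE s in lborel. indicator {\<tau>..t} s * ((t - s) powr (a - 1) * (s - \<tau>) powr (b - 1)) = 0"
    using True by (auto simp: indicator_def)
  then have "has_bochner_integral lborel (\<lambda>s. indicator {\<tau>..t} s * ((t - s) powr (a - 1) * (s - \<tau>) powr (b - 1))) 0"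
    by (subst has_bochner_integral_cong_AE[where g = "\<lambda>_. 0"]) (auto intro: has_bochner_integral_zero)
  then show ?thesis using True by simp
next
  case False
  define c where "c = t - \<tau>"
  have c: "0 < c" using False assms(3) by (simp add: c_def)
  let ?f = "\<lambda>x::real. x powr (b - 1) * (1 - x) powr (a - 1)"
  have hi: "(?f has_integral Beta a b) {0..1}"
    using has_integral_Beta_real[OF assms(2,1)] by (simp add: Beta_commute)
  then have "?f absolutely_integrable_on {0..1}"
    by (intro nonnegative_absolutely_integrable_1) (auto simp: integrable_on_def)
  then have si: "set_integrable lborel {0..1} ?f"
    unfolding set_integrable_def by (subst (asm) integrable_completion) auto
  have "(LBINT x:{0..1}. ?f x) = Beta a b"
    using set_borel_integral_eq_integral(2)[OF si] hi by (simp add: integral_unique)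
  with si have "has_bochner_integral lborel (\<lambda>x. indicator {0..1} x * ?f x) (Beta a b)"
    by (simp add: has_bochner_integral_iff set_integrable_def set_lebesgue_integral_def)
  from has_bochner_integral_mult_right[OF this, of "c powr (a + b - 2)"]
  have 1: "has_bochner_integral lborel (\<lambda>x. c powr (a + b - 2) * (indicator {0..1} x * ?f x))
      (c powr (a + b - 2) * Beta a b)" by simp
  have 2: "indicator {\<tau>..t} (\<tau> + c * x) * ((t - (\<tau> + c * x)) powr (a - 1) * (\<tau> + c * x - \<tau>) powr (b - 1))
      = c powr (a + b - 2) * (indicator {0..1} x * ?f x)" for x
  proof -
    have ind: "(indicator {\<tau>..t} (\<tau> + c * x) :: real) = indicator {0..1} x"
    proof -
      have "\<tau> + c * x \<le> t \<longleftrightarrow> c * x \<le> c * 1" by (simp add: c_def algebra_simps)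
      then show ?thesis using c by (simp add: indicator_def zero_le_mult_iff)
    qed
    show ?thesis
    proof (cases "x \<in> {0..1}")
      case True
      have "t - (\<tau> + c * x) = c * (1 - x)" by (simp add: c_def algebra_simps)
      moreover have "c powr (a - 1) * c powr (b - 1) = c powr (a + b - 2)"
        by (simp flip: powr_add)
      ultimately show ?thesis using True c unfolding ind by (simp add: powr_mult)
    qed (simp add: ind)
  qed
  have v: "c powr (a + b - 2) * Beta a b = (Beta a b * (t - \<tau>) powr (a + b - 1)) /\<^sub>R \<bar>c\<bar>"
  proof -
    have "c powr (a + b - 1) = c powr (a + b - 2) * c"
      using c powr_add[of c "a + b - 2" 1] by simp
    then show ?thesis using c by (simp flip: c_def)
  qed
  have "has_bochner_integral lborel
      (\<lambda>x. indicator {\<tau>..t} (\<tau> + c * x) * ((t - (\<tau> + c * x)) powr (a - 1) * (\<tau> + c * x - \<tau>) powr (b - 1)))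
      ((Beta a b * (t - \<tau>) powr (a + b - 1)) /\<^sub>R \<bar>c\<bar>)"
    unfolding 2 v[symmetric] by (rule 1)
  then show ?thesis
    by (rule lborel_has_bochner_integral_real_affine_iff[THEN iffD2, rotated]) (use c in simp)
qed

text \<open>Fubini's theorem reduces this to the Beta integral. The condition \<open>1 \<le> a + b\<close> makes the kernel of the
composition bounded, so that the law holds at every \<open>t\<close> and not only almost everywhere. The inner integral may fail to exist on a null
set of times, which the outer integral does not see.\<close>

lemma rl_integral_left_semigroup:
  fixes y :: "real \<Rightarrow> 'a::{banach,second_countable_topology}"
  assumes ab: "0 < a" "0 < b" "1 \<le> a + b" and y: "set_integrable lborel {0..t} y"
  shows "rl_integral_left a (rl_integral_left b y) t = rl_integral_left (a + b) y t"
proof -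
  define Y where "Y \<tau> = indicator {0..t} \<tau> *\<^sub>R y \<tau>" for \<tau>
  have Y: "integrable lborel Y" and Y0: "\<And>\<tau>. \<tau> \<notin> {0..t} \<Longrightarrow> Y \<tau> = 0"
    using y by (auto simp: Y_def[abs_def] set_integrable_def)
  have Ym[measurable]: "Y \<in> borel_measurable borel" using Y by auto
  define w where "w \<tau> s = indicator {\<tau>..t} s * ((t - s) powr (a - 1) * (s - \<tau>) powr (b - 1))" for \<tau> s
  let ?W = "\<lambda>\<tau>. Beta a b * (t - \<tau>) powr (a + b - 1)"
  have w: "has_bochner_integral lborel (w \<tau>) (?W \<tau>)" if "\<tau> \<le> t" for \<tau>
    unfolding w_def[abs_def] by (rule has_bochner_integral_beta_kernel[OF ab(1,2) that])
  have w0: "0 \<le> w \<tau> s" for \<tau> s by (simp add: w_def)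
  have Beta0: "0 \<le> Beta a b" using ab by (simp add: Beta_def Gamma_real_pos less_imp_le)
  have m: "{p \<in> space (lborel \<Otimes>\<^sub>M lborel). fst p \<le> snd p \<and> snd p \<le> t} \<in> sets (lborel \<Otimes>\<^sub>M lborel)"
    by measurable
  have ind: "(\<lambda>(\<tau>, s). indicat_real {\<tau>..t} s) = indicator {p. fst p \<le> snd p \<and> snd p \<le> t}"
    by (auto simp: indicator_def fun_eq_iff)
  have im[measurable]: "(\<lambda>(\<tau>, s). indicat_real {\<tau>..t} s) \<in> borel_measurable (lborel \<Otimes>\<^sub>M lborel)"
    unfolding ind using m by (intro borel_measurable_indicator) (simp add: space_pair_measure)
  have wm[measurable]: "(\<lambda>(\<tau>, s). w \<tau> s) \<in> borel_measurable (lborel \<Otimes>\<^sub>M lborel)"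
    unfolding w_def using im by (auto intro!: borel_measurable_times simp: split_beta')
  have int: "integrable lborel (\<lambda>s. w \<tau> s *\<^sub>R Y \<tau>)" for \<tau>
    using w[of \<tau>] Y0[of \<tau>] by (cases "\<tau> \<in> {0..t}") (auto simp: has_bochner_integral_iff)
  have F: "integrable (lborel \<Otimes>\<^sub>M lborel) (\<lambda>(\<tau>, s). w \<tau> s *\<^sub>R Y \<tau>)"
  proof (rule lborel_pair.Fubini_integrable)
    show "(\<lambda>(\<tau>, s). w \<tau> s *\<^sub>R Y \<tau>) \<in> borel_measurable (lborel \<Otimes>\<^sub>M lborel)"
      by measurable
    show "AE \<tau> in lborel. integrable lborel (\<lambda>s. case (\<tau>, s) of (\<tau>, s) \<Rightarrow> w \<tau> s *\<^sub>R Y \<tau>)"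
      using int by simp
    have "(LBINT s. norm (case (\<tau>, s) of (\<tau>, s) \<Rightarrow> w \<tau> s *\<^sub>R Y \<tau>)) = ?W \<tau> * norm (Y \<tau>)" for \<tau>
      using w[of \<tau>] Y0[of \<tau>] w0 by (cases "\<tau> \<in> {0..t}") (auto simp: has_bochner_integral_iff)
    moreover have "integrable lborel (\<lambda>\<tau>. ?W \<tau> * norm (Y \<tau>))"
    proof (rule Bochner_Integration.integrable_bound)
      show "integrable lborel (\<lambda>\<tau>. (Beta a b * t powr (a + b - 1)) * norm (Y \<tau>))" using Y by auto
      have "?W \<tau> * norm (Y \<tau>) \<le> (Beta a b * t powr (a + b - 1)) * norm (Y \<tau>)" for \<tau>
        using Y0[of \<tau>] ab Beta0
        by (cases "\<tau> \<in> {0..t}") (auto intro!: mult_right_mono mult_left_mono powr_mono2)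
      then show "AE \<tau> in lborel. norm (?W \<tau> * norm (Y \<tau>)) \<le> norm ((Beta a b * t powr (a + b - 1)) * norm (Y \<tau>))"
        using Beta0 by (simp add: abs_mult)
    qed measurable
    ultimately show "integrable lborel (\<lambda>\<tau>. LBINT s. norm (case (\<tau>, s) of (\<tau>, s) \<Rightarrow> w \<tau> s *\<^sub>R Y \<tau>))"
      by (simp only:)
  qed
  have inner: "indicator {0..t} s *\<^sub>R ((t - s) powr (a - 1) *\<^sub>R (LBINT \<tau>:{0..s}. (s - \<tau>) powr (b - 1) *\<^sub>R y \<tau>))
      = (LBINT \<tau>. w \<tau> s *\<^sub>R Y \<tau>)" for s
    unfolding set_lebesgue_integral_def Y_def w_def integral_scaleR_right[symmetric]
    by (intro Bochner_Integration.integral_cong refl) (auto simp: indicator_def)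
  have "(LBINT s:{0..t}. (t - s) powr (a - 1) *\<^sub>R (LBINT \<tau>:{0..s}. (s - \<tau>) powr (b - 1) *\<^sub>R y \<tau>))
      = (LBINT s. LBINT \<tau>. w \<tau> s *\<^sub>R Y \<tau>)"
    unfolding set_lebesgue_integral_def[of lborel "{0..t}"] inner ..
  also have "\<dots> = (LBINT \<tau>. LBINT s. w \<tau> s *\<^sub>R Y \<tau>)"
    by (rule lborel_pair.Fubini_integral[OF F])
  also have "\<dots> = (LBINT \<tau>. Beta a b *\<^sub>R (indicator {0..t} \<tau> *\<^sub>R (t - \<tau>) powr (a + b - 1) *\<^sub>R y \<tau>))"
  proof (intro Bochner_Integration.integral_cong refl)
    show "(LBINT s. w \<tau> s *\<^sub>R Y \<tau>) = Beta a b *\<^sub>R (indicator {0..t} \<tau> *\<^sub>R (t - \<tau>) powr (a + b - 1) *\<^sub>R y \<tau>)" for \<tau>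
      using w[of \<tau>] by (cases "\<tau> \<in> {0..t}") (auto simp: Y_def has_bochner_integral_iff)
  qed
  also have "\<dots> = Beta a b *\<^sub>R (LBINT \<tau>:{0..t}. (t - \<tau>) powr (a + b - 1) *\<^sub>R y \<tau>)"
    unfolding set_lebesgue_integral_def by (rule integral_scaleR_right)
  finally have "(LBINT s:{0..t}. (t - s) powr (a - 1) *\<^sub>R (LBINT \<tau>:{0..s}. (s - \<tau>) powr (b - 1) *\<^sub>R y \<tau>))
      = Beta a b *\<^sub>R (LBINT \<tau>:{0..t}. (t - \<tau>) powr (a + b - 1) *\<^sub>R y \<tau>)" .
  moreover have "Beta a b / (Gamma a * Gamma b) = 1 / Gamma (a + b)"
    using Gamma_real_pos[OF ab(1)] Gamma_real_pos[OF ab(2)] by (simp add: Beta_def)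
  moreover have "(LBINT s:{0..t}. (t - s) powr (a - 1) *\<^sub>R ((1 / Gamma b) *\<^sub>R (LBINT \<tau>:{0..s}. (s - \<tau>) powr (b - 1) *\<^sub>R y \<tau>)))
      = (1 / Gamma b) *\<^sub>R (LBINT s:{0..t}. (t - s) powr (a - 1) *\<^sub>R (LBINT \<tau>:{0..s}. (s - \<tau>) powr (b - 1) *\<^sub>R y \<tau>))"
    unfolding set_integral_scaleR_right[symmetric] by (simp add: mult.commute)
  ultimately show ?thesis
    unfolding rl_integral_left_def by (simp add: mult.commute)
qed

text \<open>Time reversal transfers everything known about the left-sided integral.\<close>

lemma rl_integral_right_eq_left:
  "rl_integral_right b T y t = rl_integral_left b (\<lambda>s. y (T - s)) (T - t)"
  unfolding rl_integral_right_def rl_integral_left_def set_integral_reflect[of t T]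
  by (simp add: algebra_simps)

lemma rl_integral_right_semigroup:
  assumes "0 < a" "0 < b" "1 \<le> a + b" "set_integrable lborel {t..T} y"
  shows "rl_integral_right a T (rl_integral_right b T y) t = rl_integral_right (a + b) T y t"
  using assms(4) rl_integral_left_semigroup[OF assms(1-3)]
  by (simp add: rl_integral_right_eq_left set_integrable_reflect[of t T y])

lemma rl_integral_left_cong:
  assumes "\<And>s. s \<in> {0..t} \<Longrightarrow> f s = g s"
  shows "rl_integral_left b f t = rl_integral_left b g t"
  unfolding rl_integral_left_def by (subst set_lebesgue_integral_cong[of _ _ _ "\<lambda>s. (t - s) powr (b - 1) *\<^sub>R g s"]) (auto simp: assms)

lemma rl_integral_left_0: "rl_integral_left b y 0 = 0"
proof -
  have "(LBINT s:{0..0}. (0 - s) powr (b - 1) *\<^sub>R y s) = (LBINT s:{0..0::real}. 0)"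
    by (rule set_lebesgue_integral_cong) auto
  then show ?thesis by (simp add: rl_integral_left_def)
qed

lemma rl_integral_left_1:
  fixes y :: "real \<Rightarrow> 'a::{banach,second_countable_topology}"
  assumes "set_integrable lborel {0..t} y"
  shows "rl_integral_left 1 y t = (LBINT s:{0..t}. y s)"
proof -
  have y: "(\<lambda>s. indicator {0..t} s *\<^sub>R y s) \<in> borel_measurable lborel"
    using assms by (auto simp: set_integrable_def)
  have "(\<lambda>s. indicator {0..<t} s *\<^sub>R (indicator {0..t} s *\<^sub>R y s)) \<in> borel_measurable lborel"
    using y by measurable
  moreover have "indicator {0..<t} s *\<^sub>R (indicator {0..t} s *\<^sub>R y s) = indicator {0..t} s *\<^sub>R ((t - s) powr 0 *\<^sub>R y s)" for s
    by (auto simp: indicator_def)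
  ultimately have "(\<lambda>s. indicator {0..t} s *\<^sub>R ((t - s) powr 0 *\<^sub>R y s)) \<in> borel_measurable lborel"
    by (simp only:)
  moreover have "AE s in lborel. indicator {0..t} s *\<^sub>R ((t - s) powr 0 *\<^sub>R y s) = indicator {0..t} s *\<^sub>R y s"
    using AE_lborel_singleton[of t] by eventually_elim auto
  ultimately have "(LBINT s. indicator {0..t} s *\<^sub>R ((t - s) powr 0 *\<^sub>R y s)) = (LBINT s. indicator {0..t} s *\<^sub>R y s)"
    using y by (intro integral_cong_AE) auto
  then show ?thesis by (simp add: rl_integral_left_def set_lebesgue_integral_def)
qed

lemma rl_integral_left_const:
  assumes "0 < b" "0 \<le> t"
  shows "rl_integral_left b (\<lambda>_. v) t = (t powr b / Gamma (b + 1)) *\<^sub>R v"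
proof -
  have "(LBINT s:{0..t}. (t - s) powr (b - 1) *\<^sub>R v) = (t powr b / b) *\<^sub>R v"
    using has_bochner_integral_powr(2)[OF assms(1), of 0 t] assms(2)
    by (simp add: set_lebesgue_integral_def has_bochner_integral_iff)
  moreover have "b \<notin> \<int>\<^sub>\<le>\<^sub>0" using assms(1) by (auto elim!: nonpos_Ints_cases)
  ultimately show ?thesis
    using assms(1) by (simp add: rl_integral_left_def Gamma_plus1 mult.commute)
qed

text \<open>For \<open>b \<ge> 1\<close> the kernel is bounded on \<open>[0,t]\<close>.\<close>

lemma set_integrable_power_kernel:
  fixes y :: "real \<Rightarrow> 'a::{banach,second_countable_topology}"
  assumes "1 \<le> b" and y: "set_integrable lborel {0..t} y"
  shows "set_integrable lborel {0..t} (\<lambda>s. (t - s) powr (b - 1) *\<^sub>R y s)"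
proof -
  have "integrable lborel (\<lambda>s. (t - s) powr (b - 1) *\<^sub>R (indicator {0..t} s *\<^sub>R y s))"
  proof (rule Bochner_Integration.integrable_bound)
    show "integrable lborel (\<lambda>s. t powr (b - 1) *\<^sub>R (indicator {0..t} s *\<^sub>R y s))"
      using y by (intro integrable_scaleR_right) (simp add: set_integrable_def)
    show "(\<lambda>s. (t - s) powr (b - 1) *\<^sub>R (indicator {0..t} s *\<^sub>R y s)) \<in> borel_measurable lborel"
      by (rule borel_measurable_scaleR) (use y in \<open>auto simp: set_integrable_def\<close>)
    show "AE s in lborel. norm ((t - s) powr (b - 1) *\<^sub>R (indicator {0..t} s *\<^sub>R y s))
        \<le> norm (t powr (b - 1) *\<^sub>R (indicator {0..t} s *\<^sub>R y s))"
      using assms(1) by (intro AE_I2) (auto simp: indicator_def intro!: mult_right_mono powr_mono2)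
  qed
  then show ?thesis by (simp add: set_integrable_def mult.commute)
qed

lemma rl_integral_left_add:
  assumes "1 \<le> b" "set_integrable lborel {0..t} f" "set_integrable lborel {0..t} g"
  shows "rl_integral_left b (\<lambda>s. f s + g s) t = rl_integral_left b f t + rl_integral_left b g t"
  using assms set_integrable_power_kernel[OF assms(1,2)] set_integrable_power_kernel[OF assms(1,3)]
  by (simp add: rl_integral_left_def scaleR_add_right)

text \<open>The kernel of the fractional integral of order \<open>\<alpha>\<close>. For \<open>\<alpha> > 1\<close> it is continuous up to \<open>0\<close>.\<close>

definition memory_kernel :: "real \<Rightarrow> real \<Rightarrow> real"
  where "memory_kernel \<alpha> x = x powr (\<alpha> - 1) / Gamma \<alpha>"

lemma continuous_memory_kernel:
  assumes "1 < \<alpha>" shows "continuous_on {0..T} (memory_kernel \<alpha>)"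
  unfolding memory_kernel_def divide_inverse
  using assms by (intro continuous_on_mult continuous_on_powr' continuous_intros) auto

lemma rl_integral_left_apply:
  fixes g :: "real \<Rightarrow> 'a::{banach,second_countable_topology}"
    and L :: "'a \<Rightarrow> 'b::{banach,second_countable_topology}"
  assumes "1 \<le> \<alpha>" "set_integrable lborel {0..t} g" and L: "bounded_linear L"
  shows "L (rl_integral_left \<alpha> g t) = (LBINT s:{0..t}. memory_kernel \<alpha> (t - s) *\<^sub>R L (g s))"
proof -
  note s = set_integral_bounded_linear(2)[OF L set_integrable_power_kernel[OF assms(1,2)]]
  have "L (rl_integral_left \<alpha> g t) = (LBINT s:{0..t}. (1 / Gamma \<alpha>) *\<^sub>R ((t - s) powr (\<alpha> - 1) *\<^sub>R L (g s)))"
    using s by (subst set_integral_scaleR_right)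
      (simp add: rl_integral_left_def linear_scale[OF bounded_linear.linear[OF L]])
  also have "\<dots> = (LBINT s:{0..t}. memory_kernel \<alpha> (t - s) *\<^sub>R L (g s))"
    by (simp add: memory_kernel_def)
  finally show ?thesis .
qed

text \<open>The definition of the Caputo derivative reads \<open>I\<^sup>2\<^sup>-\<^sup>\<alpha> (y' - y' 0) = I\<^sup>1 g\<close>. Applying \<open>I\<^sup>\<alpha>\<^sup>-\<^sup>1\<close> to both sides gives
\<open>I\<^sup>1 (y' - y' 0) = I\<^sup>\<alpha> g\<close>, and the left-hand side is known from the fundamental theorem of calculus.\<close>

lemma caputo_imp_volterra:
  fixes y y' g :: "real \<Rightarrow> 'a::{banach,second_countable_topology}"
  assumes \<alpha>: "1 < \<alpha>" "\<alpha> < 2"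
    and D: "has_caputo_derivative \<alpha> T y' g"
    and y: "\<And>t. t \<in> {0..T} \<Longrightarrow> (y has_vector_derivative y' t) (at t within {0..T})"
    and y': "continuous_on {0..T} y'" and t: "t \<in> {0..T}"
  shows "y t = y 0 + t *\<^sub>R y' 0 + rl_integral_left \<alpha> g t"
proof -
  let ?z = "\<lambda>s. y' s - y' 0"
  have sub: "{0..t} \<subseteq> {0..T}" using t by auto
  have g: "set_integrable lborel {0..s} g" if "s \<in> {0..T}" for s
    using D that unfolding has_caputo_derivative_def by (auto intro: set_integrable_subset)
  have eq: "rl_integral_left (2 - \<alpha>) ?z s = rl_integral_left 1 g s" if "s \<in> {0..T}" for s
    using D that by (simp add: has_caputo_derivative_def rl_integral_left_1[OF g[OF that]])
  have c: "continuous_on {0..t} y'" by (rule continuous_on_subset[OF y' sub])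
  have z: "set_integrable lborel {0..t} ?z"
    by (intro borel_integrable_atLeastAtMost' continuous_intros c)
  have "(LBINT s:{0..t}. ?z s) = rl_integral_left ((\<alpha> - 1) + (2 - \<alpha>)) ?z t"
    by (simp add: rl_integral_left_1[OF z])
  also have "\<dots> = rl_integral_left (\<alpha> - 1) (rl_integral_left (2 - \<alpha>) ?z) t"
    using \<alpha> z by (intro rl_integral_left_semigroup[symmetric]) auto
  also have "\<dots> = rl_integral_left (\<alpha> - 1) (rl_integral_left 1 g) t"
    by (rule rl_integral_left_cong) (use eq sub in auto)
  also have "\<dots> = rl_integral_left ((\<alpha> - 1) + 1) g t"
    using \<alpha> g[OF t] by (intro rl_integral_left_semigroup) auto
  finally have 1: "(LBINT s:{0..t}. ?z s) = rl_integral_left \<alpha> g t" by simp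
  have "(LBINT s:{0..t}. ?z s) = (y t - t *\<^sub>R y' 0) - (y 0 - 0 *\<^sub>R y' 0)"
  proof (rule bochner_FTC[where F = "\<lambda>t. y t - t *\<^sub>R y' 0"])
    fix s assume s: "s \<in> {0..t}"
    have "(y has_vector_derivative y' s) (at s within {0..t})"
      using y[of s] s sub by (auto intro: has_vector_derivative_within_subset)
    then show "((\<lambda>t. y t - t *\<^sub>R y' 0) has_vector_derivative ?z s) (at s within {0..t})"
      by (auto intro!: derivative_eq_intros)
  qed (use t c in \<open>auto intro!: continuous_intros\<close>)
  then show ?thesis using 1 by (simp add: algebra_simps)
qed

text \<open>Write \<open>I\<close> for the right-sided integrals and \<open>e\<close> for \<open>d2\<close> extended by zero. Integrating the two outer derivatives from \<open>T\<close>, with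
the two traces as constants of integration, gives \<open>I\<^sup>2\<^sup>-\<^sup>\<alpha> y = I\<^sup>1 D1\<close> with \<open>D1 = r + I\<^sup>1 e\<close>. Applying \<open>I\<^sup>\<alpha>\<^sup>-\<^sup>1\<close>
yields \<open>I\<^sup>1 y = I\<^sup>\<alpha> D1 = I\<^sup>1 (I\<^sup>\<alpha>\<^sup>-\<^sup>1 r + I\<^sup>\<alpha> e)\<close>, and an integrable function is determined almost everywhere by its
integrals.\<close>

lemma right_rl_imp_volterra:
  fixes y d1 d2 :: "real \<Rightarrow> 'a::{banach,second_countable_topology}"
  assumes \<alpha>: "1 < \<alpha>" "\<alpha> < 2"
    and D: "has_right_rl_derivatives \<alpha> T y d1 d2"
    and y: "set_integrable lborel {0<..<T} y"
    and lim0: "(rl_integral_right (2 - \<alpha>) T y \<longlongrightarrow> 0) (at_left T)"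
    and lim1: "(d1 \<longlongrightarrow> r) (at_left T)"
  shows "AE t\<in>{0<..<T} in lborel. y t = ((T - t) powr (\<alpha> - 1) / Gamma \<alpha>) *\<^sub>R r + rl_integral_right \<alpha> T (\<lambda>s. indicator {0<..<T} s *\<^sub>R d2 s) t"
proof -
  define e where "e s = indicator {0<..<T} s *\<^sub>R d2 s" for s
  define J where "J = rl_integral_right (2 - \<alpha>) T y"
  define D1 where "D1 s = r + rl_integral_right 1 T e s" for s
  have d2: "set_integrable lborel {0<..<T} d2" using D by (simp add: has_right_rl_derivatives_def)
  then have e: "integrable lborel e" by (simp add: e_def[abs_def] set_integrable_def)
  note si = integrable_imp_set_integrable
  have one: "rl_integral_right 1 T f s = (LBINT \<tau>:{s..T}. f \<tau>)" if "set_integrable lborel {s..T} f" for f :: "real \<Rightarrow> 'a" and s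
    unfolding rl_integral_right_eq_left set_integral_reflect[of s T f]
    using that by (intro rl_integral_left_1) (simp add: set_integrable_reflect[of s T f])
  have D1e: "D1 s = r + (LBINT \<tau>:{s..T}. e \<tau>)" for s by (simp add: D1_def one si e)
  \<comment> \<open>The trace of the derivative of order \<open>\<alpha> - 1\<close> fixes the first constant of integration, that of \<open>I\<^sup>2\<^sup>-\<^sup>\<alpha> y\<close> the second.\<close>
  have d1: "d1 s = D1 s" if "0 < s" "s < T" for s
    unfolding D1e e_def
  proof (rule eq_tail_integral[OF d2 _ lim1 that])
    show "d1 s - d1 t = (LBINT \<tau>:{s..t}. d2 \<tau>)" if "0 < s" "s \<le> t" "t < T" for s t
      using D that by (auto simp: has_right_rl_derivatives_def)
  qed
  have cD1: "continuous_on UNIV (\<lambda>s. r + ((LBINT \<tau>:{s..}. e \<tau>) - (LBINT \<tau>:{T..}. e \<tau>)))"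
    by (intro continuous_intros continuous_tail_integral e)
  have contD1: "continuous_on {s..T} D1" for s
    by (rule continuous_on_eq[OF continuous_on_subset[OF cD1]]) (auto simp: D1e tail_integral_diff[OF e])
  have intD1: "set_integrable lborel {s..T} D1" for s
    by (rule borel_integrable_atLeastAtMost'[OF contD1])
  have J: "J s = (LBINT \<tau>:{s..T}. D1 \<tau>)" if s: "0 < s" "s < T" for s
  proof -
    have "J s = 0 + (LBINT \<tau>:{s..T}. indicator {0<..<T} \<tau> *\<^sub>R D1 \<tau>)"
    proof (rule eq_tail_integral[OF _ _ lim0[folded J_def] s])
      show "set_integrable lborel {0<..<T} D1" by (rule set_integrable_subset[OF intD1[of 0]]) auto
      fix s t assume st: "0 < s" "s \<le> t" "t < T"
      have "(LBINT \<tau>:{s..t}. D1 \<tau>) = - J t - (- J s)"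
      proof (rule bochner_FTC[where F = "\<lambda>t. - J t"])
        fix \<tau> assume \<tau>: "\<tau> \<in> {s..t}"
        then have \<tau>0: "0 < \<tau>" "\<tau> < T" using st by auto
        then have "(J has_vector_derivative - D1 \<tau>) (at \<tau>)"
          using D unfolding has_right_rl_derivatives_def J_def d1[OF \<tau>0, symmetric] by simp
        from has_vector_derivative_minus[OF this]
        show "((\<lambda>t. - J t) has_vector_derivative D1 \<tau>) (at \<tau> within {s..t})"
          by (auto intro: has_vector_derivative_at_within)
      next
        show "continuous_on {s..t} D1" by (rule continuous_on_subset[OF contD1[of s]]) (use st in auto)
      qed (use st in auto)
      then show "J s - J t = (LBINT \<tau>:{s..t}. D1 \<tau>)" by simp
    qed
    also have "(LBINT \<tau>:{s..T}. indicator {0<..<T} \<tau> *\<^sub>R D1 \<tau>) = (LBINT \<tau>:{s..T}. D1 \<tau>)"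
      by (rule set_integral_indicator_open[OF s(1) intD1])
    finally show ?thesis by simp
  qed
  define f where "f t = y t - (rl_integral_right (\<alpha> - 1) T (\<lambda>_. r) t + rl_integral_right \<alpha> T e t)" for t
  have yT: "set_integrable lborel {s..T} y" if "0 < s" for s
    by (rule set_integrable_closed_end[OF y that])
  have cr: "set_integrable lborel {s..T} (\<lambda>_. r)" for s
    by (intro borel_integrable_atLeastAtMost' continuous_intros)
  have intrl: "set_integrable lborel {s..T} (rl_integral_right b T f)" if "0 < b" "set_integrable lborel {s..T} f" for b s and f :: "real \<Rightarrow> 'a"
    using rl_integral_left_primitive(2)[OF that(1), of "T - s" "\<lambda>s. f (T - s)"] that(2)
    unfolding set_integrable_reflect[of s T f] set_integrable_reflect[of s T "rl_integral_right b T f"]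
    by (simp add: rl_integral_right_eq_left)
  \<comment> \<open>\<open>I\<^sup>\<alpha>\<^sup>-\<^sup>1\<close> completes \<open>I\<^sup>2\<^sup>-\<^sup>\<alpha>\<close> to \<open>I\<^sup>1\<close>; on the other side one \<open>I\<^sup>1\<close> is split off again.\<close>
  have f0: "(LBINT \<tau>:{s..T}. f \<tau>) = 0" if s: "0 < s" "s < T" for s
  proof -
    have "(LBINT \<tau>:{s..T}. y \<tau>) = rl_integral_right ((\<alpha> - 1) + (2 - \<alpha>)) T y s"
      using s by (simp add: one yT)
    also have "\<dots> = rl_integral_right (\<alpha> - 1) T J s"
      unfolding J_def using \<alpha> yT[OF s(1)] by (intro rl_integral_right_semigroup[symmetric]) auto
    also have "\<dots> = rl_integral_right (\<alpha> - 1) T (rl_integral_right 1 T D1) s"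
    proof -
      have "J \<tau> = rl_integral_right 1 T D1 \<tau>" if "s \<le> \<tau>" "\<tau> \<le> T" for \<tau>
      proof (cases "\<tau> = T")
        case True
        then show ?thesis by (simp add: J_def rl_integral_right_eq_left rl_integral_left_0)
      next
        case False
        then show ?thesis using J[of \<tau>] that s by (simp add: one intD1)
      qed
      then show ?thesis
        unfolding rl_integral_right_eq_left[of "\<alpha> - 1"] by (intro rl_integral_left_cong) auto
    qed
    also have "\<dots> = rl_integral_right ((\<alpha> - 1) + 1) T D1 s"
      using \<alpha> intD1 by (intro rl_integral_right_semigroup) auto
    also have "\<dots> = rl_integral_right \<alpha> T D1 s" by simp
    also have "\<dots> = rl_integral_right \<alpha> T (\<lambda>_. r) s + rl_integral_right \<alpha> T (rl_integral_right 1 T e) s"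
    proof -
      have "set_integrable lborel {s..T} (rl_integral_right 1 T e)" using intrl[of 1 s e] si[OF e] by simp
      then show ?thesis
        unfolding rl_integral_right_eq_left[of \<alpha>] D1_def
        using \<alpha> borel_integrable_atLeastAtMost'[OF continuous_on_const, of 0 "T - s" r]
        by (intro rl_integral_left_add) (simp_all flip: set_integrable_reflect)
    qed
    also have "rl_integral_right \<alpha> T (\<lambda>_. r) s = rl_integral_right (1 + (\<alpha> - 1)) T (\<lambda>_. r) s" by simp
    also have "\<dots> = rl_integral_right 1 T (rl_integral_right (\<alpha> - 1) T (\<lambda>_. r)) s"
      using \<alpha> cr by (intro rl_integral_right_semigroup[symmetric]) auto
    also have "\<dots> = (LBINT \<tau>:{s..T}. rl_integral_right (\<alpha> - 1) T (\<lambda>_. r) \<tau>)"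
      using \<alpha> by (intro one intrl cr) auto
    also have "rl_integral_right \<alpha> T (rl_integral_right 1 T e) s = rl_integral_right (\<alpha> + 1) T e s"
      using \<alpha> si[OF e] by (intro rl_integral_right_semigroup) auto
    also have "\<dots> = rl_integral_right (1 + \<alpha>) T e s" by (simp add: add.commute)
    also have "\<dots> = rl_integral_right 1 T (rl_integral_right \<alpha> T e) s"
      using \<alpha> si[OF e] by (intro rl_integral_right_semigroup[symmetric]) auto
    also have "\<dots> = (LBINT \<tau>:{s..T}. rl_integral_right \<alpha> T e \<tau>)"
      using \<alpha> by (intro one intrl si e) auto
    finally show ?thesis
      unfolding f_def using \<alpha> yT[OF s(1)] intrl[OF _ cr] intrl[OF _ si[OF e]] by simp
  qed
  define F where "F t = indicator {0<..<T} t *\<^sub>R f t" for t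
  have fT: "set_integrable lborel {0<..<T} f"
  proof -
    have "set_integrable lborel {0<..<T} (rl_integral_right b T g)" if "0 < b" "set_integrable lborel {0..T} g" for b and g :: "real \<Rightarrow> 'a"
      by (rule set_integrable_subset[OF intrl[OF that]]) auto
    then show ?thesis unfolding f_def using \<alpha> cr[of 0] si[OF e, of "{0..T}"] y by simp
  qed
  then have F: "integrable lborel F" by (simp add: F_def[abs_def] set_integrable_def)
  define E where "E a = (LBINT t:{a..}. F t)" for a
  have pos: "E a = 0" if "0 < a" for a
  proof (cases "a < T")
    case True
    have "E a = (LBINT t:{a..T}. F t)"
      unfolding E_def set_lebesgue_integral_def by (intro Bochner_Integration.integral_cong) (auto simp: F_def indicator_def)
    also have "\<dots> = (LBINT t:{a..T}. f t)"
      unfolding F_def by (rule set_integral_indicator_open[OF that set_integrable_closed_end[OF fT that]])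
    finally show ?thesis using f0[OF that True] by simp
  next
    case False
    then have "E a = (LBINT t:{a..}. 0)"
      unfolding E_def by (intro set_lebesgue_integral_cong) (auto simp: F_def)
    then show ?thesis by simp
  qed
  have zero: "E 0 = 0"
  proof -
    have "(E \<longlongrightarrow> E 0) (at 0)"
      using continuous_tail_integral[OF F] unfolding E_def
      by (simp add: continuous_on_eq_continuous_at isCont_def)
    then have "(E \<longlongrightarrow> E 0) (at_right 0)" by (rule tendsto_within_subset) simp
    moreover have "(E \<longlongrightarrow> 0) (at_right 0)"
      by (rule tendsto_eventually) (use pos in \<open>auto simp: eventually_at_filter\<close>)
    ultimately show ?thesis by (rule tendsto_unique[rotated]) simp
  qed
  have "E a = 0" for a
  proof (cases "0 < a")
    case False
    have "E a - E 0 = (LBINT t:{a..0}. F t)"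
      unfolding E_def using False by (intro tail_integral_diff[OF F]) simp
    also have "\<dots> = (LBINT t:{a..0}. 0)"
      by (rule set_lebesgue_integral_cong) (auto simp: F_def)
    finally show ?thesis by (simp add: zero)
  qed (rule pos)
  then have "AE t in lborel. F t = 0"
    unfolding E_def by (rule AE_zero_if_interval_integrals_zero[OF F])
  then show ?thesis
    unfolding e_def[symmetric]
  proof eventually_elim
    case (elim t)
    then show ?case using \<alpha>
      by (auto simp: F_def f_def rl_integral_right_eq_left[of "\<alpha> - 1"] rl_integral_left_const)
  qed
qed

section \<open>The closed graph theorem\<close>

text \<open>The closed graph theorem, with the closedness of the graph tested at \<open>0\<close> only, which suffices by linearity. By Baire's theorem
some set \<open>{x. norm (f x) \<le> N}\<close> is dense in a ball, so every \<open>x\<close> is approximated up to \<open>norm x / 2\<close> by some \<open>g x\<close> with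
\<open>norm (f (g x)) \<le> C * norm x\<close>. Iterating on the remainders writes \<open>x\<close> as a series whose image under \<open>f\<close> converges
absolutely; closedness identifies its sum with \<open>f x\<close>.\<close>

lemma closed_graph_imp_bounded_linear:
  fixes f :: "'a::banach \<Rightarrow> 'b::banach"
  assumes lin: "linear f"
    and closed: "\<And>X y. X \<longlonglongrightarrow> 0 \<Longrightarrow> (\<lambda>n. f (X n)) \<longlonglongrightarrow> y \<Longrightarrow> y = 0"
  shows "bounded_linear f"
proof -
  define E where "E n = {x. norm (f x) \<le> real n}" for n
  have "\<Union> (range (\<lambda>n. closure (E n))) = UNIV"
  proof (intro equalityI subsetI UNIV_I)
    fix x
    obtain n where "norm (f x) \<le> real n" using real_arch_simple by blast
    then show "x \<in> \<Union> (range (\<lambda>n. closure (E n)))"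
      using closure_subset[of "E n"] by (auto simp: E_def)
  qed
  then have "\<exists>n. interior (closure (E n)) \<noteq> {}"
    using Met_TC.metric_Baire_category_alt[where 'a = 'a, of "range (\<lambda>n. closure (E n))"]
    by (force simp: Met_TC.mcomplete_def convergent_def Cauchy_convergent_iff)
  then obtain N a r where r: "0 < r" "ball a r \<subseteq> closure (E N)"
    by (meson all_not_in_conv mem_interior)
  have "a \<in> closure (E N)" using r by (simp add: subset_iff)
  then obtain V where V: "\<And>n. V n \<in> E N" "V \<longlonglongrightarrow> a" unfolding closure_sequential by blast
  define C where "C = 4 * real N / r"
  have C0: "0 \<le> C" using r(1) by (simp add: C_def)
  \<comment> \<open>Differences of two points of the dense set reach every small vector.\<close>
  have small: "\<exists>y. norm (x - y) < e \<and> norm (f y) \<le> 2 * real N" if x: "norm x < r" and e: "0 < e" for x e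
  proof -
    have "a + x \<in> closure (E N)" using x r(2) by (auto simp: dist_norm)
    then obtain U where U: "\<And>n. U n \<in> E N" "U \<longlonglongrightarrow> a + x" unfolding closure_sequential by blast
    have "(\<lambda>n. U n - V n) \<longlonglongrightarrow> (a + x) - a" by (intro tendsto_diff U V)
    then have "(\<lambda>n. U n - V n) \<longlonglongrightarrow> x" by simp
    then obtain n where "norm ((U n - V n) - x) < e" using LIMSEQ_D e by blast
    moreover have "norm (f (U n - V n)) \<le> 2 * real N"
      using norm_triangle_ineq4[of "f (U n)" "f (V n)"] U(1)[of n] V(1)[of n]
      by (simp add: E_def linear_diff[OF lin])
    ultimately show ?thesis by (metis norm_minus_commute)
  qed
  have "\<exists>y. norm (x - y) \<le> norm x / 2 \<and> norm (f y) \<le> C * norm x" for x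
  proof (cases "x = 0")
    case True
    then show ?thesis by (intro exI[of _ 0]) (simp add: linear_0[OF lin])
  next
    case False
    define c where "c = r / (2 * norm x)"
    have c: "0 < c" using False r(1) by (simp add: c_def)
    have "norm (c *\<^sub>R x) < r" "0 < c * (norm x / 2)" using False r(1) c by (simp_all add: c_def)
    from small[OF this] obtain y where y: "norm (c *\<^sub>R x - y) < c * (norm x / 2)" "norm (f y) \<le> 2 * real N"
      by blast
    have "norm (c *\<^sub>R (x - (1/c) *\<^sub>R y)) < c * (norm x / 2)" using y(1) c by (simp add: algebra_simps)
    then have "norm (x - (1/c) *\<^sub>R y) < norm x / 2" using c by simp
    moreover have "norm (f ((1/c) *\<^sub>R y)) \<le> (1/c) * (2 * real N)"
      using c y(2) by (simp add: linear_scale[OF lin] divide_right_mono)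
    moreover have "(1/c) * (2 * real N) = C * norm x" using r(1) False by (simp add: c_def C_def field_simps)
    ultimately show ?thesis by (intro exI[of _ "(1/c) *\<^sub>R y"]) simp
  qed
  then obtain g where g: "\<And>x. norm (x - g x) \<le> norm x / 2" "\<And>x. norm (f (g x)) \<le> C * norm x" by metis
  have "norm (f x) \<le> norm x * (2 * C)" for x
  proof -
    \<comment> \<open>The remainders after \<open>n\<close> steps of the approximation.\<close>
    define X where "X n = ((\<lambda>x. x - g x) ^^ n) x" for n
    have XS: "X (Suc n) = X n - g (X n)" for n by (simp add: X_def)
    have Xn: "norm (X n) \<le> norm x * (1/2) ^ n" for n
    proof (induction n)
      case (Suc n)
      then show ?case using g(1)[of "X n"] by (simp add: XS)
    qed (simp add: X_def)
    have bnd: "norm (f (g (X n))) \<le> C * norm x * (1/2) ^ n" for n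
    proof -
      have "norm (f (g (X n))) \<le> C * norm (X n)" by (rule g(2))
      also have "\<dots> \<le> C * (norm x * (1/2) ^ n)" by (intro mult_left_mono Xn C0)
      finally show ?thesis by (simp add: mult.assoc)
    qed
    have geo: "(\<lambda>n. C * norm x * (1/2) ^ n) sums (C * norm x * 2)"
      using sums_mult[OF geometric_sums[of "1/2 :: real"]] by simp
    have sm: "summable (\<lambda>n. f (g (X n)))"
      by (rule summable_comparison_test'[OF sums_summable[OF geo] bnd])
    have part: "f (X n) = f x - (\<Sum>j<n. f (g (X j)))" for n
      by (induction n) (simp_all add: XS linear_diff[OF lin], simp add: X_def)
    have "X \<longlonglongrightarrow> 0"
    proof (rule Lim_null_comparison[OF always_eventually[OF allI[OF Xn]]])
      show "(\<lambda>n. norm x * (1/2) ^ n) \<longlonglongrightarrow> 0"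
        using tendsto_mult[OF tendsto_const LIMSEQ_power_zero[of "1/2 :: real"]] by auto
    qed
    moreover have "(\<lambda>n. f (X n)) \<longlonglongrightarrow> f x - (\<Sum>j. f (g (X j)))"
      unfolding part by (intro tendsto_diff tendsto_const summable_LIMSEQ sm)
    ultimately have "f x = (\<Sum>j. f (g (X j)))" using closed by fastforce
    also have "norm \<dots> \<le> (\<Sum>n. C * norm x * (1/2) ^ n)"
      by (rule norm_suminf_le[OF bnd sums_summable[OF geo]])
    also have "\<dots> = norm x * (2 * C)" using sums_unique[OF geo] by (simp only: mult.commute mult.left_commute)
    finally show ?thesis .
  qed
  then show ?thesis
    by (intro bounded_linear_intro[where K = "2 * C"]) (simp_all add: linear_add[OF lin] linear_scale[OF lin])
qed

section \<open>Volterra equations of the first kind with a symmetric operator\<close>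

text \<open>\<open>norm (B y)\<^sup>2 = (y, B (B y)) \<le> norm y * norm (B (B y))\<close>, so the quotients of the norms of successive iterates do not
decrease.\<close>

lemma symmetric_power_norm_ge:
  fixes B :: "'a::real_inner \<Rightarrow> 'a"
  assumes sym: "\<And>x y. inner (B x) y = inner x (B y)" and x: "x \<noteq> 0" 
  shows "(norm (B x) / norm x) ^ n * norm x \<le> norm ((B ^^ n) x)"
proof (cases "B x = 0")
  case True
  then show ?thesis by (cases n) auto
next
  case False
  define c where "c = norm (B x) / norm x"
  have c: "0 < c" using x False by (simp add: c_def)
  have step: "c * norm ((B ^^ n) x) \<le> norm ((B ^^ Suc n) x) \<and> 0 < norm ((B ^^ n) x)" for n
  proof (induction n)
    case 0
    show ?case using x by (simp add: c_def)
  next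
    case (Suc n)
    let ?y = "(B ^^ n) x"
    have pos: "0 < norm (B ?y)" 
      by (rule less_le_trans[OF mult_pos_pos[OF c, of "norm ?y"]]) (use Suc in auto)
    have "norm (B ?y) * (c * norm ?y) \<le> norm (B ?y) * norm (B ?y)"
      using Suc by (intro mult_left_mono) auto
    also have "\<dots> = inner (B ?y) (B ?y)" by (simp add: dot_square_norm power2_eq_square)
    also have "\<dots> = inner ?y (B (B ?y))" by (rule sym)
    also have "\<dots> \<le> norm ?y * norm (B (B ?y))" by (rule norm_cauchy_schwarz)
    finally have "norm ?y * (c * norm (B ?y)) \<le> norm ?y * norm (B (B ?y))" by (simp add: ac_simps)
    then show ?case using Suc pos by simp
  qed
  have "c ^ n * norm x \<le> norm ((B ^^ n) x)"
  proof (induction n)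
    case (Suc n)
    have "c ^ Suc n * norm x \<le> c * norm ((B ^^ n) x)" using Suc c by simp
    then show ?case using step[of n] by linarith
  qed simp
  then show ?thesis by (simp add: c_def)
qed

text \<open>Iterating the equation gives \<open>norm ((B ^^ n) (w t)) \<le> M * (K * t) ^ n / n!\<close>. If \<open>B (w t)\<close> were nonzero, the left-hand
side would be at least \<open>c ^ n * norm (w t)\<close> for some \<open>c > 0\<close> by \<open>symmetric_power_norm_ge\<close>, and the factorial wins.\<close>

lemma volterra_first_kind_unique:
  fixes B :: "'a::{real_inner,banach,second_countable_topology} \<Rightarrow> 'a" and k :: "real \<Rightarrow> real"
  assumes B: "bounded_linear B" and sym: "\<And>x y. inner (B x) y = inner x (B y)"
    and k: "continuous_on {0..T} k"
    and w: "continuous_on {0..T} w"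
    and eq: "\<And>t. t \<in> {0..T} \<Longrightarrow> B (w t) = - (LBINT s:{0..t}. k (t - s) *\<^sub>R w s)"
    and t: "t \<in> {0..T}"
  shows "B (w t) = 0"
proof (rule ccontr)
  assume Bw: "B (w t) \<noteq> 0"
  interpret B: bounded_linear B by fact
  have "compact (k ` {0..T})" "compact (w ` {0..T})" by (intro compact_continuous_image k w compact_Icc)+
  then have "bounded (k ` {0..T})" "bounded (w ` {0..T})" by (auto intro: compact_imp_bounded)
  then obtain K M where K: "\<And>t. t \<in> {0..T} \<Longrightarrow> \<bar>k t\<bar> \<le> K" and M: "\<And>t. t \<in> {0..T} \<Longrightarrow> norm (w t) \<le> M"
    unfolding bounded_iff by (metis imageI real_norm_def)
  have K0: "0 \<le> K" using K[OF t] by simp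
  have M0: "0 \<le> M" using M[OF t] norm_ge_zero order_trans by blast
  have blp: "bounded_linear (B ^^ n)" for n
    by (induction n) (auto intro: bounded_linear_compose[OF B, unfolded comp_def] bounded_linear_ident simp: id_def comp_def)
  have contBw: "continuous_on {0..T} (\<lambda>s. (B ^^ n) (w s))" for n
    by (rule bounded_linear.continuous_on[OF blp w])
  have kint: "set_integrable lborel {0..t} (\<lambda>s. k (t - s) *\<^sub>R v s)" if "continuous_on {0..T} v" "t \<in> {0..T}" for v :: "real \<Rightarrow> 'a" and t
    using that by (intro borel_integrable_atLeastAtMost' continuous_intros continuous_on_compose2[OF k] continuous_on_subset[OF that(1)]) auto
  have iter: "(B ^^ Suc n) (w t) = - (LBINT s:{0..t}. k (t - s) *\<^sub>R (B ^^ n) (w s))" if t: "t \<in> {0..T}" for n t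
  proof -
    interpret Bn: bounded_linear "B ^^ n" by (rule blp)
    have "(B ^^ Suc n) (w t) = (B ^^ n) (B (w t))" by (simp only: funpow_Suc_right comp_def)
    also have "\<dots> = - (B ^^ n) (LBINT s:{0..t}. k (t - s) *\<^sub>R w s)" by (simp add: eq[OF t] Bn.neg)
    also have "(B ^^ n) (LBINT s:{0..t}. k (t - s) *\<^sub>R w s) = (LBINT s:{0..t}. (B ^^ n) (k (t - s) *\<^sub>R w s))"
      using kint[OF w t] unfolding set_lebesgue_integral_def set_integrable_def
      by (subst integral_bounded_linear[OF blp, symmetric]) (simp_all add: Bn.scaleR)
    finally show ?thesis by (simp add: Bn.scaleR)
  qed
  have bound: "norm ((B ^^ n) (w t)) \<le> M * K ^ n / fact n * t ^ n" if "t \<in> {0..T}" for n t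
    using that
  proof (induction n arbitrary: t)
    case 0
    then show ?case using M by simp
  next
    case (Suc n)
    note t = Suc.prems
    have "norm ((B ^^ Suc n) (w t)) \<le> (LBINT s:{0..t}. norm (k (t - s) *\<^sub>R (B ^^ n) (w s)))"
      unfolding iter[OF t] norm_minus_cancel by (rule set_integral_norm_bound[OF kint[OF contBw t]])
    also have "\<dots> \<le> (LBINT s:{0..t}. (K * (M * K ^ n / fact n)) * s ^ n)"
    proof (rule set_integral_mono)
      show "set_integrable lborel {0..t} (\<lambda>s. norm (k (t - s) *\<^sub>R (B ^^ n) (w s)))"
        by (rule set_integrable_norm[OF kint[OF contBw t]])
      show "set_integrable lborel {0..t} (\<lambda>s. K * (M * K ^ n / fact n) * s ^ n)"
        using t by (intro set_integrable_mult_right integral_power_upto) auto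
      fix s assume s: "s \<in> {0..t}"
      have "\<bar>k (t - s)\<bar> * norm ((B ^^ n) (w s)) \<le> K * (M * K ^ n / fact n * s ^ n)"
        using s t by (intro mult_mono K Suc.IH K0) auto
      then show "norm (k (t - s) *\<^sub>R (B ^^ n) (w s)) \<le> K * (M * K ^ n / fact n) * s ^ n" by (simp add: mult.assoc)
    qed
    also have "\<dots> = (K * (M * K ^ n / fact n)) * (t ^ Suc n / Suc n)"
      using t by (simp add: integral_power_upto(2))
    also have "\<dots> = M * K ^ Suc n / fact (Suc n) * t ^ Suc n" by (simp add: field_simps)
    finally show ?case .
  qed
  have wt: "w t \<noteq> 0" using Bw B.zero by metis
  define c where "c = norm (B (w t)) / norm (w t)"
  have c: "0 < c" using Bw wt by (simp add: c_def)
  have "norm (w t) \<le> M * ((K * t / c) ^ n / fact n)" for n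
  proof -
    have "c ^ n * norm (w t) \<le> M * K ^ n / fact n * t ^ n"
      using symmetric_power_norm_ge[OF sym wt, of n] bound[OF t, of n] by (simp add: c_def)
    then show ?thesis using c by (simp add: field_simps)
  qed
  moreover have "(\<lambda>n. M * ((K * t / c) ^ n / fact n)) \<longlonglongrightarrow> M * 0"
    using summable_LIMSEQ_zero[OF summable_exp, of "K * t / c"]
    by (intro tendsto_mult tendsto_const) (simp add: inverse_eq_divide)
  ultimately have "norm (w t) \<le> M * 0"
    by (intro LIMSEQ_le_const[where a = "norm (w t)"]) auto
  then show False using wt by simp
qed

text \<open>The convolution with \<open>k\<close> to the left and the one to the right are transposes of each other, by Fubini's theorem; the
kernel is bounded, so the integrand is dominated by a product of integrable functions.\<close>

lemma volterra_kernel_transpose: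
  fixes \<phi> \<psi> :: "real \<Rightarrow> 'a::{real_inner,banach,second_countable_topology}"
  assumes k: "continuous_on {0..T} k"
    and \<phi>: "set_integrable lborel {0..T} \<phi>" and \<psi>: "set_integrable lborel {0..T} \<psi>"
  shows "(LBINT s:{0..T}. inner (LBINT t:{s..T}. k (t - s) *\<^sub>R \<psi> t) (\<phi> s))
      = (LBINT t:{0..T}. inner (\<psi> t) (LBINT s:{0..t}. k (t - s) *\<^sub>R \<phi> s))"
    and "set_integrable lborel {0..T} (\<lambda>s. inner (LBINT t:{s..T}. k (t - s) *\<^sub>R \<psi> t) (\<phi> s))"
proof -
  define \<kappa> where "\<kappa> x = indicator {0..T} x * k x" for x
  define \<Phi> where "\<Phi> s = indicator {0..T} s *\<^sub>R \<phi> s" for s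
  define \<Psi> where "\<Psi> s = indicator {0..T} s *\<^sub>R \<psi> s" for s
  have \<kappa>m[measurable]: "\<kappa> \<in> borel_measurable borel"
    unfolding \<kappa>_def[abs_def] using borel_measurable_continuous_on_indicator[OF _ k] by simp
  obtain K where "\<And>x. x \<in> {0..T} \<Longrightarrow> norm (k x) \<le> K" using continuous_Icc_bounded[OF k] by blast
  then have K: "\<bar>\<kappa> x\<bar> \<le> \<bar>K\<bar>" for x by (force simp: \<kappa>_def indicator_def)
  have \<Phi>: "integrable lborel \<Phi>" and \<Psi>: "integrable lborel \<Psi>"
    using \<phi> \<psi> by (auto simp: \<Phi>_def[abs_def] \<Psi>_def[abs_def] set_integrable_def)
  have [measurable]: "\<Phi> \<in> borel_measurable borel" "\<Psi> \<in> borel_measurable borel" using \<Phi> \<Psi> by auto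
  have ki: "integrable lborel (\<lambda>x. \<kappa> (g x) *\<^sub>R f x)"
    if [measurable]: "g \<in> borel_measurable borel" and f: "integrable lborel f" for f :: "real \<Rightarrow> 'a" and g
  proof (rule Bochner_Integration.integrable_bound)
    show "integrable lborel (\<lambda>x. K *\<^sub>R f x)" using f by simp
    show "(\<lambda>x. \<kappa> (g x) *\<^sub>R f x) \<in> borel_measurable lborel"
      using f[THEN borel_measurable_integrable] by simp
    show "AE x in lborel. norm (\<kappa> (g x) *\<^sub>R f x) \<le> norm (K *\<^sub>R f x)"
      using K by (auto intro!: mult_right_mono)
  qed
  have F: "integrable (lborel \<Otimes>\<^sub>M lborel) (\<lambda>(s, t). \<kappa> (t - s) * inner (\<Psi> t) (\<Phi> s))"
  proof (rule Bochner_Integration.integrable_bound)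
    show "integrable (lborel \<Otimes>\<^sub>M lborel) (\<lambda>(s, t). \<bar>K\<bar> * (norm (\<Phi> s) * norm (\<Psi> t)))"
    proof (rule lborel_pair.Fubini_integrable)
      show "(\<lambda>(s, t). \<bar>K\<bar> * (norm (\<Phi> s) * norm (\<Psi> t))) \<in> borel_measurable (lborel \<Otimes>\<^sub>M lborel)"
        by measurable
      show "AE s in lborel. integrable lborel (\<lambda>t. case (s, t) of (s, t) \<Rightarrow> \<bar>K\<bar> * (norm (\<Phi> s) * norm (\<Psi> t)))"
        using \<Psi> by simp
      show "integrable lborel (\<lambda>s. LBINT t. norm (case (s, t) of (s, t) \<Rightarrow> \<bar>K\<bar> * (norm (\<Phi> s) * norm (\<Psi> t))))"
        using \<Phi> by (simp add: abs_mult)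
    qed
    show "(\<lambda>(s, t). \<kappa> (t - s) * inner (\<Psi> t) (\<Phi> s)) \<in> borel_measurable (lborel \<Otimes>\<^sub>M lborel)"
      by measurable
    show "AE x in lborel \<Otimes>\<^sub>M lborel. norm (case x of (s, t) \<Rightarrow> \<kappa> (t - s) * inner (\<Psi> t) (\<Phi> s))
        \<le> norm (case x of (s, t) \<Rightarrow> \<bar>K\<bar> * (norm (\<Phi> s) * norm (\<Psi> t)))"
    proof (intro AE_I2, clarify)
      fix s t
      have "\<bar>inner (\<Psi> t) (\<Phi> s)\<bar> \<le> norm (\<Psi> t) * norm (\<Phi> s)" by (rule Cauchy_Schwarz_ineq2)
      then have "\<bar>\<kappa> (t - s)\<bar> * \<bar>inner (\<Psi> t) (\<Phi> s)\<bar> \<le> \<bar>K\<bar> * (norm (\<Psi> t) * norm (\<Phi> s))"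
        using K by (intro mult_mono) auto
      then show "norm (\<kappa> (t - s) * inner (\<Psi> t) (\<Phi> s)) \<le> norm (\<bar>K\<bar> * (norm (\<Phi> s) * norm (\<Psi> t)))"
        by (simp add: abs_mult ac_simps)
    qed
  qed
  have 1: "(LBINT t. \<kappa> (t - s) * inner (\<Psi> t) (\<Phi> s))
      = indicator {0..T} s *\<^sub>R inner (LBINT t:{s..T}. k (t - s) *\<^sub>R \<psi> t) (\<phi> s)" for s
  proof -
    have "(LBINT t. \<kappa> (t - s) * inner (\<Psi> t) (\<Phi> s)) = inner (LBINT t. \<kappa> (t - s) *\<^sub>R \<Psi> t) (\<Phi> s)"
      using integral_inner_left[of "\<Phi> s" lborel "\<lambda>t. \<kappa> (t - s) *\<^sub>R \<Psi> t"] ki[OF _ \<Psi>, of "\<lambda>t. t - s"] by simp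
    also have "(LBINT t. \<kappa> (t - s) *\<^sub>R \<Psi> t) = (LBINT t:{s..T}. k (t - s) *\<^sub>R \<psi> t)" if "s \<in> {0..T}"
      unfolding set_lebesgue_integral_def
      by (intro Bochner_Integration.integral_cong refl) (use that in \<open>auto simp: \<kappa>_def \<Psi>_def indicator_def\<close>)
    then have "inner (LBINT t. \<kappa> (t - s) *\<^sub>R \<Psi> t) (\<Phi> s) = indicator {0..T} s *\<^sub>R inner (LBINT t:{s..T}. k (t - s) *\<^sub>R \<psi> t) (\<phi> s)"
      by (simp add: \<Phi>_def indicator_def)
    finally show ?thesis .
  qed
  have 2: "(LBINT s. \<kappa> (t - s) * inner (\<Psi> t) (\<Phi> s))
      = indicator {0..T} t *\<^sub>R inner (\<psi> t) (LBINT s:{0..t}. k (t - s) *\<^sub>R \<phi> s)" for t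
  proof -
    have "(LBINT s. \<kappa> (t - s) * inner (\<Psi> t) (\<Phi> s)) = inner (\<Psi> t) (LBINT s. \<kappa> (t - s) *\<^sub>R \<Phi> s)"
      using integral_inner_right[of "\<Psi> t" lborel "\<lambda>s. \<kappa> (t - s) *\<^sub>R \<Phi> s"] ki[OF _ \<Phi>, of "\<lambda>s. t - s"] by simp
    also have "(LBINT s. \<kappa> (t - s) *\<^sub>R \<Phi> s) = (LBINT s:{0..t}. k (t - s) *\<^sub>R \<phi> s)" if "t \<in> {0..T}"
      unfolding set_lebesgue_integral_def
      by (intro Bochner_Integration.integral_cong refl) (use that in \<open>auto simp: \<kappa>_def \<Phi>_def indicator_def\<close>)
    then have "inner (\<Psi> t) (LBINT s. \<kappa> (t - s) *\<^sub>R \<Phi> s) = indicator {0..T} t *\<^sub>R inner (\<psi> t) (LBINT s:{0..t}. k (t - s) *\<^sub>R \<phi> s)"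
      by (simp add: \<Psi>_def indicator_def)
    finally show ?thesis .
  qed
  show "(LBINT s:{0..T}. inner (LBINT t:{s..T}. k (t - s) *\<^sub>R \<psi> t) (\<phi> s))
      = (LBINT t:{0..T}. inner (\<psi> t) (LBINT s:{0..t}. k (t - s) *\<^sub>R \<phi> s))"
    using lborel_pair.Fubini_integral[OF F] by (simp add: 1 2 set_lebesgue_integral_def)
  show "set_integrable lborel {0..T} (\<lambda>s. inner (LBINT t:{s..T}. k (t - s) *\<^sub>R \<psi> t) (\<phi> s))"
    using lborel_pair.integrable_fst[OF F] by (simp add: 1 set_integrable_def)
qed

lemma volterra_integrand_integrable:
  fixes v :: "real \<Rightarrow> 'a::{banach,second_countable_topology}" and k q :: "real \<Rightarrow> real"
  assumes k: "continuous_on {0..T} k" and qm: "q \<in> borel_measurable borel" and qC: "\<And>t. \<bar>q t\<bar> \<le> C"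
    and v: "continuous_on {0..T} v" and t: "t \<in> {0..T}"
  shows "set_integrable lborel {0..t} (\<lambda>s. q s *\<^sub>R b - v s)"
    and "set_integrable lborel {0..t} (\<lambda>s. k (t - s) *\<^sub>R (q s *\<^sub>R b - v s))"
proof -
  have q: "set_borel_measurable lborel {0..t} q" using qm by (simp add: set_borel_measurable_def)
  have "set_integrable lborel {0..t} (\<lambda>s. q s *\<^sub>R b)"
    using borel_integrable_atLeastAtMost'[OF continuous_on_const, of 0 t b] qC
    by (intro set_integrable_bilinear_bounded[OF bounded_bilinear_scaleR q, where K = C]) auto
  moreover have "continuous_on {0..t} v" using v t by (auto intro: continuous_on_subset)
  ultimately show 1: "set_integrable lborel {0..t} (\<lambda>s. q s *\<^sub>R b - v s)"
    by (intro set_integral_diff(1)[OF _ borel_integrable_atLeastAtMost'])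
  have kt: "continuous_on {0..t} (\<lambda>s. k (t - s))"
    using t by (intro continuous_on_compose2[OF k] continuous_intros) auto
  obtain K where K: "\<And>s. s \<in> {0..t} \<Longrightarrow> norm (k (t - s)) \<le> K" using continuous_Icc_bounded[OF kt] by blast
  show "set_integrable lborel {0..t} (\<lambda>s. k (t - s) *\<^sub>R (q s *\<^sub>R b - v s))"
    by (rule set_integrable_bilinear_bounded[OF bounded_bilinear_scaleR set_borel_measurable_continuous_Icc[OF kt] K 1])
qed

instance bcontfun :: (metric_space, banach) banach ..

text \<open>The forward problem after inversion of the elliptic operator and of the fractional derivative, for vanishing initial
values: \<open>w p\<close> is the solution with source \<open>q p\<close>, and \<open>B\<close> is the inverse of the elliptic operator. The solutions are
supposed to exist for every \<open>p\<close>. The orthogonality to the kernel of \<open>B\<close> makes them unique.\<close>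

locale volterra_source_problem =
  fixes B :: "'a::{real_inner,banach,second_countable_topology} \<Rightarrow> 'a"
    and k q :: "real \<Rightarrow> real" and T C :: real and w :: "'a \<Rightarrow> real \<Rightarrow> 'a"
  assumes T: "0 < T" and B: "bounded_linear B" and sym: "\<And>x y. inner (B x) y = inner x (B y)"
    and k: "continuous_on {0..T} k"
    and qm: "q \<in> borel_measurable borel" and qC: "\<And>t. \<bar>q t\<bar> \<le> C"
    and w: "\<And>p. continuous_on {0..T} (w p)"
    and orth: "\<And>p t y. t \<in> {0..T} \<Longrightarrow> B y = 0 \<Longrightarrow> inner y (w p t) = 0"
    and eq: "\<And>p t. t \<in> {0..T} \<Longrightarrow> B (w p t) = (LBINT s:{0..t}. k (t - s) *\<^sub>R (q s *\<^sub>R B p - w p s))"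
begin

sublocale B: bounded_linear B by (rule B)

lemmas source_integrable = volterra_integrand_integrable[OF k qm qC]

text \<open>The difference of two solutions is in the kernel of \<open>B\<close> by \<open>volterra_first_kind_unique\<close>, and also orthogonal to
this kernel.\<close>

lemma unique:
  assumes v: "continuous_on {0..T} v"
    and v_orth: "\<And>t y. t \<in> {0..T} \<Longrightarrow> B y = 0 \<Longrightarrow> inner y (v t) = 0"
    and v_eq: "\<And>t. t \<in> {0..T} \<Longrightarrow> B (v t) = (LBINT s:{0..t}. k (t - s) *\<^sub>R (q s *\<^sub>R B p - v s))"
    and t: "t \<in> {0..T}"
  shows "v t = w p t"
proof -
  have "B (v t - w p t) = 0"
  proof (rule volterra_first_kind_unique[OF B sym k _ _ t])
    show "continuous_on {0..T} (\<lambda>t. v t - w p t)" by (intro continuous_intros v w)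
    fix t assume t: "t \<in> {0..T}"
    have "B (v t - w p t) = (LBINT s:{0..t}. k (t - s) *\<^sub>R (q s *\<^sub>R B p - v s) - k (t - s) *\<^sub>R (q s *\<^sub>R B p - w p s))"
      by (simp add: B.diff v_eq[OF t] eq[OF t] source_integrable[OF v t] source_integrable[OF w t])
    also have "\<dots> = (LBINT s:{0..t}. (- 1) *\<^sub>R (k (t - s) *\<^sub>R (v s - w p s)))"
      by (intro set_lebesgue_integral_cong) (auto simp: algebra_simps)
    also have "\<dots> = - (LBINT s:{0..t}. k (t - s) *\<^sub>R (v s - w p s))"
      by (subst set_integral_scaleR_right) simp
    finally show "B (v t - w p t) = - (LBINT s:{0..t}. k (t - s) *\<^sub>R (v s - w p s))" .
  qed
  then have "inner (v t - w p t) (v t - w p t) = 0"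
    using v_orth[OF t] orth[OF t] by (simp add: inner_diff_right)
  then show ?thesis by simp
qed

lemma solution_add: "t \<in> {0..T} \<Longrightarrow> w (p + p') t = w p t + w p' t"
proof (rule unique[symmetric])
  fix t assume t: "t \<in> {0..T}"
  have "B (w p t + w p' t) = (LBINT s:{0..t}. k (t - s) *\<^sub>R (q s *\<^sub>R B p - w p s) + k (t - s) *\<^sub>R (q s *\<^sub>R B p' - w p' s))"
    by (simp add: B.add eq[OF t] source_integrable[OF w t])
  also have "\<dots> = (LBINT s:{0..t}. k (t - s) *\<^sub>R (q s *\<^sub>R B (p + p') - (w p s + w p' s)))"
    by (intro set_lebesgue_integral_cong) (auto simp: algebra_simps B.add)
  finally show "B (w p t + w p' t) = (LBINT s:{0..t}. k (t - s) *\<^sub>R (q s *\<^sub>R B (p + p') - (w p s + w p' s)))" .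
qed (auto intro!: continuous_intros w simp: inner_add_right orth)

lemma solution_scale: "t \<in> {0..T} \<Longrightarrow> w (c *\<^sub>R p) t = c *\<^sub>R w p t"
proof (rule unique[symmetric])
  fix t assume t: "t \<in> {0..T}"
  have "B (c *\<^sub>R w p t) = (LBINT s:{0..t}. c *\<^sub>R (k (t - s) *\<^sub>R (q s *\<^sub>R B p - w p s)))"
    by (subst set_integral_scaleR_right) (simp add: B.scaleR eq[OF t])
  also have "\<dots> = (LBINT s:{0..t}. k (t - s) *\<^sub>R (q s *\<^sub>R B (c *\<^sub>R p) - c *\<^sub>R w p s))"
    by (intro set_lebesgue_integral_cong) (auto simp: algebra_simps B.scaleR)
  finally show "B (c *\<^sub>R w p t) = (LBINT s:{0..t}. k (t - s) *\<^sub>R (q s *\<^sub>R B (c *\<^sub>R p) - c *\<^sub>R w p s))" .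
qed (auto intro!: continuous_intros w simp: orth)

lemma solution_commute: "t \<in> {0..T} \<Longrightarrow> w (B p) t = B (w p t)"
proof (rule unique[symmetric])
  fix t assume t: "t \<in> {0..T}"
  have "B (B (w p t)) = (LBINT s:{0..t}. B (k (t - s) *\<^sub>R (q s *\<^sub>R B p - w p s)))"
    by (simp add: eq[OF t] set_integral_bounded_linear(2)[OF B source_integrable(2)[OF w t]])
  then show "B (B (w p t)) = (LBINT s:{0..t}. k (t - s) *\<^sub>R (q s *\<^sub>R B (B p) - B (w p s)))"
    by (simp add: B.diff B.scaleR)
next
  show "inner y (B (w p t)) = 0" if "B y = 0" for y t using that by (simp add: sym[symmetric])
qed (auto intro!: B.continuous_on w)

text \<open>The closed graph theorem applies to the map from the source to the whole trajectory, in the supremum norm. A limit of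
trajectories solves the limiting equation by dominated convergence, so uniqueness closes the graph. The trajectory has to be kept because the convergence of the final values alone
says nothing about the equation at earlier times.\<close>

lemma bounded_linear_final_value: "bounded_linear (\<lambda>p. w p T)"
proof -
  \<comment> \<open>Trajectories are extended by constants, to become bounded continuous functions on the whole line.\<close>
  define cl where "cl t = max 0 (min t T)" for t
  have cl: "cl t \<in> {0..T}" "continuous_on UNIV cl" for t using T by (auto simp: cl_def[abs_def] intro!: continuous_intros)
  have cl_id: "cl t = t" if "t \<in> {0..T}" for t using that by (auto simp: cl_def)
  define S where "S p = Bcontfun (\<lambda>t. w p (cl t))" for p
  have S: "apply_bcontfun (S p) t = w p (cl t)" for p t
  proof -
    obtain K where K: "\<And>t. t \<in> {0..T} \<Longrightarrow> norm (w p t) \<le> K" using continuous_Icc_bounded[OF w] by blast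
    have "(\<lambda>t. w p (cl t)) \<in> bcontfun"
      by (rule bcontfun_normI[where b = K]) (use cl K in \<open>auto intro!: continuous_on_compose2[OF w]\<close>)
    then show ?thesis by (simp add: S_def Bcontfun_inverse)
  qed
  have lin: "linear S"
    by (rule linearI) (auto intro!: bcontfun_eqI simp: S solution_add[OF cl(1)] solution_scale[OF cl(1)])
  have "bounded_linear S"
  proof (rule closed_graph_imp_bounded_linear[OF lin])
    fix X and v :: "real \<Rightarrow>\<^sub>C 'a" assume X: "X \<longlonglongrightarrow> 0" and lim: "(\<lambda>n. S (X n)) \<longlonglongrightarrow> v"
    have pt: "(\<lambda>n. w (X n) t) \<longlonglongrightarrow> v t" if "t \<in> {0..T}" for t
      using tendsto_bcontfun_uniform_limit[OF lim] that
      by (auto dest!: tendsto_uniform_limitI[where x = t] simp: S cl_id)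
    obtain M where M: "\<And>n. norm (S (X n)) \<le> M"
      using convergent_imp_Bseq[OF convergentI[OF lim]] by (meson BseqE)
    obtain N where N: "\<And>n. norm (B (X n)) \<le> N"
      using convergent_imp_Bseq[OF convergentI[OF B.tendsto[OF X]]] by (meson BseqE)
    have wM: "norm (w (X n) t) \<le> M" if "t \<in> {0..T}" for n t
      using norm_bounded[of "S (X n)" t] M[of n] by (simp add: S cl_id[OF that])
    have cv: "continuous_on {0..T} v" by simp
    have v0: "v t = w 0 t" if "t \<in> {0..T}" for t
    proof (rule unique[OF cv _ _ that])
      fix t assume t: "t \<in> {0..T}"
      show "inner y (v t) = 0" if "B y = 0" for y
      proof -
        have "(\<lambda>n. inner y (w (X n) t)) \<longlonglongrightarrow> inner y (v t)" by (intro tendsto_intros pt t)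
        then show ?thesis by (simp add: orth[OF t that] LIMSEQ_const_iff)
      qed
      obtain K where K: "\<And>x. x \<in> {0..T} \<Longrightarrow> norm (k x) \<le> K" using continuous_Icc_bounded[OF k] by blast
      have "(\<lambda>n. LBINT s:{0..t}. k (t - s) *\<^sub>R (q s *\<^sub>R B (X n) - w (X n) s))
          \<longlonglongrightarrow> (LBINT s:{0..t}. k (t - s) *\<^sub>R (q s *\<^sub>R B 0 - v s))"
        unfolding set_lebesgue_integral_def
      proof (rule integral_dominated_convergence[where w = "\<lambda>s. indicator {0..t} s * (K * (C * N + M))"])
        show "(\<lambda>s. indicator {0..t} s *\<^sub>R k (t - s) *\<^sub>R (q s *\<^sub>R B 0 - v s)) \<in> borel_measurable lborel"
          using source_integrable(2)[OF cv t, of "B 0"] unfolding set_integrable_def by (rule borel_measurable_integrable)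
        show "(\<lambda>s. indicator {0..t} s *\<^sub>R k (t - s) *\<^sub>R (q s *\<^sub>R B (X n) - w (X n) s)) \<in> borel_measurable lborel" for n
          using source_integrable(2)[OF w t] by (auto simp: set_integrable_def)
        show "integrable lborel (\<lambda>s. indicator {0..t} s * (K * (C * N + M)))"
          using borel_integrable_atLeastAtMost'[OF continuous_on_const, of 0 t "K * (C * N + M)"]
          by (simp add: set_integrable_def)
        show "AE s in lborel. (\<lambda>n. indicator {0..t} s *\<^sub>R k (t - s) *\<^sub>R (q s *\<^sub>R B (X n) - w (X n) s))
            \<longlonglongrightarrow> indicator {0..t} s *\<^sub>R k (t - s) *\<^sub>R (q s *\<^sub>R B 0 - v s)"
        proof (intro AE_I2)
          fix s
          show "(\<lambda>n. indicator {0..t} s *\<^sub>R k (t - s) *\<^sub>R (q s *\<^sub>R B (X n) - w (X n) s))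
            \<longlonglongrightarrow> indicator {0..t} s *\<^sub>R k (t - s) *\<^sub>R (q s *\<^sub>R B 0 - v s)"
          proof (cases "s \<in> {0..t}")
            case True
            then have "s \<in> {0..T}" using t by auto
            then show ?thesis by (intro tendsto_scaleR tendsto_const tendsto_diff B.tendsto X pt)
          qed simp
        qed
        show "AE s in lborel. norm (indicator {0..t} s *\<^sub>R k (t - s) *\<^sub>R (q s *\<^sub>R B (X n) - w (X n) s))
            \<le> indicator {0..t} s * (K * (C * N + M))" for n
        proof (intro AE_I2)
          fix s
          have "norm (k (t - s) *\<^sub>R (q s *\<^sub>R B (X n) - w (X n) s)) \<le> K * (C * N + M)" if s: "s \<in> {0..t}"
          proof -
            have "norm (q s *\<^sub>R B (X n)) \<le> C * N"
              using qC[of s] N[of n] by (auto intro!: mult_mono order_trans[OF abs_ge_zero qC])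
            moreover have "norm (w (X n) s) \<le> M" using s t by (intro wM) auto
            ultimately have "norm (q s *\<^sub>R B (X n) - w (X n) s) \<le> C * N + M"
              by (intro order_trans[OF norm_triangle_ineq4] add_mono)
            moreover have "norm (k (t - s)) \<le> K" using s t by (intro K) auto
            ultimately show ?thesis
              unfolding norm_scaleR by (intro mult_mono) (auto intro: order_trans[OF norm_ge_zero])
          qed
          then show "norm (indicator {0..t} s *\<^sub>R k (t - s) *\<^sub>R (q s *\<^sub>R B (X n) - w (X n) s)) \<le> indicator {0..t} s * (K * (C * N + M))"
            by (auto simp: indicator_def)
        qed
      qed
      moreover have "(\<lambda>n. B (w (X n) t)) \<longlonglongrightarrow> B (v t)" by (intro B.tendsto pt t)
      ultimately show "B (v t) = (LBINT s:{0..t}. k (t - s) *\<^sub>R (q s *\<^sub>R B 0 - v s))"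
        unfolding eq[OF t] by (rule LIMSEQ_unique[rotated])
    qed
    have w0: "w 0 t = 0" if "t \<in> {0..T}" for t using solution_scale[OF that, of 0 0] by simp
    show "v = 0"
    proof (rule bcontfun_eqI)
      fix t
      have "(\<lambda>n. S (X n) t) \<longlonglongrightarrow> v t"
        using tendsto_bcontfun_uniform_limit[OF lim] by (auto dest!: tendsto_uniform_limitI[where x = t])
      moreover have "(\<lambda>n. S (X n) t) \<longlonglongrightarrow> v (cl t)" unfolding S by (rule pt[OF cl(1)])
      ultimately have "v t = v (cl t)" by (rule LIMSEQ_unique)
      then show "v t = (0 :: real \<Rightarrow>\<^sub>C 'a) t" by (simp add: v0[OF cl(1)] w0[OF cl(1)])
    qed
  qed
  then obtain K where K: "\<And>p. norm (S p) \<le> norm p * K" using bounded_linear.bounded by blast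
  have TT: "T \<in> {0..T}" using T by simp
  show ?thesis
  proof (rule bounded_linear_intro[where K = K])
    show "norm (w p T) \<le> norm p * K" for p
      using norm_bounded[of "S p" T] K[of p] by (simp add: S cl_id[OF TT])
  qed (simp_all add: solution_add[OF TT] solution_scale[OF TT])
qed

text \<open>Insert the equation for \<open>w h\<close> at time \<open>T\<close>, replace \<open>k (T - s) *\<^sub>R B r\<close> by the adjoint equation, and transpose the convolution. The terms
\<open>inner (B (\<Psi> t)) (w h t)\<close> then cancel.\<close>

lemma final_value_pairing:
  assumes \<Psi>: "set_integrable lborel {0..T} \<Psi>"
    and adj: "AE t\<in>{0<..<T} in lborel. B (\<Psi> t) = k (T - t) *\<^sub>R B r - (LBINT s:{t..T}. k (s - t) *\<^sub>R \<Psi> s)"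
  shows "inner (B r) (B (w h T)) = (LBINT t:{0..T}. q t * inner (B (\<Psi> t)) (B h))"
proof -
  have TT: "T \<in> {0..T}" using T by simp
  define \<phi> where "\<phi> s = q s *\<^sub>R B h - w h s" for s
  define c where "c s = (LBINT t:{s..T}. k (t - s) *\<^sub>R \<Psi> t)" for s
  have \<phi>: "set_integrable lborel {0..T} \<phi>" unfolding \<phi>_def by (rule source_integrable(1)[OF w TT])
  have k\<phi>: "set_integrable lborel {0..T} (\<lambda>s. k (T - s) *\<^sub>R \<phi> s)"
    unfolding \<phi>_def by (rule source_integrable(2)[OF w TT])
  note transpose = volterra_kernel_transpose[OF k \<phi> \<Psi>, folded c_def]
  have B\<Psi>: "set_integrable lborel {0..T} (\<lambda>t. B (\<Psi> t))" by (rule set_integral_bounded_linear(1)[OF B \<Psi>])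
  have q: "set_borel_measurable lborel {0..T} q" using qm by (simp add: set_borel_measurable_def)
  have int_q: "set_integrable lborel {0..T} (\<lambda>t. q t * inner (B (\<Psi> t)) (B h))"
    using qC
    by (intro set_integrable_bilinear_bounded[OF bounded_bilinear_mult q _
          set_integral_bounded_linear(1)[OF bounded_linear_inner_left B\<Psi>], where K = C]) auto
  obtain M where "\<And>t. t \<in> {0..T} \<Longrightarrow> norm (w h t) \<le> M" using continuous_Icc_bounded[OF w] by blast
  from set_integrable_bilinear_bounded[OF bounded_bilinear_inner set_borel_measurable_continuous_Icc[OF w] this B\<Psi>]
  have int_w: "set_integrable lborel {0..T} (\<lambda>t. inner (B (\<Psi> t)) (w h t))" by (simp add: inner_commute)
  have int_B\<phi>: "set_integrable lborel {0..T} (\<lambda>s. inner (B (\<Psi> s)) (\<phi> s))"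
    using set_integral_diff(1)[OF int_q int_w] by (simp add: \<phi>_def inner_diff_right)
  have "inner (B r) (B (w h T)) = (LBINT s:{0..T}. inner (B r) (k (T - s) *\<^sub>R \<phi> s))"
    using set_integral_bounded_linear(2)[OF bounded_linear_inner_right k\<phi>] by (simp add: eq[OF TT] \<phi>_def)
  also have "\<dots> = (LBINT s:{0..T}. inner (B (\<Psi> s)) (\<phi> s) + inner (c s) (\<phi> s))"
    unfolding set_lebesgue_integral_def
  proof (rule integral_cong_AE)
    show "(\<lambda>s. indicat_real {0..T} s *\<^sub>R inner (B r) (k (T - s) *\<^sub>R \<phi> s)) \<in> borel_measurable lborel"
      using set_integral_bounded_linear(1)[OF bounded_linear_inner_right k\<phi>] by (auto simp: set_integrable_def)
    show "(\<lambda>s. indicat_real {0..T} s *\<^sub>R (inner (B (\<Psi> s)) (\<phi> s) + inner (c s) (\<phi> s))) \<in> borel_measurable lborel"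
      using set_integral_add(1)[OF int_B\<phi> transpose(2)] by (auto simp: set_integrable_def)
    show "AE s in lborel. indicat_real {0..T} s *\<^sub>R inner (B r) (k (T - s) *\<^sub>R \<phi> s)
        = indicat_real {0..T} s *\<^sub>R (inner (B (\<Psi> s)) (\<phi> s) + inner (c s) (\<phi> s))"
      using adj AE_lborel_singleton[of 0] AE_lborel_singleton[of T]
    proof eventually_elim
      case (elim s)
      show ?case
      proof (cases "s \<in> {0..T}")
        case True
        then have "k (T - s) *\<^sub>R B r = B (\<Psi> s) + c s" using elim by (auto simp: c_def)
        then have "inner (k (T - s) *\<^sub>R B r) (\<phi> s) = inner (B (\<Psi> s) + c s) (\<phi> s)" by simp
        then show ?thesis by (simp add: inner_add_left)
      qed simp
    qed
  qed
  also have "\<dots> = (LBINT s:{0..T}. inner (B (\<Psi> s)) (\<phi> s)) + (LBINT s:{0..T}. inner (c s) (\<phi> s))"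
    by (rule set_integral_add(2)[OF int_B\<phi> transpose(2)])
  also have "(LBINT s:{0..T}. inner (c s) (\<phi> s)) = (LBINT t:{0..T}. inner (B (\<Psi> t)) (w h t))"
    unfolding transpose(1) by (intro set_lebesgue_integral_cong) (simp_all add: \<phi>_def eq[symmetric] sym)
  also have "(LBINT s:{0..T}. inner (B (\<Psi> s)) (\<phi> s))
      = (LBINT t:{0..T}. q t * inner (B (\<Psi> t)) (B h)) - (LBINT t:{0..T}. inner (B (\<Psi> t)) (w h t))"
    using set_integral_diff(2)[OF int_q int_w] by (simp add: \<phi>_def inner_diff_right)
  finally show ?thesis by simp
qed

text \<open>The difference \<open>F\<close> of the two sides is a bounded functional of \<open>h\<close>, represented by some \<open>y\<close>. By \<open>final_value_pairing\<close>, and as \<open>B\<close> commutes with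
the solution map, \<open>F\<close> vanishes on the range of \<open>B \<circ> B\<close>, so \<open>B y = 0\<close>. But a source in the kernel of \<open>B\<close> produces no
state and is orthogonal to \<open>\<Psi>\<close>, so \<open>inner y y = F y = 0\<close>.\<close>

lemma final_value_adjoint:
  assumes \<Psi>: "set_integrable lborel {0..T} \<Psi>"
    and \<Psi>_orth: "\<And>t y. B y = 0 \<Longrightarrow> inner (\<Psi> t) y = 0"
    and adj: "AE t\<in>{0<..<T} in lborel. B (\<Psi> t) = k (T - t) *\<^sub>R B r - (LBINT s:{t..T}. k (s - t) *\<^sub>R \<Psi> s)"
  shows "inner r (w h T) = inner (LBINT t:{0..T}. q t *\<^sub>R \<Psi> t) h"
proof -
  have TT: "T \<in> {0..T}" using T by simp
  have q: "set_borel_measurable lborel {0..T} q" using qm by (simp add: set_borel_measurable_def)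
  have q\<Psi>: "set_integrable lborel {0..T} (\<lambda>t. q t *\<^sub>R \<Psi> t)"
    using qC by (intro set_integrable_bilinear_bounded[OF bounded_bilinear_scaleR q _ \<Psi>, where K = C]) auto
  define g where "g = (LBINT t:{0..T}. q t *\<^sub>R \<Psi> t)"
  have g: "inner g x = (LBINT t:{0..T}. q t * inner (\<Psi> t) x)" for x
    using set_integral_bounded_linear(2)[OF bounded_linear_inner_left q\<Psi>, of x] by (simp add: g_def)
  define F where "F h = inner r (w h T) - inner g h" for h
  have "bounded_linear F"
    unfolding F_def
    by (intro bounded_linear_sub bounded_linear_inner_right
        bounded_linear_compose[OF bounded_linear_inner_right bounded_linear_final_value])
  then obtain y where y: "\<And>h. F h = inner y h" using riesz_representation by blast
  have "F (B (B h)) = 0" for h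
  proof -
    have "inner r (w (B (B h)) T) = inner (B r) (B (w h T))"
      by (simp add: solution_commute[OF TT] sym)
    also have "\<dots> = (LBINT t:{0..T}. q t * inner (B (\<Psi> t)) (B h))"
      by (rule final_value_pairing[OF \<Psi> adj])
    also have "\<dots> = inner g (B (B h))" by (simp add: g sym)
    finally show ?thesis by (simp add: F_def)
  qed
  then have "inner (B (B y)) h = 0" for h by (simp add: y sym)
  then have "B (B y) = 0" by (metis inner_eq_zero_iff)
  then have "inner (B y) (B y) = 0" by (simp add: sym)
  then have By: "B y = 0" by simp
  have "w y T = w 0 T"
    by (rule unique[OF w orth _ TT]) (auto simp: eq By)
  also have "\<dots> = 0" using solution_scale[OF TT, of 0 0] by simp
  finally have "F y = 0" by (simp add: F_def g \<Psi>_orth[OF By])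
  then have "y = 0" by (simp add: y)
  then have "F h = 0" by (simp add: y)
  then show ?thesis by (simp add: F_def g_def)
qed

end

section \<open>Hardy's inequality\<close>

instance l2 :: banach ..

instance h01 :: banach ..

lemma norm_to_l2_power2: "sq_integrable f \<Longrightarrow> (norm (to_l2 f))\<^sup>2 = (LINT x|unit_interval. (f x)\<^sup>2)"
  by (simp add: power2_norm_eq_inner inner_to_l2 flip: power2_eq_square)

lemma sq_integrable_mult_bounded:
  assumes m: "m \<in> borel_measurable borel" "\<And>x. \<bar>m x\<bar> \<le> K" and f: "sq_integrable f"
  shows "sq_integrable (\<lambda>x. m x * f x)" "norm (to_l2 (\<lambda>x. m x * f x)) \<le> K * norm (to_l2 f)"
proof -
  have fm: "f \<in> borel_measurable unit_interval" and fi: "integrable unit_interval (\<lambda>x. (f x)\<^sup>2)"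
    using f by (auto simp: sq_integrable_def)
  have mm: "m \<in> borel_measurable unit_interval"
    unfolding unit_interval_def using m(1) by (intro measurable_restrict_space1) simp
  have K: "0 \<le> K" using m(2)[of 0] by linarith
  have le: "(m x * f x)\<^sup>2 \<le> K\<^sup>2 * (f x)\<^sup>2" for x
    using power_mono[OF m(2)[of x] abs_ge_zero, of 2] by (simp add: power_mult_distrib mult_right_mono)
  have Ki: "integrable unit_interval (\<lambda>x. K\<^sup>2 * (f x)\<^sup>2)" using fi by simp
  have int: "integrable unit_interval (\<lambda>x. (m x * f x)\<^sup>2)"
    by (rule Bochner_Integration.integrable_bound[OF Ki]) (use fm mm le in auto)
  show sq: "sq_integrable (\<lambda>x. m x * f x)"
    using int fm mm by (auto simp: sq_integrable_def)
  have "(norm (to_l2 (\<lambda>x. m x * f x)))\<^sup>2 \<le> (LINT x|unit_interval. K\<^sup>2 * (f x)\<^sup>2)"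
    unfolding norm_to_l2_power2[OF sq] by (rule integral_mono[OF int Ki le])
  also have "\<dots> = (K * norm (to_l2 f))\<^sup>2" by (simp add: norm_to_l2_power2[OF f] power_mult_distrib)
  finally show "norm (to_l2 (\<lambda>x. m x * f x)) \<le> K * norm (to_l2 f)"
    using K by (simp add: power2_le_iff_abs_le)
qed

definition l2_multiply :: "(real \<Rightarrow> real) \<Rightarrow> l2 \<Rightarrow> l2"
  where "l2_multiply m f = to_l2 (\<lambda>x. m x * rep_l2 f x)"

lemma l2_eqI_AE:
  assumes "sq_integrable f" "AE x in unit_interval. f x = g x" "g \<in> borel_measurable unit_interval"
  shows "sq_integrable g" "to_l2 f = to_l2 g"
proof -
  have "integrable unit_interval (\<lambda>x. (f x)\<^sup>2) \<longleftrightarrow> integrable unit_interval (\<lambda>x. (g x)\<^sup>2)"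
    using assms by (intro integrable_cong_AE) (auto simp: sq_integrable_def)
  then show g: "sq_integrable g" using assms by (simp add: sq_integrable_def)
  show "to_l2 f = to_l2 g" using to_l2_eq_iff[OF assms(1) g] assms(2) by simp
qed

lemma rep_l2_add: "AE x in unit_interval. rep_l2 (f + g) x = rep_l2 f x + rep_l2 g x"
  using rep_to_l2[OF sq_integrable_add[OF sq_integrable_rep sq_integrable_rep], of f g]
  by (simp add: to_l2_add sq_integrable_rep)

lemma rep_l2_scale: "AE x in unit_interval. rep_l2 (c *\<^sub>R f) x = c * rep_l2 f x"
  using rep_to_l2[OF sq_integrable_scale[OF sq_integrable_rep], of c f]
  by (simp add: to_l2_scale sq_integrable_rep)

lemma rep_l2_measurable: "rep_l2 f \<in> borel_measurable unit_interval"
  using sq_integrable_rep[of f] by (simp add: sq_integrable_def)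

lemma bounded_linear_l2_multiply:
  assumes m: "m \<in> borel_measurable borel" "\<And>x. \<bar>m x\<bar> \<le> K"
  shows "bounded_linear (l2_multiply m)"
proof (rule bounded_linear_intro[where K = K])
  note sq = sq_integrable_mult_bounded[OF m sq_integrable_rep]
  have mm: "m \<in> borel_measurable unit_interval"
    unfolding unit_interval_def using m(1) by (intro measurable_restrict_space1) simp
  note [measurable] = mm rep_l2_measurable
  fix f g :: l2 and c :: real
  have "AE x in unit_interval. m x * rep_l2 (f + g) x = m x * rep_l2 f x + m x * rep_l2 g x"
    using rep_l2_add[of f g] by eventually_elim (simp add: algebra_simps)
  from l2_eqI_AE(2)[OF sq(1) this]
  show "l2_multiply m (f + g) = l2_multiply m f + l2_multiply m g"
    by (simp add: l2_multiply_def to_l2_add sq)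
  have "AE x in unit_interval. m x * rep_l2 (c *\<^sub>R f) x = c * (m x * rep_l2 f x)"
    using rep_l2_scale[of c f] by eventually_elim simp
  from l2_eqI_AE(2)[OF sq(1) this]
  show "l2_multiply m (c *\<^sub>R f) = c *\<^sub>R l2_multiply m f"
    by (simp add: l2_multiply_def to_l2_scale sq)
  show "norm (l2_multiply m f) \<le> norm f * K"
    using sq(2)[of f] by (simp add: l2_multiply_def mult.commute)
qed

text \<open>The support is a compact subset of the open interval, so it keeps a positive distance from both end points. This makes all
integrands in Hardy's inequality continuous on \<open>[a,b]\<close>.\<close>

lemma test_function_support:
  assumes "\<eta> \<in> test_functions"
  obtains a b where "0 < a" "a < b" "b < 1" "\<And>x. x \<notin> {a<..<b} \<Longrightarrow> \<eta> x = 0"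
proof -
  define K where "K = closure {x. \<eta> x \<noteq> 0}"
  have K01: "K \<subseteq> {0<..<1}" using assms by (simp add: test_functions_def K_def)
  have zero: "\<eta> x = 0" if "x \<notin> K" for x
    using that closure_subset[of "{x. \<eta> x \<noteq> 0}"] by (auto simp: K_def)
  show thesis
  proof (cases "K = {}")
    case True
    show thesis by (rule that[of "1/3" "2/3"]) (use zero True in auto)
  next
    case False
    have "compact K" unfolding compact_eq_bounded_closed
    proof
      show "bounded K"
        by (rule bounded_subset[OF compact_imp_bounded[OF compact_Icc[of 0 1]]]) (use K01 in auto)
    qed (simp add: K_def)
    then obtain l u where l: "l \<in> K" "\<And>x. x \<in> K \<Longrightarrow> l \<le> x" and u: "u \<in> K" "\<And>x. x \<in> K \<Longrightarrow> x \<le> u"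
      using compact_attains_inf[OF _ False] compact_attains_sup[OF _ False] by metis
    have lu: "0 < l" "l \<le> u" "u < 1" using l u K01 by auto
    show thesis
    proof (rule that[of "l / 2" "(u + 1) / 2"])
      fix x assume "x \<notin> {l/2<..<(u+1)/2}"
      then have "x \<notin> K" using l(2)[of x] u(2)[of x] lu by auto
      then show "\<eta> x = 0" by (rule zero)
    qed (use lu in auto)
  qed
qed

text \<open>Hardy's inequality with \<open>1 / x\<close> replaced by a bounded weight below it. It comes from the identity
\<open>4 \<eta>'\<^sup>2 - \<eta>\<^sup>2 / x\<^sup>2 = 4 (\<eta>' - \<eta> / (2 x))\<^sup>2 + 4 (\<eta>\<^sup>2 / (2 x))'\<close>, whose last term integrates to zero.\<close>

lemma hardy_test_function:
  assumes \<eta>: "\<eta> \<in> test_functions" and m: "m \<in> borel_measurable borel" "\<And>x. \<bar>m x\<bar> \<le> K"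
    and mx: "\<And>x. 0 < x \<Longrightarrow> \<bar>m x\<bar> \<le> 1 / x"
  shows "norm (to_l2 (\<lambda>x. m x * \<eta> x)) \<le> 2 * norm (to_l2 (deriv \<eta>))"
proof -
  obtain a b where ab: "0 < a" "a < b" "b < 1" and zero: "\<And>x. x \<notin> {a<..<b} \<Longrightarrow> \<eta> x = 0"
    using test_function_support[OF \<eta>] by blast
  let ?d = "deriv \<eta>"
  have D: "(\<eta> has_real_derivative ?d x) (at x within S)" for x S
    using test_functionsD(1)[OF \<eta>, of x] DERIV_deriv_iff_real_differentiable has_field_derivative_at_within by blast
  have c\<eta>: "continuous_on S \<eta>" for S
    by (meson D DERIV_continuous continuous_on_eq_continuous_within)
  have cd: "continuous_on S ?d" for S
  proof -
    have "?d differentiable at x" for x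
      using \<eta> unfolding test_functions_def by (force dest: spec[of _ 1] simp: all_conj_distrib)
    then show ?thesis
      by (meson continuous_at_imp_continuous_on differentiable_imp_continuous_within)
  qed
  define h' where "h' x = \<eta> x * ?d x / x - (\<eta> x)\<^sup>2 / (2 * x\<^sup>2)" for x
  have ch': "continuous_on {a..b} h'"
    unfolding h'_def using ab by (intro continuous_intros c\<eta> cd) auto
  have i1: "set_integrable lborel {a..b} h'" by (rule borel_integrable_atLeastAtMost'[OF ch'])
  have i2: "set_integrable lborel {a..b} (\<lambda>x. (\<eta> x)\<^sup>2 / x\<^sup>2)"
    using ab by (intro borel_integrable_atLeastAtMost' continuous_intros c\<eta>) auto
  have i3: "set_integrable lborel {a..b} (\<lambda>x. (?d x)\<^sup>2)"
    by (intro borel_integrable_atLeastAtMost' continuous_intros cd)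
  have "(LBINT x:{a..b}. h' x) = (\<eta> b)\<^sup>2 / (2 * b) - (\<eta> a)\<^sup>2 / (2 * a)"
  proof (rule bochner_FTC[where F = "\<lambda>x. (\<eta> x)\<^sup>2 / (2 * x)"])
    fix x assume x: "x \<in> {a..b}"
    have "((\<lambda>x. (\<eta> x)\<^sup>2 / (2 * x)) has_real_derivative h' x) (at x within {a..b})"
      using x ab unfolding h'_def
      by (auto intro!: derivative_eq_intros D simp: field_simps power2_eq_square)
    then show "((\<lambda>x. (\<eta> x)\<^sup>2 / (2 * x)) has_vector_derivative h' x) (at x within {a..b})"
      by (simp add: has_real_derivative_iff_has_vector_derivative)
  qed (use ab ch' in auto)
  then have h0: "(LBINT x:{a..b}. h' x) = 0" using zero[of a] zero[of b] by simp
  have "(LBINT x:{a..b}. 4 * h' x) \<le> (LBINT x:{a..b}. 4 * (?d x)\<^sup>2 - (\<eta> x)\<^sup>2 / x\<^sup>2)"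
  proof (rule set_integral_mono)
    fix x assume "x \<in> {a..b}"
    then have x: "0 < x" using ab by auto
    \<comment> \<open>the completed square\<close>
    have "4 * (?d x)\<^sup>2 - (\<eta> x)\<^sup>2 / x\<^sup>2 - 4 * h' x = 4 * (?d x - \<eta> x / (2 * x))\<^sup>2"
      unfolding h'_def using x by (simp add: power2_eq_square field_simps)
    then show "4 * h' x \<le> 4 * (?d x)\<^sup>2 - (\<eta> x)\<^sup>2 / x\<^sup>2"
      by (smt (verit) zero_le_power2)
  qed (use i1 i2 i3 in auto)
  then have main: "(LBINT x:{a..b}. (\<eta> x)\<^sup>2 / x\<^sup>2) \<le> 4 * (LBINT x:{a..b}. (?d x)\<^sup>2)"
    using h0 i2 i3 by simp
  note sq = sq_integrable_mult_bounded(1)[OF m test_functionsD(2)[OF \<eta>]]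
  have unit: "(LINT x|unit_interval. f x) = (LBINT x:{0<..<1}. f x)" "integrable unit_interval f = set_integrable lborel {0<..<1} f" for f :: "real \<Rightarrow> real"
    by (simp_all add: unit_interval_def integral_restrict_space integrable_restrict_space set_lebesgue_integral_def set_integrable_def)
  have "(norm (to_l2 (\<lambda>x. m x * \<eta> x)))\<^sup>2 = (LBINT x:{0<..<1}. (m x * \<eta> x)\<^sup>2)"
    by (simp add: norm_to_l2_power2[OF sq] unit)
  also have "\<dots> \<le> (LBINT x:{a..b}. (\<eta> x)\<^sup>2 / x\<^sup>2)"
    unfolding set_lebesgue_integral_def
  proof (rule integral_mono)
    show "integrable lborel (\<lambda>x. indicat_real {0<..<1} x *\<^sub>R (m x * \<eta> x)\<^sup>2)"
      using sq unit(2) by (simp add: sq_integrable_def set_integrable_def)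
    show "integrable lborel (\<lambda>x. indicat_real {a..b} x *\<^sub>R ((\<eta> x)\<^sup>2 / x\<^sup>2))"
      using i2 by (simp add: set_integrable_def)
    fix x :: real
    show "indicat_real {0<..<1} x *\<^sub>R (m x * \<eta> x)\<^sup>2 \<le> indicat_real {a..b} x *\<^sub>R ((\<eta> x)\<^sup>2 / x\<^sup>2)"
    proof (cases "x \<in> {a<..<b}")
      case True
      then have x: "0 < x" using ab by auto
      have "(m x)\<^sup>2 \<le> (1 / x)\<^sup>2" using mx[OF x] x by (simp flip: abs_le_square_iff)
      then have "(m x)\<^sup>2 * (\<eta> x)\<^sup>2 \<le> (1 / x)\<^sup>2 * (\<eta> x)\<^sup>2" by (rule mult_right_mono) simp
      then show ?thesis using True ab by (simp add: power_mult_distrib power_divide)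
    qed (use zero in auto)
  qed
  also note main
  also have "4 * (LBINT x:{a..b}. (?d x)\<^sup>2) \<le> 4 * (LBINT x:{0<..<1}. (?d x)\<^sup>2)"
  proof -
    have "integrable lborel (\<lambda>x. indicat_real {0<..<1} x *\<^sub>R (?d x)\<^sup>2)"
      using test_functionsD(3)[OF \<eta>] unit(2) by (simp add: sq_integrable_def set_integrable_def)
    then show ?thesis
      using i3 ab unfolding set_lebesgue_integral_def set_integrable_def
      by (intro mult_left_mono integral_mono) (auto simp: indicator_def)
  qed
  also have "\<dots> = (2 * norm (to_l2 ?d))\<^sup>2"
    by (simp add: norm_to_l2_power2[OF test_functionsD(3)[OF \<eta>]] unit power_mult_distrib)
  finally show ?thesis by (rule power2_le_imp_le) simp
qed

text \<open>As \<open>m\<close> is bounded, both sides are continuous in the \<open>H\<^sup>1\<close> norm, so the inequality passes from test functions to their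
closure.\<close>

lemma hardy_truncated:
  assumes m: "m \<in> borel_measurable borel" "\<And>x. \<bar>m x\<bar> \<le> K" and mx: "\<And>x. 0 < x \<Longrightarrow> \<bar>m x\<bar> \<le> 1 / x"
  shows "norm (l2_multiply m (h01_to_l2 v)) \<le> 2 * norm (weak_deriv v)"
proof -
  have "rep_h01 v \<in> closure grad_graph" by (rule rep_h01)
  then obtain X where X: "\<And>n. X n \<in> grad_graph" "X \<longlonglongrightarrow> rep_h01 v"
    unfolding closure_sequential by blast
  have "norm (l2_multiply m (fst (X n))) \<le> 2 * norm (snd (X n))" for n
  proof -
    obtain \<eta> where \<eta>: "\<eta> \<in> test_functions" "X n = (to_l2 \<eta>, to_l2 (deriv \<eta>))"
      using X(1)[of n] by (auto simp: grad_graph_def)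
    note s = test_functionsD(2)[OF \<eta>(1)]
    have "AE x in unit_interval. m x * rep_l2 (to_l2 \<eta>) x = m x * \<eta> x"
      using rep_to_l2[OF s] by eventually_elim simp
    then have "l2_multiply m (to_l2 \<eta>) = to_l2 (\<lambda>x. m x * \<eta> x)"
      unfolding l2_multiply_def
      by (intro l2_eqI_AE(2) sq_integrable_mult_bounded(1)[OF m sq_integrable_rep])
         (use sq_integrable_mult_bounded(1)[OF m s] in \<open>auto simp: sq_integrable_def\<close>)
    then show ?thesis using hardy_test_function[OF \<eta>(1) m mx] by (simp add: \<eta>(2))
  qed
  then show ?thesis
    unfolding h01_to_l2_def weak_deriv_def
    by (intro LIMSEQ_le[OF tendsto_norm[OF bounded_linear.tendsto[OF bounded_linear_l2_multiply[OF m] tendsto_fst[OF X(2)]]]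
          tendsto_mult[OF tendsto_const tendsto_norm[OF tendsto_snd[OF X(2)]]]]) auto
qed

definition hardy_quotient :: "h01 \<Rightarrow> l2"
  where "hardy_quotient v = to_l2 (\<lambda>x. rep_l2 (h01_to_l2 v) x / x)"

text \<open>The weight \<open>1 / x\<close> is the limit of its truncations to \<open>x > 1 / (n + 1)\<close>, and Fatou's lemma carries the bound over.\<close>

lemma hardy:
  shows sq_integrable_hardy: "sq_integrable (\<lambda>x. rep_l2 (h01_to_l2 v) x / x)"
    and norm_hardy_quotient: "norm (hardy_quotient v) \<le> 2 * norm (weak_deriv v)"
proof -
  let ?f = "rep_l2 (h01_to_l2 v)"
  define m where "m n x = (if 1 / real (Suc n) < x then 1 / x else 0)" for n and x :: real
  have mb: "m n \<in> borel_measurable borel" for n unfolding m_def by measurable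
  have mK: "\<bar>m n x\<bar> \<le> real (Suc n)" for n x
  proof (cases "1 / real (Suc n) < x")
    case True
    moreover have "0 < 1 / real (Suc n)" by simp
    ultimately have "0 < x" by linarith
    then show ?thesis using True by (simp add: m_def field_simps)
  qed (simp add: m_def)
  have mx: "\<bar>m n x\<bar> \<le> 1 / x" if "0 < x" for n x using that by (simp add: m_def)
  note [measurable] = rep_l2_measurable mb
  have sq: "sq_integrable (\<lambda>x. m n x * ?f x)" for n
    by (rule sq_integrable_mult_bounded(1)[OF mb mK sq_integrable_rep])
  have bnd: "(\<integral>\<^sup>+x. ennreal ((m n x * ?f x)\<^sup>2) \<partial>unit_interval) \<le> ennreal ((2 * norm (weak_deriv v))\<^sup>2)" for n
  proof -
    have "(\<integral>\<^sup>+x. ennreal ((m n x * ?f x)\<^sup>2) \<partial>unit_interval) = ennreal ((norm (l2_multiply (m n) (h01_to_l2 v)))\<^sup>2)"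
      using sq[of n] by (simp add: l2_multiply_def norm_to_l2_power2 nn_integral_eq_integral sq_integrable_def)
    also have "\<dots> \<le> ennreal ((2 * norm (weak_deriv v))\<^sup>2)"
      using hardy_truncated[OF mb mK mx, of n v] by (intro ennreal_leI power_mono) auto
    finally show ?thesis .
  qed
  have xm: "(\<lambda>x. x) \<in> borel_measurable unit_interval"
    unfolding unit_interval_def by (intro measurable_restrict_space1) simp
  have meas: "(\<lambda>x. ?f x / x) \<in> borel_measurable unit_interval"
    by (intro borel_measurable_divide rep_l2_measurable xm)
  have "(\<integral>\<^sup>+x. ennreal ((?f x / x)\<^sup>2) \<partial>unit_interval)
      = (\<integral>\<^sup>+x. liminf (\<lambda>n. ennreal ((m n x * ?f x)\<^sup>2)) \<partial>unit_interval)"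
  proof (rule nn_integral_cong)
    fix x assume "x \<in> space unit_interval"
    then have x: "0 < x" by simp
    obtain N where N: "1 / real (Suc N) < x" using nat_approx_posE[OF x] by blast
    have "\<forall>\<^sub>F n in sequentially. ennreal ((m n x * ?f x)\<^sup>2) = ennreal ((?f x / x)\<^sup>2)"
      using eventually_ge_at_top[of N]
    proof eventually_elim
      case (elim n)
      have "1 / real (Suc n) \<le> 1 / real (Suc N)" using elim by (simp add: field_simps)
      then show ?case using N by (simp add: m_def)
    qed
    then have "(\<lambda>n. ennreal ((m n x * ?f x)\<^sup>2)) \<longlonglongrightarrow> ennreal ((?f x / x)\<^sup>2)" by (rule tendsto_eventually)
    then show "ennreal ((?f x / x)\<^sup>2) = liminf (\<lambda>n. ennreal ((m n x * ?f x)\<^sup>2))"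
      by (intro lim_imp_Liminf[symmetric]) auto
  qed
  also have "\<dots> \<le> liminf (\<lambda>n. \<integral>\<^sup>+x. ennreal ((m n x * ?f x)\<^sup>2) \<partial>unit_interval)"
    using sq by (intro nn_integral_liminf) (auto simp: sq_integrable_def)
  also have "\<dots> \<le> ennreal ((2 * norm (weak_deriv v))\<^sup>2)"
    by (intro Liminf_le always_eventually allI bnd) simp
  finally have le: "(\<integral>\<^sup>+x. ennreal ((?f x / x)\<^sup>2) \<partial>unit_interval) \<le> ennreal ((2 * norm (weak_deriv v))\<^sup>2)" .
  show s: "sq_integrable (\<lambda>x. ?f x / x)"
    unfolding sq_integrable_def
    by (intro conjI meas integrableI_bounded)
       (use borel_measurable_power[OF meas, of 2] le in \<open>auto simp: le_less_trans top_unique\<close>)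
  have "ennreal ((norm (hardy_quotient v))\<^sup>2) \<le> ennreal ((2 * norm (weak_deriv v))\<^sup>2)"
    using le s by (simp add: hardy_quotient_def norm_to_l2_power2 nn_integral_eq_integral sq_integrable_def)
  then have "(norm (hardy_quotient v))\<^sup>2 \<le> (2 * norm (weak_deriv v))\<^sup>2" by simp
  then show "norm (hardy_quotient v) \<le> 2 * norm (weak_deriv v)" by (rule power2_le_imp_le) simp
qed

lemma norm_h01_to_l2_le: "norm (h01_to_l2 v) \<le> norm v"
  using norm_fst_le[of "fst (rep_h01 v)" "snd (rep_h01 v)"] by (simp add: h01_to_l2_def norm_h01.rep_eq)

lemma norm_weak_deriv_le: "norm (weak_deriv v) \<le> norm v"
  using norm_snd_le[of "snd (rep_h01 v)" "fst (rep_h01 v)"] by (simp add: weak_deriv_def norm_h01.rep_eq)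

lemma bounded_linear_weak_deriv: "bounded_linear weak_deriv"
proof (rule bounded_linear_intro[where K = 1])
  show "norm (weak_deriv v) \<le> norm v * 1" for v using norm_weak_deriv_le by simp
qed (simp_all add: weak_deriv_def plus_h01.rep_eq scaleR_h01.rep_eq)

lemma bounded_linear_hardy_quotient: "bounded_linear hardy_quotient"
proof (rule bounded_linear_intro[where K = 2])
  note lin = bounded_linear.linear[OF bounded_linear_h01_to_l2]
  have xm: "(\<lambda>x. x) \<in> borel_measurable unit_interval"
    unfolding unit_interval_def by (intro measurable_restrict_space1) simp
  note [measurable] = rep_l2_measurable xm
  fix v w :: h01 and c :: real
  have "AE x in unit_interval. rep_l2 (h01_to_l2 (v + w)) x / x = rep_l2 (h01_to_l2 v) x / x + rep_l2 (h01_to_l2 w) x / x"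
    using rep_l2_add[of "h01_to_l2 v" "h01_to_l2 w"]
    by eventually_elim (simp add: linear_add[OF lin] add_divide_distrib)
  from l2_eqI_AE(2)[OF sq_integrable_hardy this]
  show "hardy_quotient (v + w) = hardy_quotient v + hardy_quotient w"
    by (simp add: hardy_quotient_def to_l2_add sq_integrable_hardy)
  have "AE x in unit_interval. rep_l2 (h01_to_l2 (c *\<^sub>R v)) x / x = c * (rep_l2 (h01_to_l2 v) x / x)"
    using rep_l2_scale[of c "h01_to_l2 v"]
    by eventually_elim (simp add: linear_scale[OF lin])
  from l2_eqI_AE(2)[OF sq_integrable_hardy this]
  show "hardy_quotient (c *\<^sub>R v) = c *\<^sub>R hardy_quotient v"
    by (simp add: hardy_quotient_def to_l2_scale sq_integrable_hardy del: times_divide_eq_right)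
  show "norm (hardy_quotient v) \<le> norm v * 2"
    using norm_hardy_quotient[of v] norm_weak_deriv_le[of v] by simp
qed

text \<open>Since \<open>1 \<le> 1 / x\<close> on the unit interval, Hardy's inequality contains Poincare's.\<close>

lemma norm_le_hardy_quotient: "norm (h01_to_l2 v) \<le> norm (hardy_quotient v)"
proof -
  let ?f = "rep_l2 (h01_to_l2 v)"
  have "(norm (to_l2 ?f))\<^sup>2 \<le> (norm (hardy_quotient v))\<^sup>2"
    unfolding hardy_quotient_def norm_to_l2_power2[OF sq_integrable_hardy] norm_to_l2_power2[OF sq_integrable_rep]
  proof (rule integral_mono)
    fix x assume "x \<in> space unit_interval"
    then have x: "0 < x" "x < 1" by auto
    then have "x\<^sup>2 \<le> 1" by (simp add: power_le_one)
    then show "(?f x)\<^sup>2 \<le> (?f x / x)\<^sup>2"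
      using x by (simp add: power_divide le_divide_eq mult_left_le)
  qed (use sq_integrable_rep sq_integrable_hardy in \<open>auto simp: sq_integrable_def\<close>)
  then show ?thesis by (simp add: power2_le_iff_abs_le)
qed

section \<open>The elliptic operator and its inverse\<close>

text \<open>In this form the bilinearity and the boundedness of \<open>a_form\<close> are those of two inner products.\<close>

lemma a_form_eq: "a_form \<mu> v w = inner (weak_deriv v) (weak_deriv w) - \<mu> * inner (hardy_quotient v) (hardy_quotient w)"
  by (simp add: a_form_def hardy_quotient_def inner_to_l2 sq_integrable_hardy power2_eq_square)

lemma bounded_bilinear_a_form: "bounded_bilinear (a_form \<mu>)"
proof
  note lin = bounded_linear.linear[OF bounded_linear_weak_deriv] bounded_linear.linear[OF bounded_linear_hardy_quotient]
  note lin_simps = linear_add[OF lin(1)] linear_add[OF lin(2)] linear_scale[OF lin(1)] linear_scale[OF lin(2)]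
  fix v v' w w' :: h01 and r :: real
  show "a_form \<mu> (v + v') w = a_form \<mu> v w + a_form \<mu> v' w"
    by (simp add: a_form_eq lin_simps inner_add_left algebra_simps)
  show "a_form \<mu> v (w + w') = a_form \<mu> v w + a_form \<mu> v w'"
    by (simp add: a_form_eq lin_simps inner_add_right algebra_simps)
  show "a_form \<mu> (r *\<^sub>R v) w = r *\<^sub>R a_form \<mu> v w"
    by (simp add: a_form_eq lin_simps algebra_simps)
  show "a_form \<mu> v (r *\<^sub>R w) = r *\<^sub>R a_form \<mu> v w"
    by (simp add: a_form_eq lin_simps algebra_simps)
  note d = norm_weak_deriv_le
  have h: "norm (hardy_quotient v) \<le> 2 * norm v" for v using norm_hardy_quotient[of v] d[of v] by simp
  have "\<bar>a_form \<mu> v w\<bar> \<le> norm v * norm w * (1 + 4 * \<bar>\<mu>\<bar>)" for v w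
  proof -
    have "\<bar>inner (weak_deriv v) (weak_deriv w)\<bar> \<le> norm v * norm w"
      by (rule order_trans[OF Cauchy_Schwarz_ineq2]) (intro mult_mono d norm_ge_zero)
    moreover have "\<bar>inner (hardy_quotient v) (hardy_quotient w)\<bar> \<le> (2 * norm v) * (2 * norm w)"
      by (rule order_trans[OF Cauchy_Schwarz_ineq2]) (intro mult_mono h norm_ge_zero mult_nonneg_nonneg zero_le_numeral)
    then have "\<bar>\<mu> * inner (hardy_quotient v) (hardy_quotient w)\<bar> \<le> \<bar>\<mu>\<bar> * (4 * (norm v * norm w))"
      unfolding abs_mult by (intro mult_left_mono) auto
    ultimately show ?thesis by (simp add: a_form_eq algebra_simps)
  qed
  then show "\<exists>K. \<forall>v w. norm (a_form \<mu> v w) \<le> norm v * norm w * K" by auto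
qed

lemma a_form_coercive:
  assumes "\<mu> < 1/4"
  shows "min 1 (1 - 4 * \<mu>) / 5 * (norm v)\<^sup>2 \<le> a_form \<mu> v v"
proof -
  let ?d = "(norm (weak_deriv v))\<^sup>2" and ?h = "(norm (hardy_quotient v))\<^sup>2"
  have h: "?h \<le> 4 * ?d" using power_mono[OF norm_hardy_quotient[of v], of 2] by (simp add: power_mult_distrib)
  have "(norm (h01_to_l2 v))\<^sup>2 \<le> ?h" using norm_le_hardy_quotient[of v] by (simp add: power_mono)
  moreover have "(norm v)\<^sup>2 = (norm (h01_to_l2 v))\<^sup>2 + ?d"
    by (simp add: power2_norm_eq_inner inner_h01_eq)
  ultimately have v: "(norm v)\<^sup>2 \<le> 5 * ?d" using h by linarith
  have "min 1 (1 - 4 * \<mu>) * ?d \<le> ?d - \<mu> * ?h"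
  proof (cases "0 \<le> \<mu>")
    case True
    have "\<mu> * ?h \<le> \<mu> * (4 * ?d)" using True h by (rule mult_left_mono[rotated])
    then show ?thesis using True by (simp add: min_def algebra_simps)
  next
    case False
    then have "\<mu> * ?h \<le> 0" by (intro mult_nonpos_nonneg) auto
    then show ?thesis using False by (simp add: min_def)
  qed
  moreover have "min 1 (1 - 4 * \<mu>) / 5 * (norm v)\<^sup>2 \<le> min 1 (1 - 4 * \<mu>) / 5 * (5 * ?d)"
    using assms v by (intro mult_left_mono) auto
  ultimately show ?thesis by (simp add: a_form_eq power2_norm_eq_inner)
qed

text \<open>The operator \<open>A\<close> that represents \<open>a\<close> is bounded below by coercivity, so its range is closed; a vector \<open>z\<close> orthogonal to the range satisfies
\<open>a z z = 0\<close>, hence \<open>z = 0\<close>.\<close>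

lemma lax_milgram:
  fixes a :: "'a::{real_inner,banach} \<Rightarrow> 'a \<Rightarrow> real"
  assumes a: "bounded_bilinear a" and c: "0 < c" "\<And>v. c * (norm v)\<^sup>2 \<le> a v v"
    and F: "bounded_linear F"
  shows "\<exists>y. \<forall>v. a y v = F v"
proof -
  interpret a: bounded_bilinear a by fact
  have "\<exists>y. \<forall>v. a u v = inner y v" for u
    by (rule riesz_representation) (rule a.bounded_linear_right)
  then obtain A where A: "\<And>u v. a u v = inner (A u) v" by metis
  obtain K where K: "0 < K" "\<And>u v. norm (a u v) \<le> norm u * norm v * K" using a.pos_bounded by blast
  have A_bl: "bounded_linear A"
  proof (rule bounded_linear_intro[where K = K])
    show "A (u + v) = A u + A v" for u v
      by (rule vector_eq_rdot[THEN iffD1]) (simp add: A[symmetric] a.add_left inner_add_left)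
    show "A (r *\<^sub>R u) = r *\<^sub>R A u" for r u
      by (rule vector_eq_rdot[THEN iffD1]) (simp add: A[symmetric] a.scaleR_left)
    show "norm (A u) \<le> norm u * K" for u
    proof (cases "A u = 0")
      case True
      then show ?thesis using K(1) by simp
    next
      case False
      have "norm (A u) * norm (A u) \<le> norm u * K * norm (A u)"
        using K(2)[of u "A u"] by (simp add: A power2_norm_eq_inner[symmetric] power2_eq_square ac_simps)
      then show ?thesis using False by simp
    qed
  qed
  have lower: "c * norm u \<le> norm (A u)" for u
  proof (cases "u = 0")
    case False
    have "norm u * (c * norm u) \<le> inner (A u) u" using c(2)[of u] by (simp add: A power2_eq_square ac_simps)
    also have "\<dots> \<le> norm u * norm (A u)" using norm_cauchy_schwarz[of "A u" u] by (simp add: mult.commute)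
    finally show ?thesis using False by simp
  qed simp
  have "complete (range A)"
    by (rule complete_isometric_image[OF c(1) subspace_UNIV A_bl _ complete_UNIV]) (simp add: lower)
  then have cl: "closed (range A)" by (rule complete_imp_closed)
  have sub: "subspace (range A)"
    using linear_subspace_image[OF bounded_linear.linear[OF A_bl] subspace_UNIV] .
  obtain f where f: "\<And>x. F x = inner f x" using riesz_representation[OF F] by blast
  obtain m where m: "m \<in> range A" "\<And>v. v \<in> range A \<Longrightarrow> inner (f - m) v = 0"
    using closed_subspace_projection[OF sub cl, of f] by blast
  have "a (f - m) (f - m) = 0" using m(2)[of "A (f - m)"] by (simp add: A inner_commute)
  then have "c * (norm (f - m))\<^sup>2 \<le> 0" using c(2)[of "f - m"] by simp
  then have "f = m" using c(1) by (simp add: mult_le_0_iff)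
  then show ?thesis using m(1) A f by auto
qed

lemma elliptic_solution_operator:
  assumes \<mu>: "\<mu> < 1/4"
  obtains G where "bounded_linear G" "\<And>f v. a_form \<mu> (G f) v = inner f (h01_to_l2 v)"
proof -
  define c where "c = min 1 (1 - 4 * \<mu>) / 5"
  have c: "0 < c" "\<And>v. c * (norm v)\<^sup>2 \<le> a_form \<mu> v v"
    using \<mu> a_form_coercive[OF \<mu>] by (auto simp: c_def)
  have bb: "bounded_bilinear (a_form \<mu>)" by (rule bounded_bilinear_a_form)
  interpret a: bounded_bilinear "a_form \<mu>" by (rule bb)
  have lin: "bounded_linear (\<lambda>v. inner f (h01_to_l2 v))" for f
    by (rule bounded_linear_compose[OF bounded_linear_inner_right bounded_linear_h01_to_l2])
  have "\<exists>y. \<forall>v. a_form \<mu> y v = inner f (h01_to_l2 v)" for f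
    by (rule lax_milgram[OF bb c lin])
  then obtain G where G: "\<And>f v. a_form \<mu> (G f) v = inner f (h01_to_l2 v)" by metis
  have uniq: "y = z" if "\<And>v. a_form \<mu> y v = a_form \<mu> z v" for y z
  proof -
    have "a_form \<mu> (y - z) (y - z) = 0" by (simp add: a.diff_left that)
    then have "c * (norm (y - z))\<^sup>2 \<le> 0" using c(2)[of "y - z"] by simp
    then show ?thesis using c(1) by (simp add: mult_le_0_iff)
  qed
  have "bounded_linear G"
  proof (rule bounded_linear_intro[where K = "1 / c"])
    show "G (f + g) = G f + G g" for f g
      by (rule uniq) (simp add: G a.add_left inner_add_left)
    show "G (r *\<^sub>R f) = r *\<^sub>R G f" for r f
      by (rule uniq) (simp add: G a.scaleR_left)
    show "norm (G f) \<le> norm f * (1 / c)" for f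
    proof (cases "G f = 0")
      case False
      have "c * (norm (G f))\<^sup>2 \<le> inner f (h01_to_l2 (G f))" using c(2)[of "G f"] by (simp add: G)
      also have "\<dots> \<le> norm f * norm (h01_to_l2 (G f))" by (rule norm_cauchy_schwarz)
      also have "\<dots> \<le> norm f * norm (G f)"
        by (intro mult_left_mono norm_h01_to_l2_le) simp
      finally have "(c * norm (G f)) * norm (G f) \<le> norm f * norm (G f)" by (simp add: power2_eq_square ac_simps)
      then have "c * norm (G f) \<le> norm f" using False by simp
      then show ?thesis using c(1) by (simp add: field_simps)
    qed (use c(1) in simp)
  qed
  then show thesis using that G by blast
qed

section \<open>Weak solutions as solutions of Volterra equations\<close>

lemma bounded_linear_pivot: "bounded_linear pivot"
proof (rule bounded_linear_intro[where K = 1])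
  show "pivot (f + g) = pivot f + pivot g" for f g
    by (rule blinfun_eqI) (simp add: blinfun.add_left inner_add_left)
  show "pivot (c *\<^sub>R f) = c *\<^sub>R pivot f" for c f
    by (rule blinfun_eqI) (simp add: blinfun.scaleR_left)
  show "norm (pivot f) \<le> norm f * 1" for f
  proof (rule norm_blinfun_bound)
    fix v
    have "norm f * norm (h01_to_l2 v) \<le> norm f * norm v" by (intro mult_left_mono norm_h01_to_l2_le) simp
    then show "norm (blinfun_apply (pivot f) v) \<le> norm f * 1 * norm v"
      using Cauchy_Schwarz_ineq2[of f "h01_to_l2 v"] by simp
  qed simp
qed

text \<open>\<open>G\<close> is the solution operator of the elliptic problem with values in \<open>H\<^sub>0\<^sup>1(0,1)\<close>, and \<open>L_inv\<close> is \<open>G\<close> followed by the embedding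
into \<open>L\<^sup>2(0,1)\<close>. Testing an identity in \<open>\<H>\<^sup>-\<^sup>1\<close> with \<open>G f\<close> for all \<open>f\<close> amounts to applying \<open>L\<^sub>\<mu>\<^sup>-\<^sup>1\<close> to it.\<close>

locale elliptic_inverse =
  fixes \<mu> :: real and G :: "l2 \<Rightarrow> h01"
  assumes \<mu>: "\<mu> < 1/4" and G: "bounded_linear G"
    and a_form_G: "\<And>f v. a_form \<mu> (G f) v = inner f (h01_to_l2 v)"
begin

definition L_inv :: "l2 \<Rightarrow> l2" where "L_inv f = h01_to_l2 (G f)"

lemma bounded_linear_L_inv: "bounded_linear L_inv"
  unfolding L_inv_def by (rule bounded_linear_compose[OF bounded_linear_h01_to_l2 G])

lemma a_form_G_right: "a_form \<mu> v (G f) = inner f (h01_to_l2 v)"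
  using a_form_G[of f v] by (simp add: a_form_eq inner_commute)

lemma L_inv_symmetric: "inner (L_inv f) g = inner f (L_inv g)"
  using a_form_G[of f "G g"] a_form_G_right[of "G f" g] by (simp add: L_inv_def inner_commute)

lemma inner_G: "inner f (h01_to_l2 (G g)) = inner g (L_inv f)"
  using L_inv_symmetric[of f g] by (simp add: L_inv_def inner_commute)

text \<open>\<open>L_inv y = 0\<close> gives \<open>a\<^sub>\<mu>(G y, G y) = (y, L_inv y) = 0\<close>, hence \<open>G y = 0\<close> by coercivity.\<close>

lemma kernel_L_inv_orthogonal:
  assumes "L_inv y = 0" shows "inner y (h01_to_l2 v) = 0"
proof -
  have "a_form \<mu> (G y) (G y) = 0" using a_form_G[of y "G y"] assms by (simp add: L_inv_def)
  then have "min 1 (1 - 4 * \<mu>) / 5 * (norm (G y))\<^sup>2 \<le> 0" using a_form_coercive[OF \<mu>, of "G y"] by simp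
  moreover have "0 < min 1 (1 - 4 * \<mu>) / 5" using \<mu> by simp
  ultimately have "G y = 0" by (simp add: mult_le_0_iff)
  then show ?thesis
    using a_form_G[of y v] bounded_bilinear.zero_left[OF bounded_bilinear_a_form] by simp
qed

text \<open>The Volterra form of the weak equation holds in \<open>\<H>\<^sup>-\<^sup>1\<close> and contains \<open>a\<^sub>\<mu>(u(s), v)\<close>. For \<open>v = G f\<close> this is
\<open>(u(s), f)\<close>, so the unbounded operator disappears. The initial values enter in a way that does not depend on \<open>p\<close>, and cancel in differences.\<close>

lemma weak_solution_volterra:
  assumes \<alpha>: "1 < \<alpha>" "\<alpha> < 2"
    and sol: "weak_solution \<mu> \<alpha> T q u0 u1 p u"
    and qm: "q' \<in> borel_measurable borel" and qC: "\<And>t. \<bar>q' t\<bar> \<le> C"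
    and qq: "AE t\<in>{0<..<T} in lborel. q t = q' t"
    and t: "t \<in> {0..T}"
  shows "L_inv (h01_to_l2 (u t)) = L_inv (h01_to_l2 u0) + t *\<^sub>R L_inv u1
    + (LBINT s:{0..t}. memory_kernel \<alpha> (t - s) *\<^sub>R (q' s *\<^sub>R L_inv p - h01_to_l2 (u s)))"
proof -
  obtain u' g where u: "continuous_on {0..T} u" "u 0 = u0"
    and u': "continuous_on {0..T} u'"
      "\<And>t. t \<in> {0..T} \<Longrightarrow> ((\<lambda>s. h01_to_hm1 (u s)) has_vector_derivative u' t) (at t within {0..T})"
      "u' 0 = pivot u1"
    and g: "has_caputo_derivative \<alpha> T u' g"
    and equ: "AE t\<in>{0<..<T} in lborel. \<forall>v. blinfun_apply (g t) v + a_form \<mu> (u t) v = inner (q t *\<^sub>R p) (h01_to_l2 v)"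
    using sol unfolding weak_solution_def by blast
  have gt: "set_integrable lborel {0..t} g"
    using g t unfolding has_caputo_derivative_def by (auto intro: set_integrable_subset)
  have cu: "continuous_on {0..T} (\<lambda>t. h01_to_l2 (u t))"
    by (rule bounded_linear.continuous_on[OF bounded_linear_h01_to_l2 u(1)])
  let ?R = "\<lambda>s. memory_kernel \<alpha> (t - s) *\<^sub>R (q' s *\<^sub>R L_inv p - h01_to_l2 (u s))"
  have R: "set_integrable lborel {0..t} ?R"
    by (rule volterra_integrand_integrable(2)[OF continuous_memory_kernel[OF \<alpha>(1)] qm qC cu t])
  have U: "h01_to_hm1 (u t) = h01_to_hm1 (u 0) + t *\<^sub>R u' 0 + rl_integral_left \<alpha> g t"
    by (rule caputo_imp_volterra[OF \<alpha> g u'(2,1) t])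
  show ?thesis
  proof (rule vector_eq_ldot[THEN iffD1], rule allI)
    fix f
    have Lf: "bounded_linear (\<lambda>F :: hm1. blinfun_apply F (G f))" by (rule blinfun.bounded_linear_left)
    have "inner f (L_inv (h01_to_l2 (u t))) = blinfun_apply (h01_to_hm1 (u t)) (G f)"
      by (simp add: inner_G)
    also have "\<dots> = inner f (L_inv (h01_to_l2 u0)) + t * inner f (L_inv u1) + blinfun_apply (rl_integral_left \<alpha> g t) (G f)"
      unfolding U by (simp add: u(2) u'(3) blinfun.add_left blinfun.scaleR_left inner_G)
    also have "blinfun_apply (rl_integral_left \<alpha> g t) (G f)
        = (LBINT s:{0..t}. memory_kernel \<alpha> (t - s) *\<^sub>R blinfun_apply (g s) (G f))"
      using \<alpha> by (intro rl_integral_left_apply[OF _ gt Lf]) simp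
    also have "\<dots> = (LBINT s:{0..t}. inner f (?R s))"
      unfolding set_lebesgue_integral_def
    proof (rule integral_cong_AE)
      have "set_integrable lborel {0..t} (\<lambda>s. (t - s) powr (\<alpha> - 1) *\<^sub>R blinfun_apply (g s) (G f))"
        using \<alpha> by (intro set_integrable_power_kernel set_integral_bounded_linear(1)[OF Lf gt]) simp
      then have "set_integrable lborel {0..t} (\<lambda>s. memory_kernel \<alpha> (t - s) *\<^sub>R blinfun_apply (g s) (G f))"
        by (simp add: memory_kernel_def)
      then show "(\<lambda>s. indicat_real {0..t} s *\<^sub>R memory_kernel \<alpha> (t - s) *\<^sub>R blinfun_apply (g s) (G f)) \<in> borel_measurable lborel"
        unfolding set_integrable_def by (rule borel_measurable_integrable)
      show "(\<lambda>s. indicat_real {0..t} s *\<^sub>R inner f (?R s)) \<in> borel_measurable lborel"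
        using set_integral_bounded_linear(1)[OF bounded_linear_inner_right R, of f]
        unfolding set_integrable_def by (rule borel_measurable_integrable)
      show "AE s in lborel. indicat_real {0..t} s *\<^sub>R memory_kernel \<alpha> (t - s) *\<^sub>R blinfun_apply (g s) (G f)
          = indicat_real {0..t} s *\<^sub>R inner f (?R s)"
        using equ qq AE_lborel_singleton[of 0] AE_lborel_singleton[of T]
      proof eventually_elim
        case (elim s)
        show ?case
        proof (cases "s \<in> {0..t}")
          case True
          then have "s \<in> {0<..<T}" using elim t by auto
          then have "blinfun_apply (g s) (G f) + a_form \<mu> (u s) (G f) = inner (q' s *\<^sub>R p) (h01_to_l2 (G f))"
            using elim by simp
          then have "blinfun_apply (g s) (G f) = inner f (q' s *\<^sub>R L_inv p - h01_to_l2 (u s))"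
            by (simp add: inner_diff_right a_form_G_right inner_G
                linear_scale[OF bounded_linear.linear[OF bounded_linear_L_inv]] algebra_simps)
          then show ?thesis by simp
        qed simp
      qed
    qed
    also have "\<dots> = inner f (LBINT s:{0..t}. ?R s)"
      by (rule set_integral_bounded_linear(2)[OF bounded_linear_inner_right R])
    finally show "inner f (L_inv (h01_to_l2 (u t)))
        = inner f (L_inv (h01_to_l2 u0) + t *\<^sub>R L_inv u1 + (LBINT s:{0..t}. ?R s))"
      by (simp add: inner_add_right)
  qed
qed

text \<open>The same reduction for the adjoint problem, with the terminal traces \<open>0\<close> and \<open>r\<close> in the place of the initial values. The exceptional null set
does not depend on the test function \<open>G f\<close>.\<close>

lemma adjoint_solution_volterra:
  assumes \<alpha>: "1 < \<alpha>" "\<alpha> < 2" and adj: "adjoint_solution \<mu> \<alpha> T r \<psi>"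
  defines "\<Psi> \<equiv> \<lambda>s. indicator {0<..<T} s *\<^sub>R h01_to_l2 (\<psi> s)"
  shows "integrable lborel \<Psi>"
    and "AE t\<in>{0<..<T} in lborel. L_inv (\<Psi> t) = memory_kernel \<alpha> (T - t) *\<^sub>R L_inv r - (LBINT s:{t..T}. memory_kernel \<alpha> (s - t) *\<^sub>R \<Psi> s)"
proof -
  obtain d1 d2 where \<psi>: "set_integrable lborel {0<..<T} \<psi>"
    and D: "has_right_rl_derivatives \<alpha> T (\<lambda>t. h01_to_hm1 (\<psi> t)) d1 d2"
    and equ: "AE t\<in>{0<..<T} in lborel. \<forall>v. blinfun_apply (d2 t) v + a_form \<mu> (\<psi> t) v = 0"
    and lim0: "(rl_integral_right (2 - \<alpha>) T (\<lambda>t. h01_to_hm1 (\<psi> t)) \<longlongrightarrow> 0) (at_left T)"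
    and lim1: "(d1 \<longlongrightarrow> pivot r) (at_left T)"
    using adj unfolding adjoint_solution_def by blast
  have \<psi>l: "set_integrable lborel {0<..<T} (\<lambda>t. h01_to_l2 (\<psi> t))"
    by (rule set_integral_bounded_linear(1)[OF bounded_linear_h01_to_l2 \<psi>])
  then show \<Psi>: "integrable lborel \<Psi>" by (simp add: \<Psi>_def set_integrable_def)
  define e where "e s = indicator {0<..<T} s *\<^sub>R d2 s" for s
  have e: "integrable lborel e"
    using D by (simp add: e_def[abs_def] has_right_rl_derivatives_def set_integrable_def)
  note si = integrable_imp_set_integrable
  have "AE t\<in>{0<..<T} in lborel. h01_to_hm1 (\<psi> t) = ((T - t) powr (\<alpha> - 1) / Gamma \<alpha>) *\<^sub>R pivot r + rl_integral_right \<alpha> T e t"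
    unfolding e_def
    by (rule right_rl_imp_volterra[OF \<alpha> D set_integral_bounded_linear(1)[OF bounded_linear_pivot \<psi>l] lim0 lim1])
  then show "AE t\<in>{0<..<T} in lborel. L_inv (\<Psi> t) = memory_kernel \<alpha> (T - t) *\<^sub>R L_inv r - (LBINT s:{t..T}. memory_kernel \<alpha> (s - t) *\<^sub>R \<Psi> s)"
  proof eventually_elim
    case (elim t)
    show ?case
    proof
      assume t: "t \<in> {0<..<T}"
      have key: "set_integrable lborel {t..T} (\<lambda>s. memory_kernel \<alpha> (s - t) *\<^sub>R f s)"
        if "integrable lborel f" for f :: "real \<Rightarrow> 'b::{banach,second_countable_topology}"
      proof -
        have "continuous_on {t..T} (\<lambda>s. memory_kernel \<alpha> (s - t))"
          using t by (intro continuous_on_compose2[OF continuous_memory_kernel[OF \<alpha>(1), of T]] continuous_intros) auto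
        moreover from this obtain K where "\<And>s. s \<in> {t..T} \<Longrightarrow> norm (memory_kernel \<alpha> (s - t)) \<le> K"
          using continuous_Icc_bounded by blast
        ultimately show ?thesis
          by (intro set_integrable_bilinear_bounded[OF bounded_bilinear_scaleR set_borel_measurable_continuous_Icc _ si[OF that]]) auto
      qed
      show "L_inv (\<Psi> t) = memory_kernel \<alpha> (T - t) *\<^sub>R L_inv r - (LBINT s:{t..T}. memory_kernel \<alpha> (s - t) *\<^sub>R \<Psi> s)"
      proof (rule vector_eq_ldot[THEN iffD1], rule allI)
        fix f
        have Lf: "bounded_linear (\<lambda>F :: hm1. blinfun_apply F (G f))" by (rule blinfun.bounded_linear_left)
        have er: "set_integrable lborel {0..T - t} (\<lambda>s. e (T - s))"
          using si[OF e, of "{t..T}"] by (simp flip: set_integrable_reflect)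
        have "inner f (L_inv (\<Psi> t)) = blinfun_apply (h01_to_hm1 (\<psi> t)) (G f)"
          using t by (simp add: \<Psi>_def inner_G)
        also have "\<dots> = memory_kernel \<alpha> (T - t) * inner f (L_inv r) + blinfun_apply (rl_integral_right \<alpha> T e t) (G f)"
          using elim t by (simp add: blinfun.add_left blinfun.scaleR_left memory_kernel_def inner_G)
        also have "blinfun_apply (rl_integral_right \<alpha> T e t) (G f) = (LBINT s:{t..T}. memory_kernel \<alpha> (s - t) *\<^sub>R blinfun_apply (e s) (G f))"
          unfolding rl_integral_right_eq_left set_integral_reflect[of t T]
          using \<alpha> by (subst rl_integral_left_apply[OF _ er Lf]) (simp_all add: algebra_simps)
        also have "\<dots> = (LBINT s:{t..T}. inner f (- (memory_kernel \<alpha> (s - t) *\<^sub>R \<Psi> s)))"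
          unfolding set_lebesgue_integral_def
        proof (rule integral_cong_AE)
          show "(\<lambda>s. indicat_real {t..T} s *\<^sub>R memory_kernel \<alpha> (s - t) *\<^sub>R blinfun_apply (e s) (G f)) \<in> borel_measurable lborel"
            using key[OF integrable_bounded_linear[OF Lf e]] unfolding set_integrable_def by (rule borel_measurable_integrable)
          show "(\<lambda>s. indicat_real {t..T} s *\<^sub>R inner f (- (memory_kernel \<alpha> (s - t) *\<^sub>R \<Psi> s))) \<in> borel_measurable lborel"
            using set_integral_bounded_linear(1)[OF bounded_linear_compose[OF bounded_linear_inner_right bounded_linear_minus[OF bounded_linear_ident]] key[OF \<Psi>], of f]
            unfolding set_integrable_def by (rule borel_measurable_integrable)
          show "AE s in lborel. indicat_real {t..T} s *\<^sub>R memory_kernel \<alpha> (s - t) *\<^sub>R blinfun_apply (e s) (G f)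
              = indicat_real {t..T} s *\<^sub>R inner f (- (memory_kernel \<alpha> (s - t) *\<^sub>R \<Psi> s))"
            using equ
          proof eventually_elim
            case (elim s)
            show ?case
            proof (cases "s \<in> {0<..<T}")
              case True
              then have "blinfun_apply (d2 s) (G f) + a_form \<mu> (\<psi> s) (G f) = 0" using elim by blast
              then have "blinfun_apply (d2 s) (G f) = - inner f (h01_to_l2 (\<psi> s))"
                by (simp add: a_form_G_right eq_neg_iff_add_eq_0)
              then show ?thesis using True by (simp add: e_def \<Psi>_def)
            qed (simp add: e_def \<Psi>_def)
          qed
        qed
        also have "\<dots> = inner f (- (LBINT s:{t..T}. memory_kernel \<alpha> (s - t) *\<^sub>R \<Psi> s))"
          using set_integral_bounded_linear(2)[OF bounded_linear_compose[OF bounded_linear_inner_right bounded_linear_minus[OF bounded_linear_ident]] key[OF \<Psi>], of f] .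
        finally show "inner f (L_inv (\<Psi> t)) = inner f (memory_kernel \<alpha> (T - t) *\<^sub>R L_inv r - (LBINT s:{t..T}. memory_kernel \<alpha> (s - t) *\<^sub>R \<Psi> s))"
          by (simp add: inner_diff_right)
      qed
    qed
  qed
qed

end

lemma linf_bounded_version:
  assumes "linf T q"
  obtains q' C where "q' \<in> borel_measurable borel" "\<And>t. \<bar>q' t\<bar> \<le> C" "AE t\<in>{0<..<T} in lborel. q t = q' t"
proof -
  have m: "(\<lambda>t. indicator {0<..<T} t * q t) \<in> borel_measurable borel"
    using assms by (simp add: linf_def set_borel_measurable_def)
  obtain C where C: "AE t\<in>{0<..<T} in lborel. \<bar>q t\<bar> \<le> C" using assms by (auto simp: linf_def)
  define q' where "q' t = max (- \<bar>C\<bar>) (min \<bar>C\<bar> (indicator {0<..<T} t * q t))" for t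
  show thesis
  proof (rule that[of q' "\<bar>C\<bar>"])
    show "q' \<in> borel_measurable borel" unfolding q'_def using m by measurable
    show "\<bar>q' t\<bar> \<le> \<bar>C\<bar>" for t unfolding q'_def by linarith
    show "AE t\<in>{0<..<T} in lborel. q t = q' t"
      using C by eventually_elim (auto simp: q'_def)
  qed
qed

section \<open>The gradient of the Tikhonov functional\<close>

lemma tikhonov_has_derivative:
  assumes A: "bounded_linear (\<lambda>p. residual u T \<omega> p - residual u T \<omega> 0)"
  shows "(tikhonov u T \<omega> lam has_derivative
    (\<lambda>h. inner (residual u T \<omega> p) (residual u T \<omega> h - residual u T \<omega> 0) + lam * inner p h)) (at p)"
proof -
  define A where "A p = residual u T \<omega> p - residual u T \<omega> 0" for p
  have A': "(A has_derivative A) (at p)" using assms unfolding A_def[abs_def] by (rule bounded_linear_imp_has_derivative)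
  have "tikhonov u T \<omega> lam = (\<lambda>p. inner (A p + residual u T \<omega> 0) (A p + residual u T \<omega> 0) / 2 + lam / 2 * inner p p)"
    by (rule ext) (simp add: tikhonov_def A_def power2_norm_eq_inner)
  then show ?thesis
    by (auto intro!: derivative_eq_intros A' simp: A_def[symmetric] inner_commute)
       (simp add: A_def inner_commute algebra_simps)
qed

theorem theorem3:
  fixes T \<alpha> \<mu> lam :: real and q :: "real \<Rightarrow> real"
    and u0 :: h01 and u1 \<omega>obs p :: l2
    and u :: "l2 \<Rightarrow> real \<Rightarrow> h01" and \<psi> :: "real \<Rightarrow> h01"
  assumes "T > 0" and "1 < \<alpha>" and "\<alpha> < 2" and "\<mu> < 1/4" and "lam > 0"
    and "linf T q"
    and "\<And>p'. weak_solution \<mu> \<alpha> T q u0 u1 p' (u p')"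
    and "adjoint_solution \<mu> \<alpha> T (residual u T \<omega>obs p) \<psi>"
  shows "tikhonov u T \<omega>obs lam differentiable_on UNIV \<and>
    (GDERIV (tikhonov u T \<omega>obs lam) p :>
      (LBINT t:{0<..<T}. q t *\<^sub>R h01_to_l2 (\<psi> t)) + lam *\<^sub>R p)"
proof -
  obtain G where G: "bounded_linear G" "\<And>f v. a_form \<mu> (G f) v = inner f (h01_to_l2 v)"
    using elliptic_solution_operator[OF assms(4)] by blast
  interpret elliptic_inverse \<mu> G by (rule elliptic_inverse.intro[OF assms(4) G])
  obtain q' C where q': "q' \<in> borel_measurable borel" "\<And>t. \<bar>q' t\<bar> \<le> C" "AE t\<in>{0<..<T} in lborel. q t = q' t"
    using linf_bounded_version[OF assms(6)] by blast
  define w where "w p t = h01_to_l2 (u p t) - h01_to_l2 (u 0 t)" for p t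
  have cu: "continuous_on {0..T} (\<lambda>t. h01_to_l2 (u p t))" for p
    using assms(7)[of p] by (intro bounded_linear.continuous_on[OF bounded_linear_h01_to_l2]) (simp add: weak_solution_def)
  interpret volterra_source_problem L_inv "memory_kernel \<alpha>" q' T C w
  proof (rule volterra_source_problem.intro)
    fix p t assume t: "t \<in> {0..T}"
    note int = volterra_integrand_integrable(2)[OF continuous_memory_kernel[OF assms(2)] q'(1,2) cu t]
    note V = weak_solution_volterra[OF assms(2,3) assms(7) q' t]
    have "L_inv (w p t) = L_inv (h01_to_l2 (u p t)) - L_inv (h01_to_l2 (u 0 t))"
      by (simp add: w_def linear_diff[OF bounded_linear.linear[OF bounded_linear_L_inv]])
    also have "\<dots> = (LBINT s:{0..t}. memory_kernel \<alpha> (t - s) *\<^sub>R (q' s *\<^sub>R L_inv p - h01_to_l2 (u p s))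
        - memory_kernel \<alpha> (t - s) *\<^sub>R (q' s *\<^sub>R L_inv 0 - h01_to_l2 (u 0 s)))"
      \<comment> \<open>the contributions of the initial values are the same for both sources\<close>
      unfolding V[of p] V[of 0] by (subst set_integral_diff(2)[OF int int]) simp
    also have "\<dots> = (LBINT s:{0..t}. memory_kernel \<alpha> (t - s) *\<^sub>R (q' s *\<^sub>R L_inv p - w p s))"
      by (intro set_lebesgue_integral_cong)
         (auto simp: w_def algebra_simps linear_0[OF bounded_linear.linear[OF bounded_linear_L_inv]])
    finally show "L_inv (w p t) = (LBINT s:{0..t}. memory_kernel \<alpha> (t - s) *\<^sub>R (q' s *\<^sub>R L_inv p - w p s))" .
  next
    show "continuous_on {0..T} (w p)" for p unfolding w_def[abs_def] by (intro continuous_intros cu)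
    show "inner y (w p t) = 0" if "L_inv y = 0" for p t y
      using kernel_L_inv_orthogonal[OF that] by (simp add: w_def inner_diff_right)
  qed (use assms(1) bounded_linear_L_inv L_inv_symmetric continuous_memory_kernel[OF assms(2)] q' in auto)
  have A: "residual u T \<omega>obs h - residual u T \<omega>obs 0 = w h T" for h
    by (simp add: residual_def forward_operator_def w_def)
  have D: "(tikhonov u T \<omega>obs lam has_derivative (\<lambda>h. inner (residual u T \<omega>obs x) (w h T) + lam * inner x h)) (at x)" for x
    using tikhonov_has_derivative[of u T \<omega>obs lam x] bounded_linear_final_value by (simp add: A)
  define \<Psi> where "\<Psi> = (\<lambda>s. indicator {0<..<T} s *\<^sub>R h01_to_l2 (\<psi> s))"
  have \<Psi>: "integrable lborel \<Psi>"
    "AE t\<in>{0<..<T} in lborel. L_inv (\<Psi> t) = memory_kernel \<alpha> (T - t) *\<^sub>R L_inv (residual u T \<omega>obs p)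
      - (LBINT s:{t..T}. memory_kernel \<alpha> (s - t) *\<^sub>R \<Psi> s)"
    unfolding \<Psi>_def by (rule adjoint_solution_volterra[OF assms(2,3,8)])+
  have \<Psi>T: "set_integrable lborel {0..T} \<Psi>"
    by (rule integrable_imp_set_integrable[OF \<Psi>(1)]) simp
  have pair: "inner (residual u T \<omega>obs p) (w h T) = inner (LBINT t:{0..T}. q' t *\<^sub>R \<Psi> t) h" for h
    by (rule final_value_adjoint[OF \<Psi>T _ \<Psi>(2)])
       (simp add: \<Psi>_def kernel_L_inv_orthogonal inner_commute)
  have grad: "(LBINT t:{0<..<T}. q t *\<^sub>R h01_to_l2 (\<psi> t)) = (LBINT t:{0..T}. q' t *\<^sub>R \<Psi> t)"
    unfolding set_lebesgue_integral_def
  proof (rule integral_cong_AE)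
    have \<Psi>m: "\<Psi> \<in> borel_measurable borel" using \<Psi>(1) by auto
    have "(\<lambda>t. indicator {0<..<T} t * q t) \<in> borel_measurable borel"
      using assms(6) by (simp add: linf_def set_borel_measurable_def)
    then have "(\<lambda>t. (indicator {0<..<T} t * q t) *\<^sub>R \<Psi> t) \<in> borel_measurable lborel" using \<Psi>m by simp
    moreover have "(indicator {0<..<T} t * q t) *\<^sub>R \<Psi> t = indicat_real {0<..<T} t *\<^sub>R q t *\<^sub>R h01_to_l2 (\<psi> t)" for t
      by (auto simp: \<Psi>_def indicator_def)
    ultimately show "(\<lambda>t. indicat_real {0<..<T} t *\<^sub>R q t *\<^sub>R h01_to_l2 (\<psi> t)) \<in> borel_measurable lborel" by simp
    show "(\<lambda>t. indicat_real {0..T} t *\<^sub>R q' t *\<^sub>R \<Psi> t) \<in> borel_measurable lborel"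
      using q'(1) \<Psi>m by simp
    show "AE t in lborel. indicat_real {0<..<T} t *\<^sub>R q t *\<^sub>R h01_to_l2 (\<psi> t) = indicat_real {0..T} t *\<^sub>R q' t *\<^sub>R \<Psi> t"
      using q'(3) by eventually_elim (auto simp: \<Psi>_def indicator_def)
  qed
  show ?thesis
  proof
    show "tikhonov u T \<omega>obs lam differentiable_on UNIV"
      using D by (auto simp: differentiable_on_def differentiable_def)
    have "(\<lambda>h. inner (residual u T \<omega>obs p) (w h T) + lam * inner p h)
        = (\<lambda>h. inner h ((LBINT t:{0<..<T}. q t *\<^sub>R h01_to_l2 (\<psi> t)) + lam *\<^sub>R p))"
      unfolding pair grad by (simp add: inner_add_right inner_commute)
    then show "GDERIV (tikhonov u T \<omega>obs lam) p :> (LBINT t:{0<..<T}. q t *\<^sub>R h01_to_l2 (\<psi> t)) + lam *\<^sub>R p"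
      unfolding gderiv_def using D[of p] by simp
  qed
qed

end
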